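(* Suppose that $(G,c)$ is an infinite connected locally finite network. Let $\kappa(t):=\kappa(G,t)$. Suppose that $s_0:=\inf_{s>0}\kappa(s)>0$ and $$\sum_{k\ge 0}\frac{1}{\kappa(s_k)}<\infty,$$ where $s_k$ is defined recursively by $s_{k+1}:=s_k+\kappa(s_k)/2$ for $k\in\mathbb{N}=\{0,1,2,\dots\}$. Then $\mathsf{WSF}$-a.s. every tree has only one end.
   Context: A network $(G,c)$ is a graph $G=(\mathsf V,\mathsf E)$ with a function $c:\mathsf E\to(0,\infty)$ (edge conductances). For a set $F$ of edges, $|F|_c:=\sum_{e\in F}c(e)$. For $K\subset\mathsf V$, $\partial_{\mathsf E}K$ is the set of edges with exactly one endpoint in $K$, and $\pi(K)$ is the sum of $c(e)$ over all oriented edges $e$ whose tail is in $K$ (each edge of $G$ gives two oriented edges). Define $$\kappa(G,t):=\inf\{|\partial_{\mathsf E}K|_c : K\subset\mathsf V \text{ finite and connected},\ t\le\pi(K)\},$$ with $\inf\emptyset=\infty$. For a finite connected network, the uniform spanning tree is the random spanning tree $T$ chosen with probability proportional to $\prod_{e\in T}c(e)$. Let an infinite connected network $G$ be exhausted by finite connected subnetworks $G_0\subset G_1\subset\cdots$ with $\bigcup_n G_n=G$, and let $G_n^*$ be obtained from $G$ by identifying all vertices outside $G_n$ to a single vertex and dropping loops (multiple edges are kept). The wired uniform spanning forest $\mathsf{WSF}$ on $G$ is the weak limit, as $n\to\infty$, of the laws of the uniform spanning trees of $G_n^*$ (as random sets of edges); it exists and does not depend on the exhaustion, and is supported on spanning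 forests of $G$ all of whose trees are infinite. The ends of a tree are the equivalence classes of infinite simple paths in it, two paths being equivalent if their symmetric difference is finite. *)

theory Defs
  imports "HOL-Probability.Probability" "Graph_Theory.Graph_Theory"
begin

text \<open>
  A graph is an undirected multigraph, encoded as a \<^typ>\<open>('v, 'e) pre_digraph\<close>: an element of
  \<^term>\<open>arcs G\<close> is one undirected edge, and \<^term>\<open>tail G\<close>, \<^term>\<open>head G\<close> only record its two
  endpoints in an arbitrary reference order, on which no notion below depends.  Loops and multiple
  edges are allowed.  The library's \<^const>\<open>Digraph_Component.connected\<close> and \<^const>\<open>subgraph\<close> fit
  this reading; its \<^const>\<open>forest\<close> and \<^const>\<open>tree\<close> do not, since they only exclude directed
  cycles, and so undirected cycles are defined here.
\<close>

locale network = wf_digraph G for G :: "('v, 'e) pre_digraph" +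
  fixes c :: "'e \<Rightarrow> real"
  assumes conductance_pos: "e \<in> arcs G \<Longrightarrow> 0 < c e"

definition locally_finite :: "('v, 'e) pre_digraph \<Rightarrow> bool" where
  "locally_finite G \<longleftrightarrow> (\<forall>v\<in>verts G. finite (out_arcs G v \<union> in_arcs G v))"

definition joins :: "('v, 'e) pre_digraph \<Rightarrow> 'e \<Rightarrow> 'v \<Rightarrow> 'v \<Rightarrow> bool" where
  "joins G e u v \<longleftrightarrow> e \<in> arcs G \<and>
     (tail G e = u \<and> head G e = v \<or> tail G e = v \<and> head G e = u)"


subsection \<open>Isoperimetric profile\<close>

definition edge_boundary :: "('v, 'e) pre_digraph \<Rightarrow> 'v set \<Rightarrow> 'e set" where
  "edge_boundary G K = {e \<in> arcs G. (tail G e \<in> K) \<noteq> (head G e \<in> K)}"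

text \<open>
  The two oriented edges given by \<open>e\<close> have tails \<^term>\<open>tail G e\<close> and \<^term>\<open>head G e\<close>; a loop at a
  vertex of \<open>K\<close> is therefore counted twice.
\<close>

definition vol :: "('v, 'e) pre_digraph \<Rightarrow> ('e \<Rightarrow> real) \<Rightarrow> 'v set \<Rightarrow> real" where
  "vol G c K = (\<Sum>v\<in>K. (\<Sum>e\<in>out_arcs G v. c e) + (\<Sum>e\<in>in_arcs G v. c e))"

text \<open>
  For locally finite \<open>G\<close> and finite \<open>K\<close> all sums involved are finite.  The empty set, which does
  not count as connected, would only matter for \<open>t = 0\<close>.
\<close>

definition kappa :: "('v, 'e) pre_digraph \<Rightarrow> ('e \<Rightarrow> real) \<Rightarrow> ennreal \<Rightarrow> ennreal" where
  "kappa G c t =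
     (INF K\<in>{K. K \<subseteq> verts G \<and> finite K \<and> Digraph_Component.connected (G \<restriction> K) \<and>
                t \<le> ennreal (vol G c K)}.
        ennreal (\<Sum>e\<in>edge_boundary G K. c e))"


subsection \<open>Uniform spanning trees of finite networks\<close>

definition has_cycle :: "('v, 'e) pre_digraph \<Rightarrow> bool" where
  "has_cycle G \<longleftrightarrow> (\<exists>vs es. es \<noteq> [] \<and> length vs = length es \<and> distinct vs \<and> distinct es \<and>
     (\<forall>i<length es. joins G (es ! i) (vs ! i) (vs ! (Suc i mod length es))))"

definition spanning_trees :: "('v, 'e) pre_digraph \<Rightarrow> 'e set set" where
  "spanning_trees G = {T. T \<subseteq> arcs G \<and>
     Digraph_Component.connected (G\<lparr>arcs := T\<rparr>) \<and> \<not> has_cycle (G\<lparr>arcs := T\<rparr>)}"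

definition ust :: "('v, 'e) pre_digraph \<Rightarrow> ('e \<Rightarrow> real) \<Rightarrow> 'e set pmf" where
  "ust G c = embed_pmf (\<lambda>T. if T \<in> spanning_trees G
     then (\<Prod>e\<in>T. c e) / (\<Sum>T'\<in>spanning_trees G. \<Prod>e\<in>T'. c e) else 0)"


subsection \<open>The wired uniform spanning forest\<close>

definition exhaustion :: "('v, 'e) pre_digraph \<Rightarrow> (nat \<Rightarrow> ('v, 'e) pre_digraph) \<Rightarrow> bool" where
  "exhaustion G H \<longleftrightarrow>
     (\<forall>n. subgraph (H n) G \<and> fin_digraph (H n) \<and> Digraph_Component.connected (H n) \<and>
          subgraph (H n) (H (Suc n))) \<and>
     (\<Union>n. verts (H n)) = verts G \<and> (\<Union>n. arcs (H n)) = arcs G"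

text \<open>
  The vertices outside \<open>K\<close> are identified to \<^const>\<open>None\<close>.  The surviving edges keep their names, so
  sets of edges of the contracted graph are sets of edges of \<open>G\<close>.
\<close>

definition collapse :: "'v set \<Rightarrow> 'v \<Rightarrow> 'v option" where
  "collapse K v = (if v \<in> K then Some v else None)"

definition wired :: "('v, 'e) pre_digraph \<Rightarrow> 'v set \<Rightarrow> ('v option, 'e) pre_digraph" where
  "wired G K =
     \<lparr>verts = collapse K ` verts G,
      arcs = {e \<in> arcs G. collapse K (tail G e) \<noteq> collapse K (head G e)},
      tail = collapse K \<circ> tail G,
      head = collapse K \<circ> head G\<rparr>"

text \<open>
  A random set of edges from \<open>E\<close> is a random element of the product space \<open>{0,1}\<^sup>E\<close>, whose points
  are the indicator functions that are \<^const>\<open>undefined\<close> off \<open>E\<close>.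
\<close>

definition config_topology :: "'e set \<Rightarrow> ('e \<Rightarrow> bool) topology" where
  "config_topology E = product_topology (\<lambda>_. discrete_topology UNIV) E"

definition config_space :: "'e set \<Rightarrow> ('e \<Rightarrow> bool) measure" where
  "config_space E = PiM E (\<lambda>_. count_space UNIV)"

definition config_law :: "'e set \<Rightarrow> 'e set pmf \<Rightarrow> ('e \<Rightarrow> bool) measure" where
  "config_law E p = distr (measure_pmf p) (config_space E) (\<lambda>T. \<lambda>e\<in>E. e \<in> T)"

definition weak_limit :: "'a topology \<Rightarrow> (nat \<Rightarrow> 'a measure) \<Rightarrow> 'a measure \<Rightarrow> bool" where
  "weak_limit X M N \<longleftrightarrow>
     (\<forall>f. continuous_map X euclideanreal f \<and> bounded (f ` topspace X) \<longrightarrow>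
          (\<lambda>n. \<integral>x. f x \<partial>M n) \<longlonglongrightarrow> (\<integral>x. f x \<partial>N))"

text \<open>
  \<open>is_wsf G c P\<close>: \<open>P\<close> is the law of the wired uniform spanning forest.  As the limit does not
  depend on the exhaustion, it does not matter that only one exhaustion is asked for.
\<close>

definition is_wsf :: "('v, 'e) pre_digraph \<Rightarrow> ('e \<Rightarrow> real) \<Rightarrow> ('e \<Rightarrow> bool) measure \<Rightarrow> bool" where
  "is_wsf G c P \<longleftrightarrow> prob_space P \<and> sets P = sets (config_space (arcs G)) \<and>
     (\<exists>H. exhaustion G H \<and>
        weak_limit (config_topology (arcs G))
          (\<lambda>n. config_law (arcs G) (ust (wired G (verts (H n))) c)) P)"


subsection \<open>Trees of the forest and their ends\<close>

definition open_subgraph :: "('v, 'e) pre_digraph \<Rightarrow> ('e \<Rightarrow> bool) \<Rightarrow> ('v, 'e) pre_digraph" where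
  "open_subgraph G \<omega> = G\<lparr>arcs := {e \<in> arcs G. \<omega> e}\<rparr>"

definition components_of_graph :: "('v, 'e) pre_digraph \<Rightarrow> ('v, 'e) pre_digraph set" where
  "components_of_graph F = {T. pre_digraph.max_subgraph F Digraph_Component.connected T}"

text \<open>
  Infinite simple paths are given by their vertices; in a tree these determine the edges, and the
  symmetric differences of the vertex sets and of the edge sets of two paths are both finite or
  both infinite.
\<close>

definition rays :: "('v, 'e) pre_digraph \<Rightarrow> (nat \<Rightarrow> 'v) set" where
  "rays T = {x. inj x \<and> (\<forall>i. \<exists>e. joins T e (x i) (x (Suc i)))}"

definition ends_of_tree :: "('v, 'e) pre_digraph \<Rightarrow> (nat \<Rightarrow> 'v) set set" where
  "ends_of_tree T = rays T //
     {(x, y) \<in> rays T \<times> rays T. finite ((range x - range y) \<union> (range y - range x))}"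

end

theory Submission
  imports Defs
begin

text \<open>
  Fix an edge \<open>e\<close> and finite sets \<open>K\<close> that nearly minimise the edge boundary among their finite
  supersets.  Minimality passes a quarter of the isoperimetric profile on to the graph outside \<open>K\<close>, so
  resistances there are bounded, and small between large sets.  In a wired finite graph reveal the spanning
  tree \<open>T\<close> on the edges touching \<open>K\<close>, except \<open>e\<close>, and let \<open>q\<close> be the conditional probability of \<open>e \<in> T\<close>.
  Suppose that both endpoints of \<open>e\<close> are joined to the outside of \<open>K\<close> by revealed edges.  The resistance
  bounds then keep \<open>q\<close> away from 1, and, unless \<open>q\<close> is small, one of the two clusters has bounded volume
  outside \<open>K\<close>.  Let \<open>D\<close> be the number of edges of \<open>T\<close> that are about to leave that cluster.  Swapping \<open>e\<close> with
  an edge leaving the cluster relates the pairs \<open>D = k, e \<in> T\<close> and \<open>D = k + 1, e \<notin> T\<close>, and \<open>D\<close> has bounded mean;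
  this forces \<open>q\<close> to change by a definite amount once \<open>D\<close> is known.  Since \<open>q\<close> is a bounded martingale as \<open>K\<close> grows,
  this happens rarely.  Hence it is unlikely, uniformly in the finite graph, that \<open>e \<in> T\<close> and both sides of \<open>e\<close>
  reach far.  In the limit almost surely every open edge has a finite side, so all rays of a tree
  are equivalent.
\<close>

subsection \<open>Spanning trees of finite networks\<close>

text \<open>Conditioning on the edges that touch \<open>K\<close> contracts some of them and deletes
  the rest. Deletion is the obstacle: a set outside \<open>K\<close> may have most of its boundary
  towards \<open>K\<close>, and isoperimetry would be lost. But adding such a set to
  \<open>K\<close> would lower the boundary of \<open>K\<close>, and this is what near minimality
  forbids. Potentials are expressed as weights of spanning trees, so all that is used about currents
  is one identity, \<open>flow\<close>, tested against indicators of level sets. Isoperimetry enters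
  as growth of clusters while the level descends. Revealing more edges need not move
  \<open>q\<close> by itself. The count \<open>D\<close> is a place where it must move, because
  \<open>D = 0\<close> forces \<open>e \<in> T\<close> while \<open>q\<close> stays away from 1. All
  constants depend only on \<open>c e\<close>, the threshold for \<open>q\<close> and the profile.
  This is used twice: the gains of many stages are charged to one bounded second moment, and for a
  fixed number of stages the estimate concerns finitely many edges, hence passes to the weak limit.
  The number of stages grows only afterwards.\<close>

definition adj :: "('e \<Rightarrow> 'w) \<Rightarrow> ('e \<Rightarrow> 'w) \<Rightarrow> 'e set \<Rightarrow> ('w \<times> 'w) set" where
  "adj src tgt T = (\<Union>f\<in>T. {(src f, tgt f), (tgt f, src f)})"

text \<open>Connectivity is a relation on edge sets with arbitrary end maps, so the same notion
  serves \<open>G\<close>, the wired graphs and all subsets of their edges.\<close>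

definition econn :: "('e \<Rightarrow> 'w) \<Rightarrow> ('e \<Rightarrow> 'w) \<Rightarrow> 'e set \<Rightarrow> 'w \<Rightarrow> 'w \<Rightarrow> bool" where
  "econn src tgt T x y \<longleftrightarrow> (x, y) \<in> (adj src tgt T)\<^sup>*"

lemma econn_refl [simp, intro]: "econn src tgt T x x"
  by (simp add: econn_def)

lemma econn_sym: "econn src tgt T x y \<Longrightarrow> econn src tgt T y x"
proof -
  have "sym (adj src tgt T)" by (auto simp: sym_def adj_def)
  then show "econn src tgt T x y \<Longrightarrow> econn src tgt T y x"
    unfolding econn_def by (meson sym_rtrancl symD)
qed

lemma econn_commute: "econn src tgt T x y \<longleftrightarrow> econn src tgt T y x"
  using econn_sym by metis

lemma econn_trans [trans]: "econn src tgt T x y \<Longrightarrow> econn src tgt T y z \<Longrightarrow> econn src tgt T x z"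
  unfolding econn_def by (rule rtrancl_trans)

lemma econn_cong_right: "econn src tgt T x y \<Longrightarrow> econn src tgt T z x \<longleftrightarrow> econn src tgt T z y"
  by (blast intro: econn_trans econn_sym)

lemma econn_cong_left: "econn src tgt T x y \<Longrightarrow> econn src tgt T x z \<longleftrightarrow> econn src tgt T y z"
  by (blast intro: econn_trans econn_sym)

lemma econn_mono: "econn src tgt S x y \<Longrightarrow> S \<subseteq> T \<Longrightarrow> econn src tgt T x y"
  unfolding econn_def by (rule subsetD[OF rtrancl_mono]) (auto simp: adj_def)

lemma econn_edge: "f \<in> T \<Longrightarrow> econn src tgt T (src f) (tgt f)"
  unfolding econn_def by (rule r_into_rtrancl) (auto simp: adj_def)

lemma econn_induct [consumes 1, case_names refl step]:
  assumes "econn src tgt T x y" "P x"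
    and "\<And>u v f. econn src tgt T x u \<Longrightarrow> P u \<Longrightarrow> f \<in> T \<Longrightarrow>
      (src f = u \<and> tgt f = v \<or> src f = v \<and> tgt f = u) \<Longrightarrow> P v"
  shows "P y"
proof -
  from assms(1) have "(x, y) \<in> (adj src tgt T)\<^sup>*" by (simp add: econn_def)
  then show ?thesis
  proof (induction rule: rtrancl_induct)
    case base show ?case by (rule assms(2))
  next
    case (step u v)
    then obtain f where "f \<in> T" "src f = u \<and> tgt f = v \<or> src f = v \<and> tgt f = u"
      by (auto simp: adj_def)
    with step show ?case by (intro assms(3)[of u f v]) (auto simp: econn_def)
  qed
qed

text \<open>Replaces arguments along paths: with \<open>\<phi>\<close> the membership in a set that
  no edge of \<open>T\<close> leaves, it keeps a whole component inside or outside that set.\<close>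

lemma econn_const:
  assumes "econn src tgt T x y" "\<And>f. f \<in> T \<Longrightarrow> \<phi> (src f) = \<phi> (tgt f)"
  shows "\<phi> x = \<phi> y"
  using assms(1) by (induction rule: econn_induct) (use assms(2) in metis)+

lemma econn_image:
  assumes "econn src tgt T x y"
    and "\<And>f. f \<in> T \<Longrightarrow> econn src' tgt' T' (h (src f)) (h (tgt f))"
  shows "econn src' tgt' T' (h x) (h y)"
  using assms(1)
proof (induction rule: econn_induct)
  case refl show ?case by simp
next
  case (step u v f)
  then show ?case using assms(2)[of f] econn_sym econn_trans by metis
qed

lemma econn_insert_cases:
  assumes "econn src tgt (insert g T) x y"
  shows "econn src tgt T x y \<or> econn src tgt T x (src g) \<and> econn src tgt T (tgt g) y
    \<or> econn src tgt T x (tgt g) \<and> econn src tgt T (src g) y"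
  using assms
proof (induction rule: econn_induct)
  case refl show ?case by simp
next
  case (step u v f)
  show ?case
  proof (cases "f = g")
    case True
    show ?thesis using step.IH step.hyps(3) unfolding True by (elim disjE conjE; simp)
  next
    case False
    then have "econn src tgt T (src f) (tgt f)" using step.hyps(2) by (intro econn_edge) simp
    then have "econn src tgt T u v" using step.hyps(3) by (auto intro: econn_sym)
    then show ?thesis using step.IH by (blast intro: econn_trans)
  qed
qed

section \<open>Weights of spanning trees, edge exchange and the current law\<close>

locale fin_net =
  fixes src tgt :: "'e \<Rightarrow> 'w" and V :: "'w set" and E :: "'e set" and c :: "'e \<Rightarrow> real"
  assumes finite_E: "finite E"
    and src_V: "f \<in> E \<Longrightarrow> src f \<in> V" and tgt_V: "f \<in> E \<Longrightarrow> tgt f \<in> V"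
    and c_pos: "f \<in> E \<Longrightarrow> 0 < c f"
begin

abbreviation conn :: "'e set \<Rightarrow> 'w \<Rightarrow> 'w \<Rightarrow> bool" where "conn \<equiv> econn src tgt"

text \<open>Acyclicity is stated edge by edge: an edge lies on a cycle of \<open>T\<close> iff its
  ends stay connected in \<open>T - {f}\<close>. Loops are excluded too, since \<open>conn\<close>
  is reflexive.\<close>

definition ST :: "'e set set" where
  "ST = {T. T \<subseteq> E \<and> (\<forall>x\<in>V. \<forall>y\<in>V. conn T x y) \<and> (\<forall>f\<in>T. \<not> conn (T - {f}) (src f) (tgt f))}"

definition wt :: "'e set \<Rightarrow> real" where "wt T = (\<Prod>f\<in>T. c f)"

text \<open>An unnormalised probability: dividing by \<open>W (\<lambda>T. True)\<close> gives the
  law of the random tree, and conditional probabilities are quotients of two values of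
  \<open>W\<close>.\<close>

definition W :: "('e set \<Rightarrow> bool) \<Rightarrow> real" where "W P = sum wt {T\<in>ST. P T}"

lemma finite_ST [simp]: "finite ST"
  by (rule finite_subset[OF _ finite_Pow_iff[THEN iffD2, OF finite_E]]) (auto simp: ST_def)

lemma ST_sub: "T \<in> ST \<Longrightarrow> T \<subseteq> E" and ST_conn: "T \<in> ST \<Longrightarrow> x \<in> V \<Longrightarrow> y \<in> V \<Longrightarrow> conn T x y"
  and ST_sep: "T \<in> ST \<Longrightarrow> f \<in> T \<Longrightarrow> \<not> conn (T - {f}) (src f) (tgt f)"
  by (auto simp: ST_def)

lemma wt_pos: "T \<in> ST \<Longrightarrow> 0 < wt T"
  unfolding wt_def by (rule prod_pos) (use ST_sub c_pos in blast)

lemma W_nonneg: "0 \<le> W P"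
  unfolding W_def by (rule sum_nonneg) (auto dest: wt_pos)

lemma W_mono: "(\<And>T. T \<in> ST \<Longrightarrow> P T \<Longrightarrow> Q T) \<Longrightarrow> W P \<le> W Q"
  unfolding W_def by (rule sum_mono2) (auto dest: wt_pos intro: less_imp_le)

lemma W_cong: "(\<And>T. T \<in> ST \<Longrightarrow> P T \<longleftrightarrow> Q T) \<Longrightarrow> W P = W Q"
  unfolding W_def by (rule sum.cong) auto

lemma W_split: "W P = W (\<lambda>T. P T \<and> Q T) + W (\<lambda>T. P T \<and> \<not> Q T)"
  unfolding W_def by (subst sum.union_disjoint[symmetric]) (auto intro!: sum.cong)

lemma W_partition:
  assumes "finite I" "\<And>T. T \<in> ST \<Longrightarrow> P T \<Longrightarrow> \<phi> T \<in> I"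
  shows "W P = (\<Sum>i\<in>I. W (\<lambda>T. P T \<and> \<phi> T = i))"
proof -
  have "W P = (\<Sum>i\<in>I. sum wt {x \<in> {T\<in>ST. P T}. \<phi> x = i})"
    unfolding W_def by (subst sum.group) (use assms in auto)
  also have "\<dots> = (\<Sum>i\<in>I. W (\<lambda>T. P T \<and> \<phi> T = i))"
    unfolding W_def by (intro sum.cong) auto
  finally show ?thesis .
qed

lemma two_classes:
  assumes "T \<in> ST" "f \<in> T" "x \<in> V"
  shows "conn (T - {f}) (tgt f) x \<longleftrightarrow> \<not> conn (T - {f}) (src f) x"
proof -
  have fE: "f \<in> E" using assms ST_sub by blast
  have "conn (insert f (T - {f})) (src f) x"
    using ST_conn[OF assms(1) src_V[OF fE] assms(3)] assms(2) by (simp add: insert_absorb)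
  from econn_insert_cases[OF this] ST_sep[OF assms(1,2)] show ?thesis
    using econn_trans econn_sym by metis
qed

lemma two_classes_any:
  assumes "T \<in> ST" "f \<in> T" "x \<in> V" "y \<in> V" "z \<in> V" "\<not> conn (T - {f}) x y"
  shows "conn (T - {f}) y z \<longleftrightarrow> \<not> conn (T - {f}) x z"
  using two_classes[OF assms(1,2)] assms(3-6) econn_trans econn_sym by metis

text \<open>\<open>T - {f}\<close> has two components and \<open>g\<close> joins them. If another
  edge \<open>k\<close> lay on a cycle of the new set, that cycle would use \<open>g\<close>, and
  the rest of it, through \<open>k\<close>, would connect the ends of \<open>g\<close> in
  \<open>T - {f}\<close>.\<close>

lemma exchange:
  assumes "T \<in> ST" "f \<in> T" "g \<in> E" "\<not> conn (T - {f}) (src g) (tgt g)"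
  shows "insert g (T - {f}) \<in> ST"
proof -
  let ?F = "T - {f}"
  have gV: "src g \<in> V" "tgt g \<in> V" using assms(3) src_V tgt_V by auto
  have fV: "src f \<in> V" "tgt f \<in> V" using assms(1,2) ST_sub src_V tgt_V by blast+
  have "conn (insert g ?F) (src g) x" if "x \<in> V" for x
  proof (cases "conn ?F (src g) x")
    case True then show ?thesis by (rule econn_mono) auto
  next
    case False
    then have "conn ?F (tgt g) x" using two_classes_any[OF assms(1,2) gV that assms(4)] by blast
    then have "conn (insert g ?F) (tgt g) x" by (rule econn_mono) auto
    then show ?thesis using econn_edge[of g "insert g ?F" src tgt] econn_trans by (metis insertI1)
  qed
  then have 1: "\<forall>x\<in>V. \<forall>y\<in>V. conn (insert g ?F) x y" using econn_trans econn_sym by metis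
  have gF: "g \<notin> ?F" using assms(4) econn_edge by metis
  have "\<not> conn (insert g ?F - {k}) (src k) (tgt k)" if k: "k \<in> insert g ?F" for k
  proof (cases "k = g")
    case True then show ?thesis using assms(4) gF by simp
  next
    case False
    then have kF: "k \<in> ?F" and kg: "insert g ?F - {k} = insert g (?F - {k})" using k by auto
    show ?thesis
    proof
      assume "conn (insert g ?F - {k}) (src k) (tgt k)"
      then consider "conn (?F - {k}) (src k) (tgt k)"
        | "conn (?F - {k}) (src k) (src g)" "conn (?F - {k}) (tgt g) (tgt k)"
        | "conn (?F - {k}) (src k) (tgt g)" "conn (?F - {k}) (src g) (tgt k)"
        unfolding kg by (blast dest: econn_insert_cases)
      then show False
      proof cases
        case 1
        then have "conn (T - {k}) (src k) (tgt k)" by (rule econn_mono) auto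
        then show False using ST_sep assms(1) kF by blast
      next
        case 2
        then have "conn ?F (src k) (src g)" "conn ?F (tgt g) (tgt k)"
          by (auto elim!: econn_mono)
        then show False using assms(4) econn_edge[OF kF, of src tgt] econn_sym econn_trans by metis
      next
        case 3
        then have "conn ?F (src k) (tgt g)" "conn ?F (src g) (tgt k)"
          by (auto elim!: econn_mono)
        then show False using assms(4) econn_edge[OF kF, of src tgt] econn_sym econn_trans by metis
      qed
    qed
  qed
  then show ?thesis using 1 assms ST_sub unfolding ST_def by blast
qed

lemma wt_exchange:
  assumes "T \<in> ST" "f \<in> T" "g \<notin> T"
  shows "c f * wt (insert g (T - {f})) = c g * wt T"
proof -
  have fin: "finite T" using assms(1) ST_sub finite_E finite_subset by blast
  have "wt T = c f * wt (T - {f})" unfolding wt_def by (rule prod.remove[OF fin assms(2)])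
  moreover have "wt (insert g (T - {f})) = c g * wt (T - {f})"
    unfolding wt_def using fin assms(3) by (subst prod.insert) auto
  ultimately show ?thesis by simp
qed

text \<open>The sum telescopes along the tree path from \<open>x\<close> to \<open>y\<close>: an
  edge off that path has both points on the same side and contributes 0. To avoid paths, the proof
  shows that \<open>S v - \<phi> v\<close> does not change along any edge of
  \<open>T\<close>.\<close>

lemma tree_identity:
  fixes \<phi> :: "'w \<Rightarrow> real"
  assumes "T \<in> ST" "x \<in> V" "y \<in> V"
  shows "(\<Sum>f\<in>T. (\<phi> (src f) - \<phi> (tgt f)) *
      (of_bool (conn (T - {f}) (src f) x) - of_bool (conn (T - {f}) (src f) y))) = \<phi> x - \<phi> y"
proof -
  have fin: "finite T" using assms(1) ST_sub finite_E finite_subset by blast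
  define S where "S v = (\<Sum>f\<in>T. (\<phi> (src f) - \<phi> (tgt f)) * of_bool (conn (T - {f}) (src f) v))" for v
  have "S (src k) - \<phi> (src k) = S (tgt k) - \<phi> (tgt k)" if k: "k \<in> T" for k
  proof -
    have "S (src k) - S (tgt k) = (\<Sum>f\<in>T. (\<phi> (src f) - \<phi> (tgt f)) *
        (of_bool (conn (T - {f}) (src f) (src k)) - of_bool (conn (T - {f}) (src f) (tgt k))))"
      unfolding S_def by (simp add: sum_subtractf right_diff_distrib)
    also have "\<dots> = (\<Sum>f\<in>T. if f = k then \<phi> (src k) - \<phi> (tgt k) else 0)"
    proof (rule sum.cong)
      fix f assume f: "f \<in> T"
      have "conn (T - {f}) (src k) (tgt k)" if "f \<noteq> k" using that k by (intro econn_edge) auto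
      then have "conn (T - {f}) (src f) (src k) = conn (T - {f}) (src f) (tgt k)" if "f \<noteq> k"
        using that by (intro econn_cong_right)
      then show "(\<phi> (src f) - \<phi> (tgt f)) * (of_bool (conn (T - {f}) (src f) (src k)) -
          of_bool (conn (T - {f}) (src f) (tgt k))) = (if f = k then \<phi> (src k) - \<phi> (tgt k) else 0)"
        using ST_sep[OF assms(1) k] by auto
    qed simp
    also have "\<dots> = \<phi> (src k) - \<phi> (tgt k)" using k fin by simp
    finally show ?thesis by simp
  qed
  then have "S x - \<phi> x = S y - \<phi> y"
    using econn_const[OF ST_conn[OF assms], of "\<lambda>v. S v - \<phi> v"] by blast
  moreover have "S x - S y = (\<Sum>f\<in>T. (\<phi> (src f) - \<phi> (tgt f)) *
      (of_bool (conn (T - {f}) (src f) x) - of_bool (conn (T - {f}) (src f) y)))"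
    unfolding S_def by (simp add: sum_subtractf right_diff_distrib)
  ultimately show ?thesis by simp
qed

text \<open>Up to normalisation, this is the potential of the current flow between the endpoints of \<open>g\<close>.\<close>

definition side :: "'e set \<Rightarrow> 'e set \<Rightarrow> 'e \<Rightarrow> 'w \<Rightarrow> real" where
  "side R Q g v = W (\<lambda>T. T \<inter> R = Q \<and> g \<in> T \<and> conn (T - {g}) (src g) v)"

text \<open>Kirchhoff's current law in weak form, with test function \<open>\<phi>\<close>, after
  contracting \<open>Q\<close>, deleting the rest of \<open>R\<close> and removing \<open>g\<close>.
  A tree containing \<open>g\<close> with an edge \<open>f\<close> between the two components of
  \<open>T - {g}\<close> corresponds, by swapping \<open>g\<close> and \<open>f\<close>, to a tree
  without \<open>g\<close> with an edge \<open>f\<close> on its path between the ends of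
  \<open>g\<close>; along that path \<open>\<phi>\<close> telescopes.\<close>

lemma flow:
  fixes \<phi> :: "'w \<Rightarrow> real"
  assumes R: "Q \<subseteq> R" and g: "g \<in> E" "g \<notin> R"
    and \<phi>: "\<And>f. f \<in> Q \<Longrightarrow> \<phi> (src f) = \<phi> (tgt f)"
  shows "(\<Sum>f\<in>E - R - {g}. c f * (\<phi> (src f) - \<phi> (tgt f)) * (side R Q g (src f) - side R Q g (tgt f)))
     = c g * W (\<lambda>T. T \<inter> R = Q \<and> g \<notin> T) * (\<phi> (src g) - \<phi> (tgt g))"
proof -
  define T1 where "T1 = {T\<in>ST. T \<inter> R = Q \<and> g \<in> T}"
  define T0 where "T0 = {T\<in>ST. T \<inter> R = Q \<and> g \<notin> T}"
  define J where "J T v = (of_bool (conn (T - {g}) (src g) v) :: real)" for T v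
  define I where "I T f v = (of_bool (conn (T - {f}) (src f) v) :: real)" for T f v
  define d where "d f = \<phi> (src f) - \<phi> (tgt f)" for f
  have finT: "finite T1" "finite T0" unfolding T1_def T0_def by auto
  have gV: "src g \<in> V" "tgt g \<in> V" using g src_V tgt_V by auto
  have side_eq: "side R Q g v = (\<Sum>T\<in>T1. wt T * J T v)" for v
  proof -
    have "side R Q g v = sum wt {T\<in>T1. conn (T - {g}) (src g) v}"
      unfolding side_def W_def T1_def by (rule sum.cong) auto
    also have "\<dots> = (\<Sum>T\<in>T1. wt T * J T v)"
      unfolding sum.inter_filter[OF finT(1)] by (rule sum.cong) (auto simp: J_def)
    finally show ?thesis .
  qed
  let ?B = "Sigma T1 (\<lambda>T. {f\<in>E - R - {g}. \<not> conn (T - {g}) (src f) (tgt f)})"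
  let ?A = "Sigma T0 (\<lambda>T. {f\<in>T - R. \<not> conn (T - {f}) (src g) (tgt g)})"
  have "(\<Sum>f\<in>E - R - {g}. c f * d f * (side R Q g (src f) - side R Q g (tgt f)))
     = (\<Sum>f\<in>E - R - {g}. \<Sum>T\<in>T1. c f * d f * wt T * (J T (src f) - J T (tgt f)))"
    unfolding side_eq by (simp add: sum_subtractf[symmetric] sum_distrib_left algebra_simps)
  also have "\<dots> = (\<Sum>T\<in>T1. \<Sum>f\<in>E - R - {g}. c f * d f * wt T * (J T (src f) - J T (tgt f)))"
    by (rule sum.swap)
  also have "\<dots> = (\<Sum>T\<in>T1. \<Sum>f\<in>{f\<in>E - R - {g}. \<not> conn (T - {g}) (src f) (tgt f)}.
      c f * d f * wt T * (J T (src f) - J T (tgt f)))"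
  proof (rule sum.cong[OF refl], rule sum.mono_neutral_right)
    fix T assume "T \<in> T1"
    show "\<forall>f\<in>E - R - {g} - {f \<in> E - R - {g}. \<not> conn (T - {g}) (src f) (tgt f)}.
        c f * d f * wt T * (J T (src f) - J T (tgt f)) = 0"
    proof
      fix f assume "f\<in>E - R - {g} - {f \<in> E - R - {g}. \<not> conn (T - {g}) (src f) (tgt f)}"
      then have "conn (T - {g}) (src f) (tgt f)" by auto
      then have "J T (src f) = J T (tgt f)" unfolding J_def by (simp only: econn_cong_right)
      then show "c f * d f * wt T * (J T (src f) - J T (tgt f)) = 0" by simp
    qed
  qed (use finite_E in auto)
  also have "\<dots> = (\<Sum>(T, f)\<in>?B. c f * d f * wt T * (J T (src f) - J T (tgt f)))"
  proof (rule sum.Sigma[where A = T1 and B = "\<lambda>T. {f\<in>E - R - {g}. \<not> conn (T - {g}) (src f) (tgt f)}"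
        and g = "\<lambda>T f. c f * d f * wt T * (J T (src f) - J T (tgt f))"])
    show "finite T1" by (rule finT(1))
    show "\<forall>T\<in>T1. finite {f\<in>E - R - {g}. \<not> conn (T - {g}) (src f) (tgt f)}" using finite_E by simp
  qed
  also have "\<dots> = (\<Sum>(T, f)\<in>?A. c g * d f * wt T * (I T f (src g) - I T f (tgt g)))"
  proof (rule sum.reindex_bij_witness[where i = "\<lambda>(T, f). (insert g (T - {f}), f)"
        and j = "\<lambda>(T, f). (insert f (T - {g}), f)"], goal_cases)
    case (1 a)
    obtain T f where a: "a = (T, f)" by (cases a)
    with 1 have T: "T \<in> ST" "T \<inter> R = Q" "g \<in> T" "f \<in> E" "f \<notin> R" "f \<noteq> g" "\<not> conn (T - {g}) (src f) (tgt f)"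
      by (auto simp: T1_def)
    have "f \<notin> T - {g}" using T(7) econn_edge by metis
    then show ?case using a T by auto
  next
    case (2 a)
    obtain T f where a: "a = (T, f)" by (cases a)
    with 2 have T: "T \<in> ST" "T \<inter> R = Q" "g \<in> T" "f \<in> E" "f \<notin> R" "f \<noteq> g" "\<not> conn (T - {g}) (src f) (tgt f)"
      by (auto simp: T1_def)
    have fT: "f \<notin> T - {g}" using T(7) econn_edge by metis
    have "insert f (T - {g}) \<in> ST" by (rule exchange[OF T(1,3,4,7)])
    moreover have "insert f (T - {g}) \<inter> R = Q" using T g by auto
    moreover have "\<not> conn (insert f (T - {g}) - {f}) (src g) (tgt g)"
      using ST_sep[OF T(1,3)] fT by simp
    ultimately show ?case using a T fT by (auto simp: T0_def)
  next
    case (3 a)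
    obtain T f where a: "a = (T, f)" by (cases a)
    with 3 have T: "T \<in> ST" "T \<inter> R = Q" "g \<notin> T" "f \<in> T" "f \<notin> R" "\<not> conn (T - {f}) (src g) (tgt g)"
      by (auto simp: T0_def)
    then show ?case using a by auto
  next
    case (4 a)
    obtain T f where a: "a = (T, f)" by (cases a)
    with 4 have T: "T \<in> ST" "T \<inter> R = Q" "g \<notin> T" "f \<in> T" "f \<notin> R" "\<not> conn (T - {f}) (src g) (tgt g)"
      by (auto simp: T0_def)
    have "insert g (T - {f}) \<in> ST" by (rule exchange[OF T(1,4) g(1) T(6)])
    moreover have "insert g (T - {f}) \<inter> R = Q" using T g by auto
    moreover have "insert g (T - {f}) - {g} = T - {f}" using T by auto
    ultimately show ?case using a T ST_sub[OF T(1)] ST_sep[OF T(1,4)] by (auto simp: T1_def)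
  next
    case (5 a)
    obtain T f where a: "a = (T, f)" by (cases a)
    with 5 have T: "T \<in> ST" "T \<inter> R = Q" "g \<in> T" "f \<in> E" "f \<notin> R" "f \<noteq> g" "\<not> conn (T - {g}) (src f) (tgt f)"
      by (auto simp: T1_def)
    have fT: "f \<notin> T - {g}" using T(7) econn_edge by metis
    have fV: "src f \<in> V" "tgt f \<in> V" using T(4) src_V tgt_V by auto
    have w: "c g * wt (insert f (T - {g})) = c f * wt T"
      using wt_exchange[OF T(1,3), of f] fT T(6) by auto
    have eq: "insert f (T - {g}) - {f} = T - {g}" using fT by auto
    \<comment> \<open>\<open>T - {g}\<close> has exactly two components, and both \<open>f\<close>
      and \<open>g\<close> join them, so the signs seen from \<open>g\<close> and from
      \<open>f\<close> agree.\<close>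
    note tc = two_classes_any[OF T(1,3)]
    have "conn (T - {g}) (src g) (src f) \<longleftrightarrow> conn (T - {g}) (src f) (src g)" by (rule econn_commute)
    moreover have "conn (T - {g}) (src g) (tgt f) \<longleftrightarrow> conn (T - {g}) (src f) (tgt g)"
      using tc[OF fV gV(1) T(7)] tc[OF gV fV(1) ST_sep[OF T(1,3)]]
        econn_commute[of src tgt "T - {g}"] by metis
    ultimately show ?case unfolding a case_prod_conv eq I_def J_def using w by simp
  qed
  also have "\<dots> = (\<Sum>T\<in>T0. \<Sum>f\<in>{f\<in>T - R. \<not> conn (T - {f}) (src g) (tgt g)}.
      c g * d f * wt T * (I T f (src g) - I T f (tgt g)))"
  proof (rule sum.Sigma[symmetric, where A = T0 and B = "\<lambda>T. {f\<in>T - R. \<not> conn (T - {f}) (src g) (tgt g)}"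
        and g = "\<lambda>T f. c g * d f * wt T * (I T f (src g) - I T f (tgt g))"])
    show "finite T0" by (rule finT(2))
    have "finite T" if "T \<in> T0" for T using that ST_sub finite_E finite_subset unfolding T0_def by blast
    then show "\<forall>T\<in>T0. finite {f\<in>T - R. \<not> conn (T - {f}) (src g) (tgt g)}" by simp
  qed
  \<comment> \<open>The added edges contribute 0: those in \<open>Q\<close> because
    \<open>\<phi>\<close> agrees at their ends, the others because they do not separate the ends of
    \<open>g\<close>. Now \<open>tree_identity\<close> applies.\<close>
  also have "\<dots> = (\<Sum>T\<in>T0. \<Sum>f\<in>T. c g * d f * wt T * (I T f (src g) - I T f (tgt g)))"
  proof (rule sum.cong[OF refl], rule sum.mono_neutral_left)
    fix T assume T: "T \<in> T0"
    show "finite T" using T ST_sub finite_E by (auto simp: T0_def intro: finite_subset[of _ E])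
    show "\<forall>f\<in>T - {f \<in> T - R. \<not> conn (T - {f}) (src g) (tgt g)}.
        c g * d f * wt T * (I T f (src g) - I T f (tgt g)) = 0"
    proof
      fix f assume f: "f\<in>T - {f \<in> T - R. \<not> conn (T - {f}) (src g) (tgt g)}"
      show "c g * d f * wt T * (I T f (src g) - I T f (tgt g)) = 0"
      proof (cases "f \<in> R")
        case True
        then have "f \<in> Q" using f T by (auto simp: T0_def)
        then show ?thesis using \<phi> by (simp add: d_def)
      next
        case False
        then have "conn (T - {f}) (src g) (tgt g)" using f by auto
        then have "I T f (src g) = I T f (tgt g)" unfolding I_def by (simp only: econn_cong_right)
        then show ?thesis by simp
      qed
    qed
  qed auto
  also have "\<dots> = (\<Sum>T\<in>T0. c g * wt T * (\<phi> (src g) - \<phi> (tgt g)))"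
  proof (rule sum.cong[OF refl])
    fix T assume "T \<in> T0"
    then have "T \<in> ST" by (simp add: T0_def)
    from tree_identity[OF this gV, of \<phi>, symmetric]
    show "(\<Sum>f\<in>T. c g * d f * wt T * (I T f (src g) - I T f (tgt g))) = c g * wt T * (\<phi> (src g) - \<phi> (tgt g))"
      by (simp add: d_def I_def sum_distrib_left algebra_simps)
  qed
  also have "\<dots> = c g * W (\<lambda>T. T \<inter> R = Q \<and> g \<notin> T) * (\<phi> (src g) - \<phi> (tgt g))"
    by (simp add: W_def T0_def sum_distrib_left sum_distrib_right mult_ac)
  finally show ?thesis by (simp add: d_def)
qed

text \<open>With \<open>\<phi>\<close> the indicator of \<open>X\<close>,
  \<open>tree_identity\<close> has a nonzero right side. So an edge on the tree path between the
  ends of \<open>g\<close> leaves \<open>X\<close>, and no edge of \<open>Q\<close> does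
  that.\<close>

lemma cut_edge:
  assumes T: "T \<in> ST" "T \<inter> R = Q" "g \<notin> T" and g: "g \<in> E"
    and X: "\<And>f. f \<in> Q \<Longrightarrow> src f \<in> X \<longleftrightarrow> tgt f \<in> X" "(src g \<in> X) \<noteq> (tgt g \<in> X)"
  obtains f where "f \<in> T" "f \<notin> R" "(src f \<in> X) \<noteq> (tgt f \<in> X)" "\<not> conn (T - {f}) (src g) (tgt g)"
proof -
  define \<phi> where "\<phi> v = (of_bool (v \<in> X) :: real)" for v
  have "(\<Sum>f\<in>T. (\<phi> (src f) - \<phi> (tgt f)) *
      (of_bool (conn (T - {f}) (src f) (src g)) - of_bool (conn (T - {f}) (src f) (tgt g)))) \<noteq> 0"
    using tree_identity[OF T(1) src_V[OF g] tgt_V[OF g], of \<phi>] X(2) by (auto simp: \<phi>_def)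
  then obtain f where f: "f \<in> T" "(\<phi> (src f) - \<phi> (tgt f)) *
      (of_bool (conn (T - {f}) (src f) (src g)) - of_bool (conn (T - {f}) (src f) (tgt g))) \<noteq> 0"
    using sum.not_neutral_contains_not_neutral by blast
  then have "(src f \<in> X) \<noteq> (tgt f \<in> X)" "conn (T - {f}) (src f) (src g) \<noteq> conn (T - {f}) (src f) (tgt g)"
    by (auto simp: \<phi>_def)
  moreover from this have "\<not> conn (T - {f}) (src g) (tgt g)"
    using econn_cong_right by metis
  moreover have "f \<notin> R" using calculation(1) X(1) T(2) f(1) by blast
  ultimately show ?thesis using f(1) that by blast
qed

text \<open>A tree without \<open>g\<close> has an edge of \<open>S\<close> on its path between the
  ends of \<open>g\<close>; exchanging it for \<open>g\<close> lowers the count by one. Recording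
  the removed edge makes the map injective, and summing over the possible records gives the total
  conductance of \<open>S\<close>.\<close>

lemma degree_exchange:
  assumes g: "g \<in> E" "g \<notin> R"
    and X: "\<And>f. f \<in> Q \<Longrightarrow> src f \<in> X \<longleftrightarrow> tgt f \<in> X" "(src g \<in> X) \<noteq> (tgt g \<in> X)"
    and S: "S \<subseteq> E - R - {g}" "\<And>f. f \<in> E - R - {g} \<Longrightarrow> (src f \<in> X) \<noteq> (tgt f \<in> X) \<Longrightarrow> f \<in> S"
  shows "W (\<lambda>T. T \<inter> R = Q \<and> g \<notin> T \<and> card (T \<inter> S) = 0) = 0"
    and "c g * W (\<lambda>T. T \<inter> R = Q \<and> g \<notin> T \<and> card (T \<inter> S) = Suc k) \<le>
      (\<Sum>f\<in>S. c f) * W (\<lambda>T. T \<inter> R = Q \<and> g \<in> T \<and> card (T \<inter> S) = k)"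
proof -
  have ex: "\<exists>f. f \<in> T \<and> f \<in> S \<and> \<not> conn (T - {f}) (src g) (tgt g)"
    if T: "T \<in> ST" "T \<inter> R = Q" "g \<notin> T" for T
  proof -
    obtain f where f: "f \<in> T" "f \<notin> R" "(src f \<in> X) \<noteq> (tgt f \<in> X)" "\<not> conn (T - {f}) (src g) (tgt g)"
      using cut_edge[OF T g(1) X] by blast
    moreover have "f \<in> S" using S(2)[of f] f T ST_sub by blast
    ultimately show ?thesis by blast
  qed
  have finS: "finite S" using S(1) finite_E finite_subset by blast
  have "{T\<in>ST. T \<inter> R = Q \<and> g \<notin> T \<and> card (T \<inter> S) = 0} = {}"
    using ex finS by fastforce
  then show "W (\<lambda>T. T \<inter> R = Q \<and> g \<notin> T \<and> card (T \<inter> S) = 0) = 0"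
    by (simp only: W_def sum.empty)
  define A where "A = {T\<in>ST. T \<inter> R = Q \<and> g \<notin> T \<and> card (T \<inter> S) = Suc k}"
  define B where "B = {T\<in>ST. T \<inter> R = Q \<and> g \<in> T \<and> card (T \<inter> S) = k}"
  define F where "F T = (SOME f. f \<in> T \<and> f \<in> S \<and> \<not> conn (T - {f}) (src g) (tgt g))" for T
  have F: "F T \<in> T" "F T \<in> S" "\<not> conn (T - {F T}) (src g) (tgt g)" if "T \<in> A" for T
  proof -
    have "\<exists>f. f \<in> T \<and> f \<in> S \<and> \<not> conn (T - {f}) (src g) (tgt g)"
      by (rule ex) (use that in \<open>simp_all add: A_def\<close>)
    from someI_ex[OF this] show "F T \<in> T" "F T \<in> S" "\<not> conn (T - {F T}) (src g) (tgt g)"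
      unfolding F_def by blast+
  qed
  define j where "j T = (F T, insert g (T - {F T}))" for T
  have jB: "j T \<in> S \<times> B" if "T \<in> A" for T
  proof -
    have T: "T \<in> ST" "T \<inter> R = Q" "g \<notin> T" "card (T \<inter> S) = Suc k" using that by (auto simp: A_def)
    note F' = F[OF that]
    have "insert g (T - {F T}) \<in> ST" by (rule exchange[OF T(1) F'(1) g(1) F'(3)])
    moreover have "insert g (T - {F T}) \<inter> R = Q" using g F'(2) S(1) T(2) by auto
    moreover have "insert g (T - {F T}) \<inter> S = (T \<inter> S) - {F T}" using S(1) by auto
    then have "card (insert g (T - {F T}) \<inter> S) = k" using T(4) F' finS by (simp add: card_Diff_singleton)
    ultimately show ?thesis using F'(2) by (auto simp: j_def B_def)
  qed
  have inj: "inj_on j A"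
  proof (rule inj_onI)
    fix T T' assume a: "T \<in> A" "T' \<in> A" "j T = j T'"
    then have "g \<notin> T" "g \<notin> T'" "F T = F T'" "insert g (T - {F T}) = insert g (T' - {F T'})"
      by (auto simp: A_def j_def)
    note eq = this
    have "T - {F T} = insert g (T - {F T}) - {g}" using eq(1) by auto
    also have "\<dots> = T' - {F T'}" unfolding eq(4) using eq(2) by auto
    finally have "insert (F T) (T - {F T}) = insert (F T') (T' - {F T'})" using eq(3) by simp
    then show "T = T'" unfolding insert_Diff[OF F(1)[OF a(1)]] insert_Diff[OF F(1)[OF a(2)]] .
  qed
  have "c g * W (\<lambda>T. T \<inter> R = Q \<and> g \<notin> T \<and> card (T \<inter> S) = Suc k) = (\<Sum>T\<in>A. c g * wt T)"
    unfolding W_def A_def by (rule sum_distrib_left)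
  also have "\<dots> = (\<Sum>T\<in>A. (\<lambda>(f, T'). c f * wt T') (j T))"
  proof (rule sum.cong[OF refl])
    fix T assume T: "T \<in> A"
    then have "T \<in> ST" "g \<notin> T" by (auto simp: A_def)
    then show "c g * wt T = (\<lambda>(f, T'). c f * wt T') (j T)"
      unfolding j_def using wt_exchange[OF _ F(1)[OF T]] by simp
  qed
  also have "\<dots> = (\<Sum>p\<in>j ` A. (\<lambda>(f, T'). c f * wt T') p)"
    by (rule sum.reindex_cong[OF inj, symmetric]) auto
  also have "\<dots> \<le> (\<Sum>p\<in>S \<times> B. (\<lambda>(f, T'). c f * wt T') p)"
  proof (rule sum_mono2)
    show "finite (S \<times> B)" using finS by (auto simp: B_def)
    show "j ` A \<subseteq> S \<times> B" using jB by blast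
    show "0 \<le> (\<lambda>(f, T'). c f * wt T') p" if "p \<in> S \<times> B - j ` A" for p
    proof -
      obtain f T' where p: "p = (f, T')" by (cases p)
      with that S(1) have "0 < c f" "0 < wt T'" by (auto simp: B_def intro!: c_pos wt_pos)
      then show ?thesis using p by simp
    qed
  qed
  also have "\<dots> = (\<Sum>f\<in>S. c f) * (\<Sum>T\<in>B. wt T)"
    by (simp add: sum_product sum.cartesian_product)
  finally show "c g * W (\<lambda>T. T \<inter> R = Q \<and> g \<notin> T \<and> card (T \<inter> S) = Suc k) \<le>
      (\<Sum>f\<in>S. c f) * W (\<lambda>T. T \<inter> R = Q \<and> g \<in> T \<and> card (T \<inter> S) = k)"
    by (simp add: W_def B_def)
qed

end

subsection \<open>Variance of a conditional probability\<close>

text \<open>The coefficients of the induction in \<open>variance_lower_bound\<close>: with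
  \<open>v\<close> the variance there, \<open>p k\<close> is at most
  \<open>mass_bound \<tau> \<eta> k * sqrt v\<close>.\<close>

fun mass_bound :: "real \<Rightarrow> real \<Rightarrow> nat \<Rightarrow> real" where
  "mass_bound \<tau> \<eta> 0 = 1 / \<eta>"
| "mass_bound \<tau> \<eta> (Suc k) = (\<tau> * mass_bound \<tau> \<eta> k + 1) / \<eta>"

lemma mass_bound_pos: "0 < \<eta> \<Longrightarrow> 0 \<le> \<tau> \<Longrightarrow> 0 < mass_bound \<tau> \<eta> k"
  by (induction k) (auto intro!: divide_pos_pos add_nonneg_pos mult_nonneg_nonneg)

text \<open>If the ratios \<open>x k / p k\<close> were all close to \<open>q\<close>, then \<open>p 0\<close> would be small, hence inductively all
  \<open>p k\<close>, contradicting the bound on the mean of \<open>p\<close>.\<close>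

lemma variance_lower_bound:
  fixes p x :: "nat \<Rightarrow> real"
  assumes x: "\<And>k. 0 \<le> x k" "\<And>k. x k \<le> p k" and m: "(\<Sum>k\<le>m. p k) = 1"
    and x0: "x 0 = p 0" and step: "\<And>k. p (Suc k) - x (Suc k) \<le> \<tau> * x k"
    and q: "q = (\<Sum>k\<le>m. x k)" "q \<le> 1 - \<eta>" and \<eta>: "0 < \<eta>" and \<tau>: "0 \<le> \<tau>"
    and mean: "(\<Sum>k\<le>m. real k * p k) \<le> D" and N: "2 * D \<le> real N" "0 < N"
  shows "1 / (2 * (\<Sum>k<N. mass_bound \<tau> \<eta> k))\<^sup>2 \<le> (\<Sum>k\<le>m. (x k)\<^sup>2 / p k) - q\<^sup>2"
proof -
  define v where "v = (\<Sum>k\<le>m. (x k)\<^sup>2 / p k) - q\<^sup>2"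
  define d where "d k = x k - q * p k" for k
  define a where "a = mass_bound \<tau> \<eta>"
  have a_pos: "0 < a k" for k unfolding a_def using mass_bound_pos[OF \<eta> \<tau>] .
  have p: "0 \<le> p k" for k using x order_trans by blast
  have p1: "p k \<le> 1" if "k \<le> m" for k
    using member_le_sum[of k "{..m}" p] that p m by auto
  have x_pzero: "x k = 0" if "p k = 0" for k using x[of k] that by simp
  \<comment> \<open>The left side is the variance of the conditional probability
    \<open>x k / p k\<close>. Where \<open>p k = 0\<close>, also \<open>x k = 0\<close>, and
    division by zero gives the right value 0.\<close>
  have "(\<Sum>k\<le>m. (d k)\<^sup>2 / p k) = (\<Sum>k\<le>m. (x k)\<^sup>2 / p k - 2 * q * x k + q\<^sup>2 * p k)"
  proof (rule sum.cong[OF refl])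
    fix k show "(d k)\<^sup>2 / p k = (x k)\<^sup>2 / p k - 2 * q * x k + q\<^sup>2 * p k"
      using x_pzero[of k] by (cases "p k = 0") (auto simp: d_def field_simps power2_eq_square)
  qed
  also have "\<dots> = v" using m q(1)
    by (simp add: v_def sum.distrib sum_subtractf sum_distrib_left[symmetric] power2_eq_square)
  finally have v: "(\<Sum>k\<le>m. (d k)\<^sup>2 / p k) = v" .
  have v0: "0 \<le> v" unfolding v[symmetric] by (rule sum_nonneg) (simp add: p)
  have d_le: "\<bar>d k\<bar> \<le> sqrt v" if k: "k \<le> m" for k
  proof (cases "p k = 0")
    case True then show ?thesis using x_pzero v0 by (simp add: d_def)
  next
    case False
    have "(d k)\<^sup>2 / 1 \<le> (d k)\<^sup>2 / p k"
      using p1[OF k] p[of k] False by (intro divide_left_mono) auto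
    also have "\<dots> \<le> v" unfolding v[symmetric]
      using k p by (intro member_le_sum) auto
    finally show ?thesis using real_le_rsqrt[of "\<bar>d k\<bar>" v] by simp
  qed
  have bound: "p k \<le> a k * sqrt v" if "k \<le> m" for k
    using that
  proof (induction k)
    case 0
    have "\<eta> * p 0 \<le> (1 - q) * p 0" using q p by (intro mult_right_mono) auto
    also have "\<dots> = d 0" using x0 by (simp add: d_def algebra_simps)
    also have "\<dots> \<le> sqrt v" using d_le[of 0] by simp
    finally show ?case using \<eta> by (simp add: a_def field_simps)
  next
    case (Suc k)
    have "\<eta> * p (Suc k) \<le> (1 - q) * p (Suc k)" using q p by (intro mult_right_mono) auto
    also have "\<dots> = p (Suc k) - x (Suc k) + d (Suc k)" by (simp add: d_def algebra_simps)
    also have "\<dots> \<le> \<tau> * x k + sqrt v" using step[of k] d_le[OF Suc.prems] by simp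
    also have "\<tau> * x k \<le> \<tau> * (a k * sqrt v)"
      using Suc x(2)[of k] \<tau> by (intro mult_left_mono) auto
    finally show ?case using \<eta> by (simp add: a_def field_simps)
  qed
  have "1 = (\<Sum>k\<le>m. p k)" using m by simp
  \<comment> \<open>Below \<open>N\<close> the inductive bound is used, from \<open>N\<close> on
    Markov's inequality; by the choice of \<open>N\<close> the tail holds at most half of the
    mass.\<close>
  also have "\<dots> \<le> (\<Sum>k\<le>m. (if k < N then a k * sqrt v else 0) + real k * p k / N)"
  proof (rule sum_mono)
    fix k assume "k \<in> {..m}"
    then show "p k \<le> (if k < N then a k * sqrt v else 0) + real k * p k / N"
    proof (cases "k < N")
      case True
      then show ?thesis using bound[of k] p[of k] \<open>k \<in> {..m}\<close> by (simp add: add_increasing2)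
    next
      case False
      then have "real N * p k \<le> real k * p k" using p by (intro mult_right_mono) auto
      then show ?thesis using False N by (simp add: field_simps)
    qed
  qed
  also have "\<dots> = (\<Sum>k\<in>{..m} \<inter> {..<N}. a k * sqrt v) + (\<Sum>k\<le>m. real k * p k) / N"
    by (simp add: sum.distrib sum_divide_distrib sum.inter_restrict)
  also have "(\<Sum>k\<in>{..m} \<inter> {..<N}. a k * sqrt v) \<le> (\<Sum>k<N. a k * sqrt v)"
    using a_pos v0 by (intro sum_mono2) (auto intro!: mult_nonneg_nonneg less_imp_le[OF a_pos])
  also have "\<dots> = (\<Sum>k<N. a k) * sqrt v" by (simp add: sum_distrib_right)
  also have "(\<Sum>k\<le>m. real k * p k) / N \<le> 1 / 2" using mean N by (simp add: field_simps)
  finally have half: "1 / 2 \<le> (\<Sum>k<N. a k) * sqrt v" by simp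
  have s: "0 < (\<Sum>k<N. a k)" using N(2) a_pos by (intro sum_pos) auto
  have "1 / (2 * (\<Sum>k<N. a k)) \<le> sqrt v" using half s by (simp add: field_simps)
  then have "(1 / (2 * (\<Sum>k<N. a k)))\<^sup>2 \<le> (sqrt v)\<^sup>2"
    using s by (intro power_mono) auto
  then show ?thesis using v0 by (simp add: v_def a_def power_divide)
qed

text \<open>Cauchy-Schwarz. With \<open>m i\<close> as masses and \<open>x i / m i\<close> as
  conditional probabilities, it says that second moments grow under refinement; this is the
  martingale step of the proof.\<close>

lemma sum_square_divide_ge:
  fixes x m :: "'i \<Rightarrow> real"
  assumes "finite I" "\<And>i. i \<in> I \<Longrightarrow> 0 \<le> x i" "\<And>i. i \<in> I \<Longrightarrow> x i \<le> m i"
  shows "(\<Sum>i\<in>I. x i)\<^sup>2 / (\<Sum>i\<in>I. m i) \<le> (\<Sum>i\<in>I. (x i)\<^sup>2 / m i)"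
proof (cases "(\<Sum>i\<in>I. m i) = 0")
  case True
  have "0 \<le> m i" if "i \<in> I" for i using assms(2,3)[OF that] by linarith
  then show ?thesis using True by (auto intro!: sum_nonneg)
next
  case False
  have m0: "0 \<le> m i" if "i \<in> I" for i using assms(2,3)[OF that] by linarith
  have pos: "0 < (\<Sum>i\<in>I. m i)" using False sum_nonneg[of I m] m0 by force
  have "(\<Sum>i\<in>I. x i)\<^sup>2 = (\<Sum>i\<in>I. sqrt (m i) * (x i / sqrt (m i)))\<^sup>2"
  proof -
    have "x i = sqrt (m i) * (x i / sqrt (m i))" if "i \<in> I" for i
      using assms(2,3)[OF that] by (cases "m i = 0") auto
    then show ?thesis by (metis (mono_tags, lifting) sum.cong)
  qed
  also have "\<dots> \<le> (\<Sum>i\<in>I. (sqrt (m i))\<^sup>2) * (\<Sum>i\<in>I. (x i / sqrt (m i))\<^sup>2)"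
    by (rule Cauchy_Schwarz_ineq_sum)
  also have "\<dots> = (\<Sum>i\<in>I. m i) * (\<Sum>i\<in>I. (x i)\<^sup>2 / m i)"
    using m0 by (intro arg_cong2[where f = "(*)"] sum.cong) (auto simp: power_divide)
  finally show ?thesis using pos by (simp add: field_simps)
qed

subsection \<open>Resistance outside a nearly minimal cut\<close>

lemma sum_UNION_le:
  fixes g :: "'b \<Rightarrow> real"
  assumes "finite I" "\<And>i. i \<in> I \<Longrightarrow> finite (S i)" "\<And>x. 0 \<le> g x"
  shows "sum g (\<Union>i\<in>I. S i) \<le> (\<Sum>i\<in>I. sum g (S i))"
  using assms(1,2)
proof (induction I)
  case (insert i I)
  have "sum g (S i \<union> (\<Union>i\<in>I. S i)) \<le> sum g (S i) + sum g (\<Union>i\<in>I. S i)"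
    using sum.union_inter[of "S i" "\<Union>i\<in>I. S i" g] insert sum_nonneg[of "S i \<inter> (\<Union>i\<in>I. S i)" g] assms(3)
    by auto
  then show ?case using insert by simp
qed simp


section \<open>Boundary, volume and components in the infinite network\<close>

abbreviation ends_conn :: "('v, 'e) pre_digraph \<Rightarrow> 'e set \<Rightarrow> 'v \<Rightarrow> 'v \<Rightarrow> bool" where
  "ends_conn G \<equiv> econn (tail G) (head G)"

lemma (in wf_digraph) connected_iff_econn:
  "Digraph_Component.connected G \<longleftrightarrow>
     verts G \<noteq> {} \<and> (\<forall>u\<in>verts G. \<forall>v\<in>verts G. ends_conn G (arcs G) u v)"
proof -
  have adj: "(arcs_ends G)\<^sup>s = adj (tail G) (head G) (arcs G)"
    by (auto simp: symcl_def arcs_ends_conv adj_def)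
  have "(u, v) \<in> rtrancl_on (verts G) (adj (tail G) (head G) (arcs G)) \<longleftrightarrow> ends_conn G (arcs G) u v"
    if "u \<in> verts G" "v \<in> verts G" for u v
  proof
    assume "(u, v) \<in> rtrancl_on (verts G) (adj (tail G) (head G) (arcs G))"
    then show "ends_conn G (arcs G) u v" unfolding econn_def by (rule rtrancl_on_rtranclI)
  next
    assume "ends_conn G (arcs G) u v"
    then show "(u, v) \<in> rtrancl_on (verts G) (adj (tail G) (head G) (arcs G))"
      unfolding econn_def
      by (rule rtrancl_consistent_rtrancl_on) (use that in \<open>auto simp: adj_def\<close>)
  qed
  then show ?thesis unfolding connected_conv adj by auto
qed

lemma vol_union:
  assumes "finite K" "finite L" "K \<inter> L = {}"
  shows "vol G c (K \<union> L) = vol G c K + vol G c L"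
  unfolding vol_def using assms by (rule sum.union_disjoint)

locale infinite_net = network G c for G :: "('v, 'e) pre_digraph" and c :: "'e \<Rightarrow> real" +
  assumes lf: "locally_finite G" and conn_G: "Digraph_Component.connected G" and inf_G: "infinite (verts G)"
begin

definition touch :: "'v set \<Rightarrow> 'e set" where
  "touch K = {f\<in>arcs G. tail G f \<in> K \<or> head G f \<in> K}"

definition bd :: "'v set \<Rightarrow> real" where "bd K = (\<Sum>f\<in>edge_boundary G K. c f)"

lemma finite_touch: "finite K \<Longrightarrow> finite (touch K)"
proof -
  assume "finite K"
  have "touch K \<subseteq> (\<Union>v\<in>K \<inter> verts G. out_arcs G v \<union> in_arcs G v)"
    by (auto simp: touch_def out_arcs_def in_arcs_def)
  moreover have "finite \<dots>" using lf \<open>finite K\<close> unfolding locally_finite_def by blast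
  ultimately show ?thesis by (rule finite_subset)
qed

lemma boundary_touch: "edge_boundary G K \<subseteq> touch K"
  by (auto simp: edge_boundary_def touch_def)

lemma finite_boundary: "finite K \<Longrightarrow> finite (edge_boundary G K)"
  using finite_touch boundary_touch finite_subset by blast

lemma c_nonneg: "f \<in> arcs G \<Longrightarrow> 0 \<le> c f"
  using conductance_pos less_imp_le by blast

lemma bd_nonneg: "0 \<le> bd K"
  unfolding bd_def by (rule sum_nonneg) (auto simp: edge_boundary_def c_nonneg)

lemma vol_mono:
  assumes "K \<subseteq> L" "finite L" shows "vol G c K \<le> vol G c L"
  unfolding vol_def using assms
  by (intro sum_mono2) (auto intro!: add_nonneg_nonneg sum_nonneg c_nonneg simp: out_arcs_def in_arcs_def)

lemma sum_touch_le_vol: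
  assumes "finite L" "S \<subseteq> touch L"
  shows "(\<Sum>f\<in>S. c f) \<le> vol G c L"
proof -
  have fo: "finite (out_arcs G v)" "finite (in_arcs G v)" for v
  proof -
    have "finite (touch {v})" using finite_touch by blast
    then show "finite (out_arcs G v)" "finite (in_arcs G v)"
      by (auto elim!: rev_finite_subset simp: touch_def out_arcs_def in_arcs_def)
  qed
  let ?O = "\<Union>v\<in>L. out_arcs G v" and ?I = "\<Union>v\<in>L. in_arcs G v"
  have "S \<subseteq> ?O \<union> ?I" using assms(2) by (auto simp: touch_def out_arcs_def in_arcs_def)
  then have "(\<Sum>f\<in>S. c f) \<le> (\<Sum>f\<in>?O \<union> ?I. c f)"
    using assms(1) fo by (intro sum_mono2) (auto intro: c_nonneg simp: out_arcs_def in_arcs_def)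
  also have "\<dots> \<le> (\<Sum>f\<in>?O. c f) + (\<Sum>f\<in>?I. c f)"
  proof -
    have "finite ?O" "finite ?I" using assms(1) fo by auto
    moreover have "0 \<le> (\<Sum>f\<in>?O \<inter> ?I. c f)" by (rule sum_nonneg) (auto intro: c_nonneg simp: out_arcs_def)
    ultimately show ?thesis using sum.union_inter[of ?O ?I c] by linarith
  qed
  also have "(\<Sum>f\<in>?O. c f) = (\<Sum>v\<in>L. \<Sum>f\<in>out_arcs G v. c f)"
    by (rule sum.UNION_disjoint) (use assms(1) fo in \<open>auto simp: out_arcs_def\<close>)
  also have "(\<Sum>f\<in>?I. c f) = (\<Sum>v\<in>L. \<Sum>f\<in>in_arcs G v. c f)"
    by (rule sum.UNION_disjoint) (use assms(1) fo in \<open>auto simp: in_arcs_def\<close>)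
  finally show ?thesis by (simp add: vol_def sum.distrib)
qed

lemma sum_boundary_le_vol: "finite L \<Longrightarrow> bd L \<le> vol G c L"
  unfolding bd_def by (rule sum_touch_le_vol[OF _ boundary_touch])

lemma econn_G: "u \<in> verts G \<Longrightarrow> v \<in> verts G \<Longrightarrow> ends_conn G (arcs G) u v"
  using conn_G connected_iff_econn by blast

lemma boundary_nonempty:
  assumes "K \<subseteq> verts G" "finite K" "K \<noteq> {}"
  shows "edge_boundary G K \<noteq> {}"
proof
  assume e: "edge_boundary G K = {}"
  obtain u where u: "u \<in> K" using assms by blast
  have "\<not> verts G \<subseteq> K" using assms(2) inf_G finite_subset[of "verts G" K] by auto
  then obtain v where v: "v \<in> verts G" "v \<notin> K" by blast
  have same: "\<forall>f\<in>arcs G. (tail G f \<in> K) = (head G f \<in> K)"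
    using e by (simp add: edge_boundary_def)
  have "ends_conn G (arcs G) u v" by (rule econn_G) (use u v assms(1) in auto)
  then have "(u \<in> K) = (v \<in> K)"
    by (rule econn_const[where \<phi> = "\<lambda>x. x \<in> K"]) (use same in blast)
  then show False using u v by blast
qed

lemma bd_pos:
  assumes "K \<subseteq> verts G" "finite K" "K \<noteq> {}"
  shows "0 < bd K"
  unfolding bd_def
  by (rule sum_pos) (use assms boundary_nonempty finite_boundary in \<open>auto simp: edge_boundary_def conductance_pos\<close>)

text \<open>The component of \<open>v\<close> in the subgraph induced on \<open>Y\<close>. It is
  meant for \<open>v \<in> Y\<close>; otherwise it is just \<open>{v}\<close>.\<close>

definition comp :: "'v set \<Rightarrow> 'v \<Rightarrow> 'v set" where
  "comp Y v = {u. ends_conn G {f\<in>arcs G. tail G f \<in> Y \<and> head G f \<in> Y} v u}"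

lemma comp_self [simp]: "v \<in> comp Y v" by (simp add: comp_def)

lemma comp_subset: "v \<in> Y \<Longrightarrow> comp Y v \<subseteq> Y"
proof
  fix u assume v: "v \<in> Y" and "u \<in> comp Y v"
  then have "ends_conn G {f\<in>arcs G. tail G f \<in> Y \<and> head G f \<in> Y} v u" by (simp add: comp_def)
  then have "(v \<in> Y) = (u \<in> Y)" by (rule econn_const) auto
  then show "u \<in> Y" using v by simp
qed

lemma comp_mono: "Y \<subseteq> Y' \<Longrightarrow> comp Y v \<subseteq> comp Y' v"
  unfolding comp_def by (auto elim!: econn_mono)

lemma comp_eq: "u \<in> comp Y v \<Longrightarrow> comp Y u = comp Y v"
  unfolding comp_def using econn_cong_left by fastforce

lemma comp_step:
  assumes "f \<in> arcs G" "tail G f \<in> Y" "head G f \<in> Y"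
  shows "tail G f \<in> comp Y v \<longleftrightarrow> head G f \<in> comp Y v"
  unfolding comp_def mem_Collect_eq by (rule econn_cong_right) (use assms in \<open>auto intro: econn_edge\<close>)

lemma comp_connected:
  assumes "v \<in> Y" "Y \<subseteq> verts G"
  shows "Digraph_Component.connected (G \<restriction> comp Y v)"
proof -
  interpret I: wf_digraph "G \<restriction> comp Y v" by (rule wellformed_induce_subgraph)
  have *: "ends_conn G (arcs (G \<restriction> comp Y v)) v u"
    if "ends_conn G {f\<in>arcs G. tail G f \<in> Y \<and> head G f \<in> Y} v u" for u
    using that
  proof (induction rule: econn_induct)
    case refl show ?case by simp
  next
    case (step a b f)
    have "a \<in> comp Y v" using step.hyps(1) by (simp add: comp_def)
    moreover from this have "b \<in> comp Y v" using comp_step[of f Y v] step.hyps(2,3) by auto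
    ultimately have "f \<in> arcs (G \<restriction> comp Y v)" using step.hyps(2,3) by auto
    from econn_edge[OF this, of "tail G" "head G"] have "ends_conn G (arcs (G \<restriction> comp Y v)) a b"
      using step.hyps(3) by (auto dest: econn_sym)
    with step.IH show ?case by (rule econn_trans)
  qed
  have "ends_conn G (arcs (G \<restriction> comp Y v)) a b" if "a \<in> comp Y v" "b \<in> comp Y v" for a b
    using econn_trans[OF econn_sym[OF *] *] that by (simp add: comp_def)
  moreover have "comp Y v \<noteq> {}" using comp_self by blast
  ultimately show ?thesis unfolding I.connected_iff_econn by simp
qed

end

text \<open>The step of \<open>\<sigma>\<close> is an eighth of the profile because a cluster keeps
  at least a quarter of its boundary outside \<open>K\<close> (\<open>outer_cut\<close>), and half
  of that is sure to be absorbed when the level is lowered (\<open>vol_step\<close>).\<close>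

locale isoperimetric_net = infinite_net G c for G :: "('v, 'e) pre_digraph" and c :: "'e \<Rightarrow> real" +
  fixes \<kappa> :: "real \<Rightarrow> real" and s0 :: real and \<sigma> :: "nat \<Rightarrow> real"
  assumes s0: "0 < s0" and \<kappa>_ge: "0 < t \<Longrightarrow> s0 \<le> \<kappa> t" and \<kappa>_mono: "0 < t \<Longrightarrow> t \<le> u \<Longrightarrow> \<kappa> t \<le> \<kappa> u"
    and iso: "K \<subseteq> verts G \<Longrightarrow> finite K \<Longrightarrow> Digraph_Component.connected (G \<restriction> K) \<Longrightarrow> 0 < vol G c K \<Longrightarrow>
       \<kappa> (vol G c K) \<le> (\<Sum>e\<in>edge_boundary G K. c e)"
    and \<sigma>0: "\<sigma> 0 = s0" and \<sigma>_Suc: "\<sigma> (Suc k) = \<sigma> k + \<kappa> (\<sigma> k) / 8"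
    and summable: "summable (\<lambda>k. 1 / \<kappa> (\<sigma> k))"
begin

lemma bd_ge:
  assumes "K \<subseteq> verts G" "finite K" "Digraph_Component.connected (G \<restriction> K)"
  shows "0 < vol G c K" "\<kappa> (vol G c K) \<le> bd K" "s0 \<le> bd K" "s0 \<le> vol G c K"
proof -
  have "K \<noteq> {}" using assms(3) by (auto simp: connected_conv)
  then show 1: "0 < vol G c K" using bd_pos[OF assms(1,2)] sum_boundary_le_vol[OF assms(2)] by linarith
  then show "\<kappa> (vol G c K) \<le> bd K" using iso assms by (simp add: bd_def)
  then show 2: "s0 \<le> bd K" using \<kappa>_ge[OF 1] by linarith
  then show "s0 \<le> vol G c K" using sum_boundary_le_vol[OF assms(2)] by linarith
qed

text \<open>The infimum of \<open>bd\<close> over finite supersets need not be attained, hence a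
  slack. Every finite connected set has boundary at least \<open>s0\<close>, so
  \<open>s0 / 2\<close> is small enough for \<open>outer_cut\<close>.\<close>

definition nearmin :: "'v set \<Rightarrow> bool" where
  "nearmin K \<longleftrightarrow> finite K \<and> K \<subseteq> verts G \<and>
     (\<forall>L. finite L \<and> L \<subseteq> verts G - K \<longrightarrow> bd K - s0 / 2 \<le> bd (K \<union> L))"

lemma nearmin_exists:
  assumes "finite K0" "K0 \<subseteq> verts G"
  obtains K where "K0 \<subseteq> K" "nearmin K"
proof -
  define S where "S = {K. finite K \<and> K0 \<subseteq> K \<and> K \<subseteq> verts G}"
  have ne: "bd ` S \<noteq> {}" using assms by (auto simp: S_def)
  have bb: "bdd_below (bd ` S)" using bd_nonneg by (auto intro!: bdd_belowI[of _ 0])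
  obtain y where "y \<in> bd ` S" "y < Inf (bd ` S) + s0 / 2"
    using cInf_lessD[OF ne, of "Inf (bd ` S) + s0 / 2"] s0 by auto
  then obtain K where K: "K \<in> S" "bd K < Inf (bd ` S) + s0 / 2" by auto
  have "bd K - s0 / 2 \<le> bd (K \<union> L)" if "finite L \<and> L \<subseteq> verts G - K" for L
  proof -
    have "K \<union> L \<in> S" using that K(1) by (auto simp: S_def)
    then have "Inf (bd ` S) \<le> bd (K \<union> L)" by (intro cInf_lower bb) auto
    then show ?thesis using K(2) by linarith
  qed
  then show ?thesis using that[of K] K(1) by (auto simp: nearmin_def S_def)
qed

text \<open>Adding \<open>L\<close> to \<open>K\<close> removes the edges between them, of
  conductance \<open>a\<close>, from the boundary of \<open>K\<close> and adds the other boundary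
  edges of \<open>L\<close>, of conductance \<open>b\<close>. Near minimality gives
  \<open>a \<le> b + s0 / 2\<close>, so \<open>bd L = a + b \<le> 2 * b + bd L / 2\<close>.\<close>

lemma outer_cut:
  assumes K: "nearmin K" and L: "finite L" "L \<subseteq> verts G - K" "s0 \<le> bd L"
  shows "bd L / 4 \<le> (\<Sum>f\<in>edge_boundary G L - touch K. c f)"
proof -
  have finK: "finite K" using K by (simp add: nearmin_def)
  define a where "a = (\<Sum>f\<in>edge_boundary G L \<inter> touch K. c f)"
  define b where "b = (\<Sum>f\<in>edge_boundary G L - touch K. c f)"
  have ab: "bd L = a + b"
    unfolding bd_def a_def b_def by (rule sum.Int_Diff[OF finite_boundary[OF L(1)]])
  have sub: "edge_boundary G L \<inter> touch K \<subseteq> edge_boundary G K"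
    using L(2) by (auto simp: edge_boundary_def touch_def)
  have "edge_boundary G (K \<union> L) =
      (edge_boundary G K - (edge_boundary G L \<inter> touch K)) \<union> (edge_boundary G L - touch K)"
    using L(2) by (auto simp: edge_boundary_def touch_def)
  then have "bd (K \<union> L) = (\<Sum>f\<in>edge_boundary G K - (edge_boundary G L \<inter> touch K). c f) + b"
    unfolding bd_def b_def using boundary_touch[of K] finite_boundary[OF finK] finite_boundary[OF L(1)]
    by (simp only:) (rule sum.union_disjoint, auto)
  also have "\<dots> = bd K - a + b"
    unfolding bd_def a_def using sub finite_boundary[OF finK] by (subst sum_diff) auto
  finally have "bd (K \<union> L) = bd K - a + b" .
  moreover have "bd K - s0 / 2 \<le> bd (K \<union> L)" using K L by (auto simp: nearmin_def)
  ultimately show ?thesis using ab L(3) unfolding b_def[symmetric] by linarith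
qed

lemma \<sigma>_ge: "s0 \<le> \<sigma> k"
proof (induction k)
  case (Suc k)
  then have "0 < \<kappa> (\<sigma> k)" using \<kappa>_ge[of "\<sigma> k"] s0 by linarith
  then show ?case using Suc by (simp add: \<sigma>_Suc)
qed (simp add: \<sigma>0)

lemma \<kappa>\<sigma>: "s0 \<le> \<kappa> (\<sigma> k)"
  using \<kappa>_ge[of "\<sigma> k"] \<sigma>_ge[of k] s0 by linarith

text \<open>Makes \<open>\<sigma>\<close> unbounded, which contradicts finite volume in
  \<open>level_drop\<close>.\<close>

lemma \<sigma>_linear: "real k * (s0 / 8) \<le> \<sigma> k"
proof (induction k)
  case (Suc k) then show ?case using \<kappa>\<sigma>[of k] by (simp add: \<sigma>_Suc algebra_simps)
qed (use s0 \<sigma>0 in simp)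

text \<open>Up to a constant, a bound for the resistance that remains towards infinity once a
  cluster has volume \<open>\<sigma> k0\<close>.\<close>

definition rtail :: "nat \<Rightarrow> real" where "rtail k0 = (\<Sum>k. 1 / \<kappa> (\<sigma> (k + k0)))"

lemma rtail_summable: "summable (\<lambda>k. 1 / \<kappa> (\<sigma> (k + k0)))"
  using summable_ignore_initial_segment[OF summable] .

lemma rtail_ge: "(\<Sum>k<m. 1 / \<kappa> (\<sigma> (k + k0))) \<le> rtail k0"
  unfolding rtail_def by (rule sum_le_suminf[OF rtail_summable]) (use \<kappa>\<sigma> s0 in \<open>auto intro: order_trans[of 0 s0]\<close>)

lemma rtail_pos: "0 < rtail k0"
  using rtail_ge[where m = 1 and ?k0.0 = k0] \<kappa>\<sigma>[of k0] s0 by (auto intro: less_le_trans[of 0 "1 / \<kappa> (\<sigma> k0)"])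

lemma rtail_to_zero: "rtail \<longlonglongrightarrow> 0"
  unfolding rtail_def using suminf_exist_split2[OF summable] by simp

end

text \<open>The harmonic function \<open>\<eta>\<close> is only known through the flow it carries across its level sets.\<close>

locale level_flow = isoperimetric_net +
  fixes K :: "'a set" and \<eta> :: "'a \<Rightarrow> real" and \<rho> B :: real
  assumes K: "nearmin K" and B: "0 < B"
    and fin: "\<And>s. \<rho> < s \<Longrightarrow> finite {v\<in>verts G. s \<le> \<eta> v}"
    and flow: "\<And>s. \<rho> < s \<Longrightarrow> s \<le> 1 \<Longrightarrow>
      (\<Sum>f | f \<in> arcs G \<and> f \<notin> touch K \<and> (s \<le> \<eta> (tail G f)) \<noteq> (s \<le> \<eta> (head G f)).
         c f * \<bar>\<eta> (tail G f) - \<eta> (head G f)\<bar>) \<le> B"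
begin

definition lev :: "real \<Rightarrow> 'a set" where "lev s = {v\<in>verts G - K. s \<le> \<eta> v}"

abbreviation cl :: "real \<Rightarrow> 'a \<Rightarrow> 'a set" where "cl s v \<equiv> comp (lev s) v"

definition out :: "'a set \<Rightarrow> 'b set" where "out L = edge_boundary G L - touch K"

definition fl :: "'a set \<Rightarrow> real" where "fl L = (\<Sum>f\<in>out L. c f * \<bar>\<eta> (tail G f) - \<eta> (head G f)\<bar>)"

lemma lev_sub: "lev s \<subseteq> verts G - K" by (auto simp: lev_def)

lemma finite_lev: "\<rho> < s \<Longrightarrow> finite (lev s)"
  by (rule finite_subset[OF _ fin]) (auto simp: lev_def)

lemma finite_cl: "\<rho> < s \<Longrightarrow> v \<in> lev s \<Longrightarrow> finite (cl s v)"
  using finite_subset[OF comp_subset finite_lev] .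

lemma lev_mono: "s' \<le> s \<Longrightarrow> lev s \<subseteq> lev s'" by (auto simp: lev_def)

lemma out_cl:
  assumes "\<rho> < s" "v \<in> lev s"
  shows "\<kappa> (vol G c (cl s v)) / 4 \<le> (\<Sum>f\<in>out (cl s v). c f)" "s0 / 4 \<le> (\<Sum>f\<in>out (cl s v). c f)"
    "s0 \<le> vol G c (cl s v)"
proof -
  have sub: "cl s v \<subseteq> verts G - K" using comp_subset[OF assms(2)] lev_sub by blast
  note ge = bd_ge[OF _ finite_cl[OF assms] comp_connected[OF assms(2)]]
  have "bd (cl s v) / 4 \<le> (\<Sum>f\<in>out (cl s v). c f)"
    unfolding out_def using outer_cut[OF K finite_cl[OF assms] sub] ge(3) sub lev_sub by blast
  then show "\<kappa> (vol G c (cl s v)) / 4 \<le> (\<Sum>f\<in>out (cl s v). c f)" "s0 / 4 \<le> (\<Sum>f\<in>out (cl s v). c f)"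
    using ge(2,3) sub lev_sub by fastforce+
  show "s0 \<le> vol G c (cl s v)" using ge(4) sub lev_sub by blast
qed

text \<open>The outer end of the edge lies outside \<open>K\<close>. Were its value at least
  \<open>s\<close>, it would belong to \<open>lev s\<close> and be joined to the cluster by this
  very edge.\<close>

lemma out_cl_other:
  assumes "f \<in> out (cl s v)" "v \<in> lev s"
  shows "f \<in> arcs G" "f \<notin> touch K"
    "tail G f \<in> cl s v \<and> head G f \<notin> cl s v \<and> s \<le> \<eta> (tail G f) \<and> \<eta> (head G f) < s \<or>
     head G f \<in> cl s v \<and> tail G f \<notin> cl s v \<and> s \<le> \<eta> (head G f) \<and> \<eta> (tail G f) < s"
proof -
  show f: "f \<in> arcs G" "f \<notin> touch K" using assms by (auto simp: out_def edge_boundary_def)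
  then have t: "tail G f \<in> verts G - K" "head G f \<in> verts G - K" by (auto simp: touch_def)
  have "\<not> (tail G f \<in> lev s \<and> head G f \<in> lev s)"
    using comp_step[OF f(1), of "lev s" v] assms(1) by (auto simp: out_def edge_boundary_def)
  then show "tail G f \<in> cl s v \<and> head G f \<notin> cl s v \<and> s \<le> \<eta> (tail G f) \<and> \<eta> (head G f) < s \<or>
     head G f \<in> cl s v \<and> tail G f \<notin> cl s v \<and> s \<le> \<eta> (head G f) \<and> \<eta> (tail G f) < s"
    using assms(1) comp_subset[OF assms(2)] t by (auto simp: out_def edge_boundary_def lev_def)
qed

text \<open>Each boundary edge falls from level at least \<open>s\<close> to below \<open>s\<close>,
  and its upper end determines the cluster. So distinct clusters have disjoint boundaries, all of
  them among the edges counted in \<open>flow\<close>.\<close>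

lemma sum_fl_le:
  assumes s: "\<rho> < s" "s \<le> 1" and A: "A \<subseteq> lev s"
  shows "(\<Sum>L\<in>cl s ` A. fl L) \<le> B"
proof -
  have finA: "finite A" using A finite_lev[OF s(1)] finite_subset by blast
  have finO: "finite (out L)" if "L \<in> cl s ` A" for L
    unfolding out_def using that A finite_cl[OF s(1)] finite_boundary by auto
  let ?X = "{f \<in> arcs G. f \<notin> touch K \<and> (s \<le> \<eta> (tail G f)) \<noteq> (s \<le> \<eta> (head G f))}"
  have finX: "finite ?X"
    by (rule finite_subset[OF _ finite_boundary[OF fin[OF s(1)]]]) (auto simp: edge_boundary_def)
  have disj: "out L \<inter> out L' = {}" if LL: "L \<in> cl s ` A" "L' \<in> cl s ` A" "L \<noteq> L'" for L L'
  proof (rule ccontr)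
    assume "out L \<inter> out L' \<noteq> {}"
    then obtain f where f: "f \<in> out L" "f \<in> out L'" by blast
    obtain v v' where v: "v \<in> A" "L = cl s v" "v' \<in> A" "L' = cl s v'" using LL by blast
    have "\<exists>x. x \<in> cl s v \<and> x \<in> cl s v'"
      using out_cl_other(3)[of f s v] out_cl_other(3)[of f s v'] f v A by fastforce
    then have "cl s v = cl s v'" using comp_eq by metis
    then show False using v LL(3) by simp
  qed
  have "(\<Sum>L\<in>cl s ` A. fl L) = (\<Sum>f\<in>(\<Union>L\<in>cl s ` A. out L). c f * \<bar>\<eta> (tail G f) - \<eta> (head G f)\<bar>)"
    unfolding fl_def by (rule sum.UNION_disjoint[symmetric]) (use finA finO disj in auto)
  also have "\<dots> \<le> (\<Sum>f\<in>?X. c f * \<bar>\<eta> (tail G f) - \<eta> (head G f)\<bar>)"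
  proof (rule sum_mono2[OF finX])
    show "(\<Union>L\<in>cl s ` A. out L) \<subseteq> ?X"
    proof
      fix f assume "f \<in> (\<Union>L\<in>cl s ` A. out L)"
      then obtain v where "v \<in> A" "f \<in> out (cl s v)" by auto
      then show "f \<in> ?X" using out_cl_other[of f s v] A by fastforce
    qed
  qed (auto intro!: mult_nonneg_nonneg c_nonneg)
  also have "\<dots> \<le> B" using flow[OF s] .
  finally show ?thesis .
qed

text \<open>At most half of the conductance leaving the cluster can drop by more than \<open>d\<close>; the other half
  joins the cluster at level \<open>s - d\<close>.\<close>

lemma vol_step:
  assumes s: "\<rho> < s - d" and d: "0 < d" and v: "v \<in> lev s"
    and fl: "fl (cl s v) \<le> d * (\<Sum>f\<in>out (cl s v). c f) / 2"
  shows "vol G c (cl s v) + (\<Sum>f\<in>out (cl s v). c f) / 2 \<le> vol G c (cl (s - d) v)"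
proof -
  let ?L = "cl s v" and ?M = "cl (s - d) v"
  have \<rho>s: "\<rho> < s" using s d by linarith
  have v': "v \<in> lev (s - d)" using lev_mono[of "s - d" s] v d by auto
  have LM: "?L \<subseteq> ?M" by (rule comp_mono[OF lev_mono]) (use d in simp)
  have fin_out: "finite (out ?L)" unfolding out_def using finite_boundary[OF finite_cl[OF \<rho>s v]] by auto
  define bad where "bad = {f\<in>out ?L. d < \<bar>\<eta> (tail G f) - \<eta> (head G f)\<bar>}"
  have oc: "0 \<le> c f" if "f \<in> out ?L" for f using that c_nonneg by (auto simp: out_def edge_boundary_def)
  have "(\<Sum>f\<in>bad. c f) * d \<le> (\<Sum>f\<in>bad. c f * \<bar>\<eta> (tail G f) - \<eta> (head G f)\<bar>)"
    unfolding sum_distrib_right by (rule sum_mono, rule mult_left_mono) (auto simp: bad_def oc)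
  also have "\<dots> \<le> fl ?L" unfolding fl_def
    by (rule sum_mono2[OF fin_out]) (auto simp: bad_def oc)
  finally have "(\<Sum>f\<in>bad. c f) * d \<le> d * (\<Sum>f\<in>out ?L. c f) / 2" using fl by linarith
  then have bad: "(\<Sum>f\<in>bad. c f) \<le> (\<Sum>f\<in>out ?L. c f) / 2" using d by (simp add: field_simps)
  have "(\<Sum>f\<in>out ?L. c f) = (\<Sum>f\<in>bad. c f) + (\<Sum>f\<in>out ?L - bad. c f)"
    using sum.subset_diff[of bad "out ?L" c] fin_out by (auto simp: bad_def)
  then have good: "(\<Sum>f\<in>out ?L. c f) / 2 \<le> (\<Sum>f\<in>out ?L - bad. c f)" using bad by linarith
  \<comment> \<open>An edge that drops by at most \<open>d\<close> has its outer end still at level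
    \<open>s - d\<close>, hence in the larger cluster.\<close>
  have "out ?L - bad \<subseteq> touch (?M - ?L)"
  proof
    fix f assume f: "f \<in> out ?L - bad"
    then have small: "\<bar>\<eta> (tail G f) - \<eta> (head G f)\<bar> \<le> d" by (auto simp: bad_def)
    note o = out_cl_other[OF _ v, of f]
    have fo: "f \<in> out ?L" using f by blast
    have t: "tail G f \<in> verts G - K" "head G f \<in> verts G - K" using o(1,2)[OF fo] by (auto simp: touch_def)
    have "tail G f \<in> lev (s - d)" "head G f \<in> lev (s - d)"
      using o(3)[OF fo] small t d by (auto simp: lev_def)
    then show "f \<in> touch (?M - ?L)"
      using comp_step[OF o(1)[OF fo], of "lev (s - d)" v] o[OF fo] LM by (auto simp: touch_def)
  qed
  then have "(\<Sum>f\<in>out ?L - bad. c f) \<le> vol G c (?M - ?L)"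
    using finite_cl[OF s v'] by (intro sum_touch_le_vol) auto
  moreover have "vol G c ?M = vol G c ?L + vol G c (?M - ?L)"
    using vol_union[of ?L "?M - ?L" G c] finite_cl[OF s v'] finite_cl[OF \<rho>s v] LM by (simp add: Un_absorb1)
  ultimately show ?thesis using good by linarith
qed

text \<open>From volume \<open>\<sigma> k0\<close> on, a descent by
  \<open>8 * B / \<kappa> (\<sigma> (m + k0))\<close> gives the cluster of \<open>v\<close> the
  volume of the next term of \<open>\<sigma>\<close>, and all descents together cost at most
  \<open>8 * B * rtail k0\<close>. If \<open>\<rho>\<close> were lower than that, a single finite
  level set would contain clusters of unbounded volume.\<close>

lemma level_drop:
  assumes s: "\<rho> < s" "s \<le> 1" and v: "v \<in> lev s" and k0: "\<sigma> k0 \<le> vol G c (cl s v)"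
  shows "s - \<rho> \<le> 8 * B * rtail k0"
proof (rule ccontr)
  assume "\<not> s - \<rho> \<le> 8 * B * rtail k0"
  then have far: "8 * B * rtail k0 < s - \<rho>" by simp
  define u where "u m = s - (\<Sum>k<m. 8 * B / \<kappa> (\<sigma> (k + k0)))" for m
  have u_ge: "s - 8 * B * rtail k0 \<le> u m" for m
    using rtail_ge[where m = m and ?k0.0 = k0] B
    by (simp add: u_def sum_distrib_left[symmetric, of "8 * B", simplified] divide_inverse sum_distrib_left[symmetric])
  have "\<rho> < s - 8 * B * rtail k0" using far by simp
  then have u_gt: "\<rho> < u m" for m using u_ge less_le_trans by blast
  have \<kappa>pos: "0 < \<kappa> (\<sigma> k)" for k using \<kappa>\<sigma>[of k] s0 by linarith
  have u_le: "u m \<le> s" for m unfolding u_def using B \<kappa>pos by (auto intro!: sum_nonneg divide_nonneg_pos)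
  have vu: "v \<in> lev (u m)" for m using lev_mono[OF u_le] v by blast
  have grow: "\<sigma> (m + k0) \<le> vol G c (cl (u m) v)" for m
  proof (induction m)
    case 0 then show ?case using k0 by (simp add: u_def)
  next
    case (Suc m)
    let ?d = "8 * B / \<kappa> (\<sigma> (m + k0))"
    let ?b = "\<Sum>f\<in>out (cl (u m) v). c f"
    have u_Suc: "u (Suc m) = u m - ?d" by (simp add: u_def)
    have b: "\<kappa> (\<sigma> (m + k0)) / 4 \<le> ?b"
      using out_cl(1)[OF u_gt vu, of m] \<kappa>_mono[OF _ Suc.IH] \<sigma>_ge[of "m + k0"] s0 by linarith
    have "fl (cl (u m) v) \<le> B"
      using sum_fl_le[OF u_gt order_trans[OF u_le s(2)], of "{v}" m] vu by simp
    \<comment> \<open>The drop is chosen for this equality: it is the least one at which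
      \<open>vol_step\<close> tolerates a flow \<open>B\<close> through conductance
      \<open>\<kappa> (\<sigma> (m + k0)) / 4\<close>.\<close>
    also have "B = ?d * (\<kappa> (\<sigma> (m + k0)) / 4) / 2" using \<kappa>pos[of "m + k0"] by simp
    also have "\<dots> \<le> ?d * ?b / 2" using b B \<kappa>pos[of "m + k0"] by (intro divide_right_mono mult_left_mono) auto
    finally have "vol G c (cl (u m) v) + ?b / 2 \<le> vol G c (cl (u m - ?d) v)"
      using vol_step[of "u m" ?d v] vu u_gt[of "Suc m"] B \<kappa>pos[of "m + k0"] by (simp add: u_Suc)
    then show ?case using b Suc.IH by (simp add: u_Suc \<sigma>_Suc)
  qed
  let ?s = "s - 8 * B * rtail k0"
  have fin_s: "finite (lev ?s)" using finite_lev far by simp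
  have bound: "\<sigma> (m + k0) \<le> vol G c (lev ?s)" for m
  proof -
    have "cl (u m) v \<subseteq> lev ?s" using comp_subset[OF vu] lev_mono[OF u_ge] by blast
    then show ?thesis using grow[of m] vol_mono[OF _ fin_s] order_trans by blast
  qed
  obtain n :: nat where n: "vol G c (lev ?s) / (s0 / 8) < real n" using reals_Archimedean2 by blast
  then have "vol G c (lev ?s) < real n * (s0 / 8)" using s0 by (simp add: field_simps)
  also have "\<dots> \<le> real (n + k0) * (s0 / 8)" using s0 by (intro mult_right_mono) auto
  also have "\<dots> \<le> \<sigma> (n + k0)" by (rule \<sigma>_linear)
  finally show False using bound[of n] by simp
qed

text \<open>The clusters of a set of large volume either merge into a large one, or there are many of them
  and each carries a fixed amount of flow.\<close>

lemma level_drop_or_vol_bound: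
  assumes A: "A \<subseteq> verts G - K" "\<And>v. v \<in> A \<Longrightarrow> 1 \<le> \<eta> v" and \<rho>: "\<rho> \<le> 1/2" and k0: "0 < k0"
  shows "3 / 8 \<le> 8 * B * rtail k0 \<or> vol G c A \<le> 64 * (real k0)\<^sup>2 * \<sigma> k0 * B / s0"
proof (rule disjCI)
  assume no: "\<not> vol G c A \<le> 64 * (real k0)\<^sup>2 * \<sigma> k0 * B / s0"
  \<comment> \<open>\<open>k0\<close> drops of this size lead from level 1 to 7/8, which is still at
    least 3/8 above \<open>\<rho>\<close>.\<close>
  define d where "d = 1 / (8 * real k0)"
  have d: "0 < d" "real k0 * d = 1/8" using k0 by (auto simp: d_def)
  define u where "u k = 1 - real k * d" for k
  have u_ge: "7/8 \<le> u k" if "k \<le> k0" for k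
  proof -
    have "real k * d \<le> real k0 * d" using that d by (intro mult_right_mono) auto
    then show ?thesis using d by (simp add: u_def)
  qed
  have u\<rho>: "\<rho> < u k" if "k \<le> k0" for k using u_ge[OF that] \<rho> by linarith
  have u1: "u k \<le> 1" for k using d by (simp add: u_def)
  have Alev: "A \<subseteq> lev (u k)" for k using A u1[of k] by (force simp: lev_def)
  have finA: "finite A" using finite_subset[OF Alev finite_lev[OF u\<rho>[of 0]]] by simp
  have "\<exists>v\<in>A. \<sigma> k0 \<le> vol G c (cl (u k0) v)"
  proof (rule ccontr)
    assume "\<not> (\<exists>v\<in>A. \<sigma> k0 \<le> vol G c (cl (u k0) v))"
    then have small: "vol G c (cl (u k0) v) < \<sigma> k0" if "v \<in> A" for v using that by force
    \<comment> \<open>A cluster has outer conductance at least \<open>s0 / 4\<close>, so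
      \<open>vol_step\<close> can fail only for a flow of at least \<open>d * s0 / 8\<close>.
      \<open>Ak k\<close> collects the vertices where this happens at step \<open>k\<close>.\<close>
    define Ak where "Ak k = {v\<in>A. d * s0 / 8 \<le> fl (cl (u k) v)}" for k
    have "\<exists>k<k0. v \<in> Ak k" if v: "v \<in> A" for v
    proof (rule ccontr)
      assume nf: "\<not> (\<exists>k<k0. v \<in> Ak k)"
      have "\<sigma> k \<le> vol G c (cl (u k) v)" if "k \<le> k0" for k
        using that
      proof (induction k)
        case 0 then show ?case using out_cl(3)[OF u\<rho>[of 0], of v] Alev[of 0] v \<sigma>0 by auto
      next
        case (Suc k)
        let ?b = "\<Sum>f\<in>out (cl (u k) v). c f"
        have k: "k \<le> k0" "k < k0" using Suc.prems by auto
        have vk: "v \<in> lev (u k)" using Alev v by blast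
        have IH: "\<sigma> k \<le> vol G c (cl (u k) v)" using Suc k by simp
        note oc = out_cl[OF u\<rho>[OF k(1)] vk]
        have "fl (cl (u k) v) < d * s0 / 8" using nf k(2) v by (force simp: Ak_def)
        also have "\<dots> \<le> d * ?b / 2" using oc(2) d by (simp add: field_simps)
        finally have "vol G c (cl (u k) v) + ?b / 2 \<le> vol G c (cl (u k - d) v)"
          using vol_step[of "u k" d v] vk u\<rho>[OF Suc.prems] d by (simp add: u_def algebra_simps)
        moreover have "\<kappa> (\<sigma> k) / 4 \<le> ?b"
          using oc(1) \<kappa>_mono[OF _ IH] \<sigma>_ge[of k] s0 by linarith
        moreover have "u k - d = u (Suc k)" by (simp add: u_def algebra_simps)
        ultimately show ?case using IH by (simp add: \<sigma>_Suc)
      qed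
      then show False using small[OF v] by force
    qed
    then have cover: "A \<subseteq> (\<Union>k<k0. Ak k)" by auto
    have finAk: "finite (Ak k)" for k using finA by (simp add: Ak_def)
    \<comment> \<open>At most \<open>8 * B / (d * s0)\<close> clusters can carry that much of the
      total flow \<open>B\<close>, and each has volume at most \<open>\<sigma> k0\<close> by
      \<open>small\<close>.\<close>
    have volAk: "vol G c (Ak k) \<le> 8 * \<sigma> k0 * B / (d * s0)" if k: "k < k0" for k
    proof -
      have k': "k \<le> k0" using k by simp
      have sub: "Ak k \<subseteq> lev (u k)" using Alev[of k] by (auto simp: Ak_def)
      have "cl (u k) v \<subseteq> cl (u k0) v" for v
        by (rule comp_mono[OF lev_mono]) (use k d in \<open>simp add: u_def\<close>)
      then have vs: "vol G c (cl (u k) v) \<le> \<sigma> k0" if "v \<in> A" for v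
        using vol_mono[OF _ finite_cl[OF u\<rho>[of k0]], of "cl (u k) v" v] small[OF that] Alev that by fastforce
      have "vol G c (Ak k) \<le> vol G c (\<Union>L\<in>cl (u k) ` Ak k. L)"
        using finAk finite_cl[OF u\<rho>[OF k']] sub by (intro vol_mono) auto
      also have "\<dots> \<le> (\<Sum>L\<in>cl (u k) ` Ak k. vol G c L)"
        unfolding vol_def by (rule sum_UNION_le) (use finAk finite_cl[OF u\<rho>[OF k']] sub in
          \<open>auto intro!: add_nonneg_nonneg sum_nonneg c_nonneg simp: out_arcs_def in_arcs_def\<close>)
      also have "\<dots> \<le> (\<Sum>L\<in>cl (u k) ` Ak k. 8 * \<sigma> k0 / (d * s0) * fl L)"
      proof (rule sum_mono)
        fix L assume "L \<in> cl (u k) ` Ak k"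
        then obtain v where v: "v \<in> A" "L = cl (u k) v" "d * s0 / 8 \<le> fl L" by (auto simp: Ak_def)
        have "vol G c L \<le> 8 * \<sigma> k0 / (d * s0) * (d * s0 / 8)" using vs[OF v(1)] v(2) d s0 by simp
        also have "\<dots> \<le> 8 * \<sigma> k0 / (d * s0) * fl L"
          using v(3) d s0 \<sigma>_ge[of k0] by (intro mult_left_mono) auto
        finally show "vol G c L \<le> 8 * \<sigma> k0 / (d * s0) * fl L" .
      qed
      also have "\<dots> = 8 * \<sigma> k0 / (d * s0) * (\<Sum>L\<in>cl (u k) ` Ak k. fl L)" by (rule sum_distrib_left[symmetric])
      also have "\<dots> \<le> 8 * \<sigma> k0 / (d * s0) * B"
        using sum_fl_le[OF u\<rho>[OF k'] u1 sub] d s0 \<sigma>_ge[of k0] by (intro mult_left_mono) auto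
      finally show ?thesis by simp
    qed
    have "vol G c A \<le> vol G c (\<Union>k<k0. Ak k)" using cover finAk by (intro vol_mono) auto
    also have "\<dots> \<le> (\<Sum>k<k0. vol G c (Ak k))"
      unfolding vol_def by (rule sum_UNION_le) (use finAk in
          \<open>auto intro!: add_nonneg_nonneg sum_nonneg c_nonneg simp: out_arcs_def in_arcs_def\<close>)
    also have "\<dots> \<le> (\<Sum>k<k0. 8 * \<sigma> k0 * B / (d * s0))" by (rule sum_mono) (use volAk in auto)
    also have "\<dots> = 64 * (real k0)\<^sup>2 * \<sigma> k0 * B / s0"
      using k0 by (simp add: d_def power2_eq_square)
    finally show False using no by simp
  qed
  then obtain v where v: "v \<in> A" "\<sigma> k0 \<le> vol G c (cl (u k0) v)" by blast
  have "u k0 - \<rho> \<le> 8 * B * rtail k0"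
    by (rule level_drop[OF u\<rho> u1 _ v(2)]) (use Alev v in auto)
  then show "3 / 8 \<le> 8 * B * rtail k0" using u_ge[of k0] \<rho> by simp
qed

end

subsection \<open>Conditioning a spanning tree on its edges near a cut\<close>

locale wired_net = isoperimetric_net +
  fixes V0 :: "'a set"
  assumes V0: "finite V0" "V0 \<subseteq> verts G"
begin

abbreviation col :: "'a \<Rightarrow> 'a option" where "col \<equiv> collapse V0"
abbreviation \<Gamma> :: "('a option, 'b) pre_digraph" where "\<Gamma> \<equiv> wired G V0"
abbreviation E :: "'b set" where "E \<equiv> arcs \<Gamma>"

lemma tail_wired [simp]: "tail \<Gamma> f = col (tail G f)" and head_wired [simp]: "head \<Gamma> f = col (head G f)"
  by (simp_all add: wired_def)

lemma E_iff: "f \<in> E \<longleftrightarrow> f \<in> arcs G \<and> col (tail G f) \<noteq> col (head G f)"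
  by (simp add: wired_def)

lemma E_touch: "E \<subseteq> touch V0"
  by (auto simp: E_iff touch_def collapse_def split: if_splits)

lemma finite_E: "finite E"
  using E_touch finite_touch[OF V0(1)] finite_subset by blast

sublocale fin_net "tail \<Gamma>" "head \<Gamma>" "verts \<Gamma>" E c
  by unfold_locales (use finite_E in \<open>auto simp: E_iff wired_def conductance_pos\<close>)

end

text \<open>All ends of edges touching \<open>K\<close> lie in \<open>V0\<close>, so the collapse
  identifies nothing near \<open>K\<close>. The edge \<open>e\<close> stays unrevealed, as its
  conditional probability is being followed.\<close>

locale cut_stage = wired_net +
  fixes K :: "'a set" and e :: 'b
  assumes K: "nearmin K" and touch_V0: "f \<in> touch K \<Longrightarrow> tail G f \<in> V0 \<and> head G f \<in> V0"
    and eE: "e \<in> E" and eK: "e \<in> touch K"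
begin

definition R :: "'b set" where "R = touch K \<inter> E - {e}"

lemma finite_R: "finite R" using finite_E by (auto simp: R_def)

text \<open>Used for \<open>g = e\<close> and for edges \<open>g\<close> away from \<open>K\<close>.
  If \<open>q\<close> is the conditional probability of \<open>g\<close>, a unit potential
  difference drives a current \<open>c g * (1 - q) / q\<close> past \<open>g\<close>. If
  \<open>g\<close> does not touch \<open>K\<close>, it is itself one of the edges counted in
  \<open>level_flow\<close> and adds up to \<open>c g\<close>. \<open>B\<close> bounds the
  total.\<close>

context
  fixes Q :: "'b set" and g :: 'b and B :: real
  assumes Q: "Q \<subseteq> R" and g: "g \<in> E" "g \<notin> R"
    and Z1: "0 < W (\<lambda>T. T \<inter> R = Q \<and> g \<in> T)" and B: "0 < B"
    and cB: "c g * W (\<lambda>T. T \<inter> R = Q \<and> g \<notin> T) +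
        (if g \<in> touch K then 0 else c g * W (\<lambda>T. T \<inter> R = Q \<and> g \<in> T)) \<le>
        B * W (\<lambda>T. T \<inter> R = Q \<and> g \<in> T)"
begin

definition h :: "'a option \<Rightarrow> real" where
  "h w = side R Q g w / W (\<lambda>T. T \<inter> R = Q \<and> g \<in> T)"

lemma h_src: "h (tail \<Gamma> g) = 1"
proof -
  have "side R Q g (tail \<Gamma> g) = W (\<lambda>T. T \<inter> R = Q \<and> g \<in> T)"
    unfolding side_def by (rule W_cong) auto
  then show ?thesis using Z1 by (simp add: h_def)
qed

lemma h_tgt: "h (head \<Gamma> g) = 0"
proof -
  have "side R Q g (head \<Gamma> g) = W (\<lambda>T. False)"
    unfolding side_def by (rule W_cong) (use ST_sep in blast)
  then show ?thesis by (simp add: h_def W_def)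
qed

lemma h_nonneg: "0 \<le> h w" and h_le_1: "h w \<le> 1"
proof -
  show "0 \<le> h w" unfolding h_def side_def using Z1 W_nonneg by (simp add: divide_nonneg_pos)
  have "side R Q g w \<le> W (\<lambda>T. T \<inter> R = Q \<and> g \<in> T)"
    unfolding side_def by (rule W_mono) auto
  then show "h w \<le> 1" using Z1 by (simp add: h_def)
qed

lemma h_conn: "conn Q x y \<Longrightarrow> h x = h y"
proof -
  assume xy: "conn Q x y"
  have "conn (T - {g}) (tail \<Gamma> g) x = conn (T - {g}) (tail \<Gamma> g) y" if "T \<inter> R = Q" for T
    using xy that g(2) by (intro econn_cong_right) (auto elim!: econn_mono)
  then have "side R Q g x = side R Q g y"
    unfolding side_def by (intro W_cong) auto
  then show ?thesis by (simp add: h_def)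
qed

text \<open>Testing \<open>flow\<close> with the indicator \<open>\<phi>\<close> of the set where
  the potential is at least \<open>s\<close> gives the current through that level. The terms are
  nonnegative because indicator and potential increase together. The parameters \<open>a\<close> and
  \<open>b\<close> cover \<open>h\<close> and \<open>1 - h\<close> at once.\<close>

lemma sublevel_flow:
  fixes a b s :: real
  assumes b: "b = 1 \<or> b = - 1"
    and sep: "(s \<le> a + b * h (tail \<Gamma> g)) \<noteq> (s \<le> a + b * h (head \<Gamma> g))"
  defines "\<theta> \<equiv> \<lambda>v. a + b * h (col v)"
  shows "(\<Sum>f | f \<in> arcs G \<and> f \<notin> touch K \<and> (s \<le> \<theta> (tail G f)) \<noteq> (s \<le> \<theta> (head G f)).
         c f * \<bar>\<theta> (tail G f) - \<theta> (head G f)\<bar>) \<le> B"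
proof -
  let ?X = "{f \<in> arcs G. f \<notin> touch K \<and> (s \<le> \<theta> (tail G f)) \<noteq> (s \<le> \<theta> (head G f))}"
  define \<phi> where "\<phi> w = (of_bool (s \<le> a + b * h w) :: real)" for w
  define Z where "Z = W (\<lambda>T. T \<inter> R = Q \<and> g \<in> T)"
  define Z0 where "Z0 = W (\<lambda>T. T \<inter> R = Q \<and> g \<notin> T)"
  define trm where "trm f = c f * ((\<phi> (tail \<Gamma> f) - \<phi> (head \<Gamma> f)) * (\<theta> (tail G f) - \<theta> (head G f)))" for f
  have Zp: "0 < Z" using Z1 by (simp add: Z_def)
  have cf: "0 < c f" if "f \<in> E" for f using that c_pos by blast
  have mono: "0 \<le> (\<phi> (tail \<Gamma> f) - \<phi> (head \<Gamma> f)) * (\<theta> (tail G f) - \<theta> (head G f))" for f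
    by (auto simp: \<phi>_def \<theta>_def)
  have trm_nonneg: "0 \<le> trm f" if "f \<in> E" for f
    unfolding trm_def by (rule mult_nonneg_nonneg[OF less_imp_le[OF cf[OF that]] mono])
  have cross: "trm f = c f * \<bar>\<theta> (tail G f) - \<theta> (head G f)\<bar>" if "f \<in> ?X" for f
    using that by (auto simp: trm_def \<phi>_def \<theta>_def)
  have XE: "?X \<subseteq> E - R"
    by (auto simp: E_iff \<theta>_def R_def)
  have side: "side R Q g w = Z * h w" for w using Z1 by (simp add: h_def Z_def)
  have "(\<Sum>f\<in>E - R - {g}. trm f) * Z = b * (\<Sum>f\<in>E - R - {g}.
      c f * (\<phi> (tail \<Gamma> f) - \<phi> (head \<Gamma> f)) * (side R Q g (tail \<Gamma> f) - side R Q g (head \<Gamma> f)))"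
    unfolding sum_distrib_left sum_distrib_right
    by (rule sum.cong) (simp_all add: trm_def \<theta>_def side algebra_simps)
  also have "(\<Sum>f\<in>E - R - {g}. c f * (\<phi> (tail \<Gamma> f) - \<phi> (head \<Gamma> f)) *
      (side R Q g (tail \<Gamma> f) - side R Q g (head \<Gamma> f))) = c g * Z0 * (\<phi> (tail \<Gamma> g) - \<phi> (head \<Gamma> g))"
    unfolding Z0_def
    by (rule flow[OF Q g]) (use h_conn[OF econn_edge] in \<open>metis \<phi>_def\<close>)
  finally have flow1: "(\<Sum>f\<in>E - R - {g}. trm f) * Z = b * (c g * Z0 * (\<phi> (tail \<Gamma> g) - \<phi> (head \<Gamma> g)))" .
  have "0 \<le> c g * Z0" using cf[OF g(1)] W_nonneg by (simp add: Z0_def)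
  moreover have "b * (\<phi> (tail \<Gamma> g) - \<phi> (head \<Gamma> g)) \<le> 1" using b by (auto simp: \<phi>_def)
  ultimately have "c g * Z0 * (b * (\<phi> (tail \<Gamma> g) - \<phi> (head \<Gamma> g))) \<le> c g * Z0 * 1"
    by (rule mult_left_mono[rotated])
  then have flow2: "(\<Sum>f\<in>E - R - {g}. trm f) * Z \<le> c g * Z0"
    using flow1 by (simp add: mult_ac)
  have finER: "finite (E - R)" using finite_E by simp
  have "(\<Sum>f\<in>?X. c f * \<bar>\<theta> (tail G f) - \<theta> (head G f)\<bar>) = (\<Sum>f\<in>?X. trm f)"
    by (rule sum.cong) (use cross in auto)
  also have "\<dots> \<le> (\<Sum>f\<in>E - R - {g}. trm f) + (if g \<in> touch K then 0 else c g)"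
  proof (cases "g \<in> touch K")
    case True
    then have "?X \<subseteq> E - R - {g}" using XE by auto
    then show ?thesis using True finER trm_nonneg by (simp, intro sum_mono2) auto
  next
    case False
    have "(\<Sum>f\<in>?X. trm f) \<le> (\<Sum>f\<in>E - R. trm f)" using XE finER trm_nonneg by (intro sum_mono2) auto
    also have "\<dots> = trm g + (\<Sum>f\<in>E - R - {g}. trm f)" using g finER by (intro sum.remove) auto
    also have "trm g \<le> c g"
    proof -
      have "(\<phi> (tail \<Gamma> g) - \<phi> (head \<Gamma> g)) * (\<theta> (tail G g) - \<theta> (head G g)) \<le> 1"
        using b h_src h_tgt by (auto simp: \<phi>_def \<theta>_def)
      then show ?thesis unfolding trm_def using cf[OF g(1)] by (simp add: mult_left_le)
    qed
    finally show ?thesis using False by simp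
  qed
  finally have "(\<Sum>f\<in>?X. c f * \<bar>\<theta> (tail G f) - \<theta> (head G f)\<bar>) * Z \<le>
      ((\<Sum>f\<in>E - R - {g}. trm f) + (if g \<in> touch K then 0 else c g)) * Z"
    using Zp by (intro mult_right_mono) auto
  also have "\<dots> \<le> B * Z" using flow2 cB by (auto simp: Z_def Z0_def algebra_simps split: if_splits)
  finally show ?thesis using Zp by simp
qed

text \<open>\<open>\<rho>\<close> is the value at the wired vertex: above it a level set avoids that
  vertex, so it lies in \<open>V0\<close> and is finite.\<close>

lemma level_flow_src: "level_flow G c \<kappa> s0 \<sigma> K (\<lambda>v. h (col v)) (h None) B"
proof unfold_locales
  show "nearmin K" "0 < B" by (rule K, rule B)
  show "finite {v \<in> verts G. s \<le> h (col v)}" if "h None < s" for s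
    by (rule finite_subset[OF _ V0(1)]) (use that in \<open>auto simp: collapse_def split: if_splits\<close>)
  fix s assume s: "h None < s" "s \<le> 1"
  show "(\<Sum>f | f \<in> arcs G \<and> f \<notin> touch K \<and> (s \<le> h (col (tail G f))) \<noteq> (s \<le> h (col (head G f))).
      c f * \<bar>h (col (tail G f)) - h (col (head G f))\<bar>) \<le> B"
    using sublevel_flow[of 1 s 0] s h_src h_tgt h_nonneg[of None] by simp
qed

lemma level_flow_tgt: "level_flow G c \<kappa> s0 \<sigma> K (\<lambda>v. 1 - h (col v)) (1 - h None) B"
proof unfold_locales
  show "nearmin K" "0 < B" by (rule K, rule B)
  show "finite {v \<in> verts G. s \<le> 1 - h (col v)}" if "1 - h None < s" for s
    by (rule finite_subset[OF _ V0(1)]) (use that in \<open>auto simp: collapse_def split: if_splits\<close>)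
  fix s assume s: "1 - h None < s" "s \<le> 1"
  show "(\<Sum>f | f \<in> arcs G \<and> f \<notin> touch K \<and> (s \<le> 1 - h (col (tail G f))) \<noteq> (s \<le> 1 - h (col (head G f))).
      c f * \<bar>1 - h (col (tail G f)) - (1 - h (col (head G f)))\<bar>) \<le> B"
    using sublevel_flow[of "- 1" s 1] s h_src h_tgt h_le_1[of None] by simp
qed

text \<open>The value at the wired vertex is at most 1/2 for one of \<open>h\<close> and
  \<open>1 - h\<close>, so from one end of \<open>g\<close> the potential falls by at least 1/2 on
  the way to infinity. Which end this is remains open; hence both sets are assumed nonempty, and the
  volume bound is for the smaller one.\<close>

lemma resistance_bounds:
  assumes A1: "A1 \<subseteq> verts G - K" "\<And>v. v \<in> A1 \<Longrightarrow> conn Q (tail \<Gamma> g) (col v)"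
    and A2: "A2 \<subseteq> verts G - K" "\<And>v. v \<in> A2 \<Longrightarrow> conn Q (head \<Gamma> g) (col v)"
  shows "A1 \<noteq> {} \<Longrightarrow> A2 \<noteq> {} \<Longrightarrow> 1 / 2 \<le> 8 * B * rtail 0"
    and "0 < k0 \<Longrightarrow> 3 / 8 \<le> 8 * B * rtail k0 \<or> min (vol G c A1) (vol G c A2) \<le> 64 * (real k0)\<^sup>2 * \<sigma> k0 * B / s0"
proof -
  have h1: "h (col v) = 1" if "v \<in> A1" for v using h_conn[OF A1(2)[OF that]] h_src by simp
  have h2: "h (col v) = 0" if "v \<in> A2" for v using h_conn[OF A2(2)[OF that]] h_tgt by simp
  consider "h None \<le> 1/2" | "1 - h None \<le> 1/2" by linarith
  then have "(A1 \<noteq> {} \<longrightarrow> A2 \<noteq> {} \<longrightarrow> 1 / 2 \<le> 8 * B * rtail 0) \<and> (0 < k0 \<longrightarrow>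
      3 / 8 \<le> 8 * B * rtail k0 \<or> min (vol G c A1) (vol G c A2) \<le> 64 * (real k0)\<^sup>2 * \<sigma> k0 * B / s0)"
  proof cases
    case 1
    interpret L: level_flow G c \<kappa> s0 \<sigma> K "\<lambda>v. h (col v)" "h None" B by (rule level_flow_src)
    have "1 / 2 \<le> 8 * B * rtail 0" if v: "v \<in> A1" for v
    proof -
      have "v \<in> L.lev 1" using v A1(1) h1 by (auto simp: L.lev_def)
      from L.level_drop[OF _ _ this, of 0] L.out_cl(3)[OF _ this] 1 \<sigma>0 show ?thesis by simp
    qed
    moreover have "3 / 8 \<le> 8 * B * rtail k0 \<or> vol G c A1 \<le> 64 * (real k0)\<^sup>2 * \<sigma> k0 * B / s0" if "0 < k0"
      by (rule L.level_drop_or_vol_bound) (use A1 h1 1 that in auto)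
    ultimately show ?thesis by (auto simp: min_le_iff_disj)
  next
    case 2
    interpret L: level_flow G c \<kappa> s0 \<sigma> K "\<lambda>v. 1 - h (col v)" "1 - h None" B by (rule level_flow_tgt)
    have "1 / 2 \<le> 8 * B * rtail 0" if v: "v \<in> A2" for v
    proof -
      have "v \<in> L.lev 1" using v A2(1) h2 by (auto simp: L.lev_def)
      from L.level_drop[OF _ _ this, of 0] L.out_cl(3)[OF _ this] 2 \<sigma>0 show ?thesis by simp
    qed
    moreover have "3 / 8 \<le> 8 * B * rtail k0 \<or> vol G c A2 \<le> 64 * (real k0)\<^sup>2 * \<sigma> k0 * B / s0" if "0 < k0"
      by (rule L.level_drop_or_vol_bound) (use A2 h2 2 that in auto)
    ultimately show ?thesis by (auto simp: min_le_iff_disj)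
  qed
  then show "A1 \<noteq> {} \<Longrightarrow> A2 \<noteq> {} \<Longrightarrow> 1 / 2 \<le> 8 * B * rtail 0"
    and "0 < k0 \<Longrightarrow> 3 / 8 \<le> 8 * B * rtail k0 \<or> min (vol G c A1) (vol G c A2) \<le> 64 * (real k0)\<^sup>2 * \<sigma> k0 * B / s0"
    by blast+
qed

end

text \<open>By Kirchhoff's formula the conditional probability is \<open>c g\<close> times the
  effective resistance between the ends of \<open>g\<close>. Both ends lie outside \<open>K\<close>,
  so \<open>resistance_bounds\<close> applies to these two vertices;
  \<open>1 / 2 \<le> 8 * B * rtail 0\<close> is the origin of the factor 16.\<close>

lemma edge_probability_le:
  assumes Q: "Q \<subseteq> R" and g: "g \<in> E" "g \<notin> touch K"
  shows "W (\<lambda>T. T \<inter> R = Q \<and> g \<in> T) \<le> 16 * rtail 0 * c g * W (\<lambda>T. T \<inter> R = Q)"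
proof -
  define Z where "Z = W (\<lambda>T. T \<inter> R = Q \<and> g \<in> T)"
  define Z0 where "Z0 = W (\<lambda>T. T \<inter> R = Q \<and> g \<notin> T)"
  have ZZ: "W (\<lambda>T. T \<inter> R = Q) = Z + Z0" unfolding Z_def Z0_def by (rule W_split)
  have nn: "0 \<le> Z" "0 \<le> Z0" unfolding Z_def Z0_def by (rule W_nonneg)+
  have cg: "0 < c g" using g c_pos by blast
  show ?thesis
  proof (cases "0 < Z")
    case True
    define B where "B = c g * (Z + Z0) / Z"
    have B: "0 < B" using True nn cg by (simp add: B_def)
    have gR: "g \<notin> R" using g by (simp add: R_def)
    have cB: "c g * W (\<lambda>T. T \<inter> R = Q \<and> g \<notin> T) +
        (if g \<in> touch K then 0 else c g * W (\<lambda>T. T \<inter> R = Q \<and> g \<in> T)) \<le> B * W (\<lambda>T. T \<inter> R = Q \<and> g \<in> T)"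
    proof -
      have "B * Z = c g * (Z + Z0)" using True by (simp add: B_def)
      then show ?thesis unfolding Z_def[symmetric] Z0_def[symmetric] using g(2) by (simp add: algebra_simps)
    qed
    have Z1: "0 < W (\<lambda>T. T \<inter> R = Q \<and> g \<in> T)" using True by (simp add: Z_def)
    have ga: "g \<in> arcs G" using g(1) by (simp add: E_iff)
    have "1 / 2 \<le> 8 * B * rtail 0"
      by (rule resistance_bounds(1)[OF Q g(1) gR Z1 B cB, of "{tail G g}" "{head G g}"])
        (use ga g(2) in \<open>auto simp: touch_def\<close>)
    then show ?thesis using True unfolding ZZ Z_def[symmetric] B_def by (simp add: field_simps)
  next
    case False
    then have "Z = 0" using nn by linarith
    then show ?thesis using nn cg rtail_pos[of 0] unfolding ZZ Z_def[symmetric] by simp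
  qed
qed

text \<open>Vertices of \<open>K\<close> are left out because isoperimetry is available only outside
  \<open>K\<close>; from \<open>nbrs K\<close> the wired vertex is never reached
  (\<open>cluster_nbrs\<close>).\<close>

definition cluster :: "'b set \<Rightarrow> 'a \<Rightarrow> 'a set" where
  "cluster Q x = {v \<in> V0 - K. conn Q (col x) (col v)}"

lemma eR: "e \<notin> R" by (simp add: R_def)

lemma cluster_sub: "cluster Q x \<subseteq> verts G - K" using V0 by (auto simp: cluster_def)

text \<open>Since \<open>e\<close> touches \<open>K\<close>, the resistance that is bounded is that
  of the network without \<open>e\<close>. Times \<open>c e\<close> it equals the odds
  \<open>q / (1 - q)\<close>, so \<open>q\<close> stays away from 1.\<close>

lemma not_edge_probability_ge:
  assumes Q: "Q \<subseteq> R" and ne: "cluster Q (tail G e) \<noteq> {}" "cluster Q (head G e) \<noteq> {}"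
  shows "W (\<lambda>T. T \<inter> R = Q \<and> e \<in> T) \<le> 16 * rtail 0 * c e * W (\<lambda>T. T \<inter> R = Q \<and> e \<notin> T)"
proof (rule ccontr)
  assume neg: "\<not> ?thesis"
  define Z where "Z = W (\<lambda>T. T \<inter> R = Q \<and> e \<in> T)"
  define Z0 where "Z0 = W (\<lambda>T. T \<inter> R = Q \<and> e \<notin> T)"
  have nn: "0 \<le> Z" "0 \<le> Z0" unfolding Z_def Z0_def by (rule W_nonneg)+
  have ce: "0 < c e" using eE c_pos by blast
  have lt: "16 * rtail 0 * c e * Z0 < Z" using neg by (simp add: Z_def Z0_def)
  then have Zp: "0 < Z" using nn ce rtail_pos[of 0] by (auto intro: le_less_trans[rotated])
  \<comment> \<open>The second entry keeps \<open>B\<close> positive when \<open>Z0 = 0\<close>. It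
    gives \<open>8 * B * rtail 0 = 1 / 4\<close>, still too little for the resistance bound.\<close>
  define B where "B = max (c e * Z0 / Z) (1 / (32 * rtail 0))"
  have rt: "0 < rtail 0" by (rule rtail_pos)
  have B: "0 < B" using rt by (simp add: B_def less_max_iff_disj)
  have "c e * Z0 / Z \<le> B" by (simp add: B_def)
  then have cB: "c e * W (\<lambda>T. T \<inter> R = Q \<and> e \<notin> T) +
        (if e \<in> touch K then 0 else c e * W (\<lambda>T. T \<inter> R = Q \<and> e \<in> T)) \<le> B * W (\<lambda>T. T \<inter> R = Q \<and> e \<in> T)"
    unfolding Z_def[symmetric] Z0_def[symmetric] using eK Zp by (simp add: field_simps)
  have Z1: "0 < W (\<lambda>T. T \<inter> R = Q \<and> e \<in> T)" using Zp by (simp add: Z_def)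
  have "1 / 2 \<le> 8 * B * rtail 0"
    by (rule resistance_bounds(1)[OF Q eE eR Z1 B cB cluster_sub _ cluster_sub _ ne])
      (auto simp: cluster_def)
  moreover have "8 * (c e * Z0 / Z) * rtail 0 < 1 / 2" using lt Zp by (simp add: field_simps)
  moreover have "8 * (1 / (32 * rtail 0)) * rtail 0 < 1 / 2" using rt by simp
  ultimately show False unfolding B_def by (auto simp: max_def split: if_splits)
qed

text \<open>For \<open>q \<ge> \<epsilon>\<close> the current \<open>c e * (1 - q) / q\<close> is at
  most \<open>c e / \<epsilon>\<close>, and the condition on \<open>k0\<close> excludes the first
  alternative of \<open>resistance_bounds\<close>.\<close>

lemma cluster_volume_le:
  assumes Q: "Q \<subseteq> R" and \<epsilon>: "0 < \<epsilon>" "\<epsilon> * W (\<lambda>T. T \<inter> R = Q) \<le> W (\<lambda>T. T \<inter> R = Q \<and> e \<in> T)"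
    and Zp: "0 < W (\<lambda>T. T \<inter> R = Q)"
    and k0: "0 < k0" "8 * (c e / \<epsilon>) * rtail k0 < 3 / 8"
  shows "min (vol G c (cluster Q (tail G e))) (vol G c (cluster Q (head G e))) \<le> 64 * (real k0)\<^sup>2 * \<sigma> k0 * (c e / \<epsilon>) / s0"
proof -
  define Z where "Z = W (\<lambda>T. T \<inter> R = Q \<and> e \<in> T)"
  define Z0 where "Z0 = W (\<lambda>T. T \<inter> R = Q \<and> e \<notin> T)"
  have ZZ: "W (\<lambda>T. T \<inter> R = Q) = Z + Z0" unfolding Z_def Z0_def by (rule W_split)
  have nn: "0 \<le> Z" "0 \<le> Z0" unfolding Z_def Z0_def by (rule W_nonneg)+
  have ce: "0 < c e" using eE c_pos by blast
  have "0 < \<epsilon> * (Z + Z0)" using \<epsilon>(1) Zp ZZ by simp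
  then have Z1: "0 < W (\<lambda>T. T \<inter> R = Q \<and> e \<in> T)" using \<epsilon>(2) unfolding ZZ by linarith
  have B: "0 < c e / \<epsilon>" using ce \<epsilon> by simp
  have "\<epsilon> * Z0 \<le> \<epsilon> * (Z + Z0)" using nn \<epsilon>(1) by (intro mult_left_mono) auto
  then have "\<epsilon> * Z0 \<le> Z" using \<epsilon>(2) unfolding ZZ Z_def[symmetric] by linarith
  then have "c e * (\<epsilon> * Z0) \<le> c e * Z" using ce by (intro mult_left_mono) auto
  then have cB: "c e * W (\<lambda>T. T \<inter> R = Q \<and> e \<notin> T) +
        (if e \<in> touch K then 0 else c e * W (\<lambda>T. T \<inter> R = Q \<and> e \<in> T)) \<le> c e / \<epsilon> * W (\<lambda>T. T \<inter> R = Q \<and> e \<in> T)"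
    unfolding Z_def[symmetric] Z0_def[symmetric] using eK \<epsilon> by (simp add: field_simps)
  have "3 / 8 \<le> 8 * (c e / \<epsilon>) * rtail k0 \<or> min (vol G c (cluster Q (tail G e))) (vol G c (cluster Q (head G e)))
      \<le> 64 * (real k0)\<^sup>2 * \<sigma> k0 * (c e / \<epsilon>) / s0"
    by (rule resistance_bounds(2)[OF Q eE eR Z1 B cB cluster_sub _ cluster_sub _ k0(1)])
      (auto simp: cluster_def)
  then show ?thesis using k0(2) by linarith
qed

end

subsection \<open>The expected variance gain\<close>

context fin_net
begin

lemma W_mean:
  assumes "finite S" "card S \<le> n"
  shows "(\<Sum>k\<le>n. real k * W (\<lambda>T. P T \<and> card (T \<inter> S) = k)) = (\<Sum>f\<in>S. W (\<lambda>T. P T \<and> f \<in> T))"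
proof -
  let ?A = "{T\<in>ST. P T}"
  have "(\<Sum>k\<le>n. real k * W (\<lambda>T. P T \<and> card (T \<inter> S) = k)) =
      (\<Sum>k\<le>n. sum (\<lambda>T. real (card (T \<inter> S)) * wt T) {T\<in>?A. card (T \<inter> S) = k})"
    unfolding W_def sum_distrib_left by (intro sum.cong) auto
  also have "\<dots> = (\<Sum>T\<in>?A. real (card (T \<inter> S)) * wt T)"
  proof (rule sum.group)
    have "card (T \<inter> S) \<le> n" for T
      using card_mono[OF assms(1), of "T \<inter> S"] assms(2) by simp
    then show "(\<lambda>T. card (T \<inter> S)) ` ?A \<subseteq> {..n}" by auto
  qed auto
  also have "\<dots> = (\<Sum>T\<in>?A. \<Sum>f\<in>S. if f \<in> T then wt T else 0)"
  proof (rule sum.cong[OF refl])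
    fix T
    have "(\<Sum>f\<in>S. if f \<in> T then wt T else 0) = (\<Sum>f\<in>S \<inter> T. wt T)"
      using sum.inter_restrict[OF assms(1), of "\<lambda>_. wt T" T] by simp
    then show "real (card (T \<inter> S)) * wt T = (\<Sum>f\<in>S. if f \<in> T then wt T else 0)"
      by (simp add: Int_commute)
  qed
  also have "\<dots> = (\<Sum>f\<in>S. \<Sum>T\<in>?A. if f \<in> T then wt T else 0)" by (rule sum.swap)
  also have "\<dots> = (\<Sum>f\<in>S. W (\<lambda>T. P T \<and> f \<in> T))"
  proof (rule sum.cong[OF refl])
    fix f
    have "W (\<lambda>T. P T \<and> f \<in> T) = sum wt {T\<in>?A. f \<in> T}" unfolding W_def by (rule sum.cong) auto
    also have "\<dots> = (\<Sum>T\<in>?A. if f \<in> T then wt T else 0)" by (rule sum.inter_filter) simp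
    finally show "(\<Sum>T\<in>?A. if f \<in> T then wt T else 0) = W (\<lambda>T. P T \<and> f \<in> T)" by simp
  qed
  finally show ?thesis .
qed

text \<open>The mass of \<open>Q\<close> times the squared conditional probability of
  \<open>e\<close>. Summed over \<open>Q\<close> it is the second moment of that probability, still
  unnormalised.\<close>

definition energy :: "'e \<Rightarrow> 'e set \<Rightarrow> 'e set \<Rightarrow> real" where
  "energy e R Q = (W (\<lambda>T. T \<inter> R = Q \<and> e \<in> T))\<^sup>2 / W (\<lambda>T. T \<inter> R = Q)"

text \<open>The count \<open>card (T \<inter> S)\<close> is a function of
  \<open>T \<inter> R'\<close>, so knowing it together with \<open>T \<inter> R\<close> lies between
  the two stages. A gain found there is not lost when all of \<open>R'\<close> is revealed.\<close>

lemma energy_refine: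
  assumes R': "finite R'" "R \<subseteq> R'" "S \<subseteq> R'" and n: "card S \<le> n"
  shows "(\<Sum>k\<le>n. (W (\<lambda>T. T \<inter> R = Q \<and> e \<in> T \<and> card (T \<inter> S) = k))\<^sup>2 / W (\<lambda>T. T \<inter> R = Q \<and> card (T \<inter> S) = k))
     \<le> (\<Sum>Q' | Q' \<subseteq> R' \<and> Q' \<inter> R = Q. energy e R' Q')"
proof -
  define I where "I = {Q'. Q' \<subseteq> R' \<and> Q' \<inter> R = Q}"
  define Ik where "Ik k = {Q'\<in>I. card (Q' \<inter> S) = k}" for k
  have finI: "finite I" by (rule finite_subset[of _ "Pow R'"]) (use R' in \<open>auto simp: I_def\<close>)
  have finIk: "finite (Ik k)" for k using finI by (simp add: Ik_def)
  have TR: "T \<inter> R' \<inter> R = T \<inter> R" "T \<inter> R' \<inter> S = T \<inter> S" for T using R' by auto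
  have key: "T \<inter> R = Q \<and> card (T \<inter> S) = k" if "Q' \<in> Ik k" "T \<inter> R' = Q'" for T Q' k
    using TR[of T] that by (simp add: Ik_def I_def)
  have in_Ik: "T \<inter> R' \<in> Ik k" if "T \<inter> R = Q" "card (T \<inter> S) = k" for T k
    using that by (simp add: Ik_def I_def TR)
  have mass: "W (\<lambda>T. T \<inter> R = Q \<and> card (T \<inter> S) = k) = (\<Sum>Q'\<in>Ik k. W (\<lambda>T. T \<inter> R' = Q'))" for k
  proof -
    have "W (\<lambda>T. T \<inter> R = Q \<and> card (T \<inter> S) = k) =
        (\<Sum>Q'\<in>Ik k. W (\<lambda>T. (T \<inter> R = Q \<and> card (T \<inter> S) = k) \<and> T \<inter> R' = Q'))"
      by (rule W_partition[OF finIk]) (use in_Ik in blast)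
    also have "\<dots> = (\<Sum>Q'\<in>Ik k. W (\<lambda>T. T \<inter> R' = Q'))"
      by (intro sum.cong refl W_cong) (use key in blast)
    finally show ?thesis .
  qed
  have hit: "W (\<lambda>T. T \<inter> R = Q \<and> e \<in> T \<and> card (T \<inter> S) = k) = (\<Sum>Q'\<in>Ik k. W (\<lambda>T. T \<inter> R' = Q' \<and> e \<in> T))" for k
  proof -
    have "W (\<lambda>T. T \<inter> R = Q \<and> e \<in> T \<and> card (T \<inter> S) = k) =
        (\<Sum>Q'\<in>Ik k. W (\<lambda>T. (T \<inter> R = Q \<and> e \<in> T \<and> card (T \<inter> S) = k) \<and> T \<inter> R' = Q'))"
      by (rule W_partition[OF finIk]) (use in_Ik in blast)
    also have "\<dots> = (\<Sum>Q'\<in>Ik k. W (\<lambda>T. T \<inter> R' = Q' \<and> e \<in> T))"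
      by (intro sum.cong refl W_cong) (use key in blast)
    finally show ?thesis .
  qed
  have "(\<Sum>k\<le>n. (W (\<lambda>T. T \<inter> R = Q \<and> e \<in> T \<and> card (T \<inter> S) = k))\<^sup>2 / W (\<lambda>T. T \<inter> R = Q \<and> card (T \<inter> S) = k))
      \<le> (\<Sum>k\<le>n. \<Sum>Q'\<in>Ik k. energy e R' Q')"
    unfolding mass hit energy_def
    by (intro sum_mono sum_square_divide_ge finIk W_nonneg W_mono) auto
  also have "\<dots> = (\<Sum>Q'\<in>I. energy e R' Q')"
    unfolding Ik_def
  proof (rule sum.group[OF finI])
    have "card (Q' \<inter> S) \<le> n" for Q'
      using card_mono[OF finite_subset[OF R'(3,1)], of "Q' \<inter> S"] n by simp
    then show "(\<lambda>Q'. card (Q' \<inter> S)) ` I \<subseteq> {..n}" by auto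
  qed auto
  finally show ?thesis by (simp add: I_def)
qed

lemma energy_refine_simple:
  assumes "finite R'" "R \<subseteq> R'"
  shows "energy e R Q \<le> (\<Sum>Q' | Q' \<subseteq> R' \<and> Q' \<inter> R = Q. energy e R' Q')"
  using energy_refine[OF assms, of "{}" 0 Q e] by (simp add: energy_def)

lemma total_energy_le:
  assumes "finite R"
  shows "(\<Sum>Q\<in>Pow R. energy e R Q) \<le> W (\<lambda>T. True)"
proof -
  have "(\<Sum>Q\<in>Pow R. energy e R Q) \<le> (\<Sum>Q\<in>Pow R. W (\<lambda>T. True \<and> T \<inter> R = Q))"
  proof (rule sum_mono)
    fix Q
    define a where "a = W (\<lambda>T. T \<inter> R = Q \<and> e \<in> T)"
    define b where "b = W (\<lambda>T. T \<inter> R = Q)"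
    have ab: "0 \<le> a" "a \<le> b" unfolding a_def b_def by (auto intro: W_nonneg W_mono)
    have "a\<^sup>2 / b \<le> b"
    proof (cases "b = 0")
      case False
      have "a\<^sup>2 \<le> b\<^sup>2" using ab by (intro power_mono) auto
      then show ?thesis using ab False by (simp add: field_simps power2_eq_square)
    qed simp
    then show "energy e R Q \<le> W (\<lambda>T. True \<and> T \<inter> R = Q)" by (simp add: energy_def a_def b_def)
  qed
  also have "\<dots> = W (\<lambda>T. True)" by (rule W_partition[symmetric]) (use assms in auto)
  finally show ?thesis .
qed

end

section \<open>Constants that are uniform over the finite graphs\<close>

context isoperimetric_net
begin

definition drop_index :: "real \<Rightarrow> nat" where
  "drop_index b = (SOME k. 0 < k \<and> 8 * b * rtail k < 3 / 8)"

lemma drop_index: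
  "0 < drop_index b" "8 * b * rtail (drop_index b) < 3 / 8"
proof -
  have "(\<lambda>k. 8 * b * rtail k) \<longlonglongrightarrow> 8 * b * 0" by (intro tendsto_intros rtail_to_zero)
  then have "\<forall>\<^sub>F k in sequentially. 8 * b * rtail k < 3 / 8" by (rule order_tendstoD) simp
  then have "\<forall>\<^sub>F k in sequentially. 0 < k \<and> 8 * b * rtail k < 3 / 8"
    using eventually_gt_at_top[of 0] by eventually_elim simp
  then have "\<exists>k. 0 < k \<and> 8 * b * rtail k < 3 / 8" by (rule eventually_happens'[rotated]) simp
  from someI_ex[OF this] show "0 < drop_index b" "8 * b * rtail (drop_index b) < 3 / 8"
    unfolding drop_index_def by auto
qed

definition vbound :: "real \<Rightarrow> real" where
  "vbound b = 64 * (real (drop_index b))\<^sup>2 * \<sigma> (drop_index b) * b / s0"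

text \<open>The bound of \<open>variance_lower_bound\<close> for \<open>a = c e\<close> and
  \<open>b = c e / \<epsilon>\<close>: the ratio \<open>\<tau>\<close> is conductance at the cluster
  over \<open>c e\<close>, \<open>\<eta>\<close> comes from the odds bound, and the number of terms
  exceeds twice the bound on the mean. Neither \<open>K\<close> nor the finite graph enters.\<close>

definition gain :: "real \<Rightarrow> real \<Rightarrow> real" where
  "gain a b = 1 / (2 * (\<Sum>k<Suc (nat \<lceil>2 * (16 * rtail 0 * vbound b)\<rceil>).
     mass_bound (vbound b / a) (1 / (1 + 16 * rtail 0 * a)) k))\<^sup>2"

lemma vbound_pos: "0 < b \<Longrightarrow> 0 < vbound b"
  using drop_index(1)[of b] s0 \<sigma>_ge[of "drop_index b"] by (simp add: vbound_def)

lemma gain_pos: "0 < a \<Longrightarrow> 0 < b \<Longrightarrow> 0 < gain a b"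
proof -
  assume ab: "0 < a" "0 < b"
  have "0 < mass_bound (vbound b / a) (1 / (1 + 16 * rtail 0 * a)) k" for k
    using vbound_pos[OF ab(2)] ab rtail_pos[of 0]
    by (intro mass_bound_pos) (auto intro!: divide_pos_pos add_pos_pos mult_pos_pos)
  then have "0 < (\<Sum>k<Suc (nat \<lceil>2 * (16 * rtail 0 * vbound b)\<rceil>).
     mass_bound (vbound b / a) (1 / (1 + 16 * rtail 0 * a)) k)" by (intro sum_pos) auto
  then show ?thesis by (simp add: gain_def)
qed

definition nbrs :: "'v set \<Rightarrow> 'v set" where "nbrs K = tail G ` touch K \<union> head G ` touch K"

text \<open>Only edges touching \<open>K\<close> may be used, so for finite \<open>K\<close> the
  event depends on finitely many edges and survives the weak limit.\<close>

definition far :: "'e \<Rightarrow> 'v set \<Rightarrow> 'e set \<Rightarrow> 'v \<Rightarrow> bool" where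
  "far e K T x \<longleftrightarrow> (\<exists>v. v \<notin> K \<and> ends_conn G (T \<inter> touch K - {e}) x v)"

definition two_sided :: "'e \<Rightarrow> 'v set \<Rightarrow> 'e set \<Rightarrow> bool" where
  "two_sided e K T \<longleftrightarrow> e \<in> T \<and> far e K T (tail G e) \<and> far e K T (head G e)"

end

section \<open>Gain at a single stage\<close>

context cut_stage
begin

lemma nbrs_V0: "nbrs K \<subseteq> V0" using touch_V0 by (auto simp: nbrs_def)

lemma col_V0: "v \<in> V0 \<Longrightarrow> col v = Some v" by (simp add: collapse_def)

lemma cluster_nbrs:
  assumes Q: "Q \<subseteq> R" and x: "x \<in> nbrs K"
  shows "cluster Q x \<subseteq> nbrs K" and "\<not> conn Q (col x) None"
proof -
  have in_nbrs: "tail G f \<in> nbrs K" "head G f \<in> nbrs K" if "f \<in> Q" for f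
    using that Q by (auto simp: R_def nbrs_def)
  have const: "(col x \<in> Some ` nbrs K) = (w \<in> Some ` nbrs K)" if "conn Q (col x) w" for w
    using that
  proof (rule econn_const)
    fix f assume "f \<in> Q"
    then show "(tail \<Gamma> f \<in> Some ` nbrs K) = (head \<Gamma> f \<in> Some ` nbrs K)"
      using in_nbrs[of f] nbrs_V0 col_V0 by auto
  qed
  have xin: "col x \<in> Some ` nbrs K" using x nbrs_V0 col_V0 by auto
  show "\<not> conn Q (col x) None" using const[of None] xin by auto
  show "cluster Q x \<subseteq> nbrs K"
  proof
    fix v assume "v \<in> cluster Q x"
    then have "v \<in> V0" "conn Q (col x) (col v)" by (auto simp: cluster_def)
    then show "v \<in> nbrs K" using const xin col_V0 by auto
  qed
qed

definition good :: "real \<Rightarrow> 'b set \<Rightarrow> bool" where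
  "good \<epsilon> Q \<longleftrightarrow> Q \<subseteq> R \<and> 0 < W (\<lambda>T. T \<inter> R = Q) \<and> \<epsilon> * W (\<lambda>T. T \<inter> R = Q) \<le> W (\<lambda>T. T \<inter> R = Q \<and> e \<in> T) \<and>
     cluster Q (tail G e) \<noteq> {} \<and> cluster Q (head G e) \<noteq> {}"

lemma ends_nbrs: "tail G e \<in> nbrs K" "head G e \<in> nbrs K"
  using eK by (auto simp: nbrs_def)

text \<open>Collects the inputs of \<open>variance_lower_bound\<close> for the count
  \<open>card (T \<inter> S)\<close>: \<open>degree_exchange\<close> gives the step and the value at
  0, \<open>edge_probability_le\<close> the mean, \<open>not_edge_probability_ge\<close> the
  distance of \<open>q\<close> from 1.\<close>

lemma degree_gain:
  assumes good: "good \<epsilon> Q" and \<epsilon>: "0 < \<epsilon>"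
  obtains S where "S \<subseteq> E - {e}" "S \<subseteq> touch (nbrs K)"
    "energy e R Q + gain (c e) (c e / \<epsilon>) * W (\<lambda>T. T \<inter> R = Q) \<le>
      (\<Sum>k\<le>card E. (W (\<lambda>T. T \<inter> R = Q \<and> e \<in> T \<and> card (T \<inter> S) = k))\<^sup>2 / W (\<lambda>T. T \<inter> R = Q \<and> card (T \<inter> S) = k))"
proof -
  have Q: "Q \<subseteq> R" and m: "0 < W (\<lambda>T. T \<inter> R = Q)"
    and \<epsilon>m: "\<epsilon> * W (\<lambda>T. T \<inter> R = Q) \<le> W (\<lambda>T. T \<inter> R = Q \<and> e \<in> T)"
    and ne: "cluster Q (tail G e) \<noteq> {}" "cluster Q (head G e) \<noteq> {}"
    using good by (auto simp: good_def)
  define b where "b = c e / \<epsilon>"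
  have ce: "0 < c e" using eE c_pos by blast
  then have b: "0 < b" using \<epsilon> by (simp add: b_def)
  define t where "t = vbound b"
  have tpos: "0 < t" using vbound_pos[OF b] by (simp add: t_def)
  have "min (vol G c (cluster Q (tail G e))) (vol G c (cluster Q (head G e))) \<le> t"
    unfolding t_def vbound_def b_def
    by (rule cluster_volume_le[OF Q \<epsilon> \<epsilon>m m]) (use drop_index[of "c e / \<epsilon>"] in auto)
  then obtain x where x: "x = tail G e \<or> x = head G e" and vx: "vol G c (cluster Q x) \<le> t"
    by (auto simp: min_le_iff_disj)
  have xn: "x \<in> nbrs K" using x ends_nbrs by auto
  define X where "X = {w. conn Q (col x) w}"
  define S where "S = {f\<in>E - R - {e}. tail \<Gamma> f \<in> X \<or> head \<Gamma> f \<in> X}"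
  have finS: "finite S" using finite_E by (simp add: S_def)
  have S_touch: "S \<subseteq> touch (cluster Q x)"
  proof
    fix f assume f: "f \<in> S"
    then have fG: "f \<in> arcs G" "f \<notin> touch K" by (auto simp: S_def R_def E_iff)
    have "v \<in> cluster Q x" if "v \<in> {tail G f, head G f}" "col v \<in> X" for v
    proof -
      have "v \<notin> K" using fG that(1) by (auto simp: touch_def)
      moreover have "col v \<noteq> None" using that(2) cluster_nbrs(2)[OF Q xn] unfolding X_def mem_Collect_eq by metis
      then have "v \<in> V0" by (auto simp: collapse_def split: if_splits)
      ultimately show ?thesis using that(2) by (simp add: cluster_def X_def)
    qed
    then show "f \<in> touch (cluster Q x)" using f fG(1) by (auto simp: S_def touch_def)
  qed
  have fincl: "finite (cluster Q x)" using V0 by (simp add: cluster_def)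
  have cS: "(\<Sum>f\<in>S. c f) \<le> t" using sum_touch_le_vol[OF fincl S_touch] vx by linarith
  have hit: "0 < W (\<lambda>T. T \<inter> R = Q \<and> e \<in> T)" using \<epsilon>m mult_pos_pos[OF \<epsilon> m] by linarith
  then have "{T\<in>ST. T \<inter> R = Q \<and> e \<in> T} \<noteq> {}" unfolding W_def by (metis less_irrefl sum.empty)
  then obtain T0 where T0: "T0 \<in> ST" "T0 \<inter> R = Q" "e \<in> T0" by blast
  have nQ: "\<not> conn Q (tail \<Gamma> e) (head \<Gamma> e)"
  proof
    assume "conn Q (tail \<Gamma> e) (head \<Gamma> e)"
    then have "conn (T0 - {e}) (tail \<Gamma> e) (head \<Gamma> e)" by (rule econn_mono) (use T0 eR in auto)
    then show False using ST_sep T0 by blast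
  qed
  have sep: "(tail \<Gamma> e \<in> X) \<noteq> (head \<Gamma> e \<in> X)"
    using x nQ econn_commute[of "tail \<Gamma>" "head \<Gamma>" Q] by (auto simp: X_def)
  have XQ: "tail \<Gamma> f \<in> X \<longleftrightarrow> head \<Gamma> f \<in> X" if "f \<in> Q" for f
    unfolding X_def mem_Collect_eq by (rule econn_cong_right[OF econn_edge[OF that]])
  have Ssub: "S \<subseteq> E - R - {e}" by (auto simp: S_def)
  have Sin: "f \<in> S" if "f \<in> E - R - {e}" "(tail \<Gamma> f \<in> X) \<noteq> (head \<Gamma> f \<in> X)" for f
    using that by (auto simp: S_def)
  note dx = degree_exchange[OF eE eR XQ sep Ssub Sin]
  define M where "M = W (\<lambda>T. T \<inter> R = Q)"
  define p where "p k = W (\<lambda>T. T \<inter> R = Q \<and> card (T \<inter> S) = k) / M" for k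
  define y where "y k = W (\<lambda>T. T \<inter> R = Q \<and> e \<in> T \<and> card (T \<inter> S) = k) / M" for k
  have M: "0 < M" using m by (simp add: M_def)
  have cardS: "card S \<le> card E" using Ssub finite_E by (intro card_mono) auto
  have card_le: "card (T \<inter> S) \<in> {..card E}" for T
    using cardS card_mono[OF finS, of "T \<inter> S"] by auto
  have sum_p: "(\<Sum>k\<le>card E. p k) = 1"
    using W_partition[of "{..card E}" "\<lambda>T. T \<inter> R = Q" "\<lambda>T. card (T \<inter> S)"] card_le M
    by (simp add: p_def M_def sum_divide_distrib[symmetric])
  have sum_y: "W (\<lambda>T. T \<inter> R = Q \<and> e \<in> T) / M = (\<Sum>k\<le>card E. y k)"
    using W_partition[of "{..card E}" "\<lambda>T. T \<inter> R = Q \<and> e \<in> T" "\<lambda>T. card (T \<inter> S)"] card_le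
    by (simp add: y_def sum_divide_distrib[symmetric] conj_assoc)
  have py: "p k - y k = W (\<lambda>T. T \<inter> R = Q \<and> e \<notin> T \<and> card (T \<inter> S) = k) / M" for k
  proof -
    have "W (\<lambda>T. T \<inter> R = Q \<and> card (T \<inter> S) = k) = W (\<lambda>T. T \<inter> R = Q \<and> e \<in> T \<and> card (T \<inter> S) = k)
        + W (\<lambda>T. T \<inter> R = Q \<and> e \<notin> T \<and> card (T \<inter> S) = k)"
      using W_split[of "\<lambda>T. T \<inter> R = Q \<and> card (T \<inter> S) = k" "\<lambda>T. e \<in> T"]
      by (simp add: conj_assoc conj_commute conj_left_commute)
    then show ?thesis by (simp add: p_def y_def diff_divide_distrib[symmetric])
  qed
  have step: "p (Suc k) - y (Suc k) \<le> t / c e * y k" for k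
  proof -
    have "c e * W (\<lambda>T. T \<inter> R = Q \<and> e \<notin> T \<and> card (T \<inter> S) = Suc k) \<le>
        (\<Sum>f\<in>S. c f) * W (\<lambda>T. T \<inter> R = Q \<and> e \<in> T \<and> card (T \<inter> S) = k)" by (rule dx(2))
    also have "\<dots> \<le> t * W (\<lambda>T. T \<inter> R = Q \<and> e \<in> T \<and> card (T \<inter> S) = k)"
      by (rule mult_right_mono[OF cS W_nonneg])
    finally show ?thesis unfolding py unfolding y_def using ce M by (simp add: field_simps)
  qed
  have "W (\<lambda>T. T \<inter> R = Q \<and> e \<notin> T \<and> card (T \<inter> S) = 0) = 0" by (rule dx(1))
  then have "p 0 - y 0 = 0" unfolding py[of 0] by (simp only: div_0)
  then have zero: "y 0 = p 0" by simp
  have r0: "0 < rtail 0" by (rule rtail_pos)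
  define \<eta> where "\<eta> = 1 / (1 + 16 * rtail 0 * c e)"
  have den: "0 < 1 + 16 * rtail 0 * c e" using r0 ce by (simp add: add_pos_pos)
  have \<eta>: "0 < \<eta>" using den by (simp add: \<eta>_def)
  have q\<eta>: "W (\<lambda>T. T \<inter> R = Q \<and> e \<in> T) / M \<le> 1 - \<eta>"
  proof -
    define Z where "Z = W (\<lambda>T. T \<inter> R = Q \<and> e \<in> T)"
    define Z0 where "Z0 = W (\<lambda>T. T \<inter> R = Q \<and> e \<notin> T)"
    have "Z \<le> 16 * rtail 0 * c e * Z0" unfolding Z_def Z0_def by (rule not_edge_probability_ge[OF Q ne])
    moreover have MZ: "M = Z + Z0" unfolding M_def Z_def Z0_def by (rule W_split)
    ultimately have "Z * (1 + 16 * rtail 0 * c e) \<le> 16 * rtail 0 * c e * M" by (simp add: algebra_simps)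
    then have "Z \<le> (16 * rtail 0 * c e / (1 + 16 * rtail 0 * c e)) * M" using den by (simp add: field_simps)
    also have "16 * rtail 0 * c e / (1 + 16 * rtail 0 * c e) = 1 - \<eta>" using den by (simp add: \<eta>_def field_simps)
    finally show ?thesis using M by (simp add: Z_def[symmetric] field_simps)
  qed
  have mean: "(\<Sum>k\<le>card E. real k * p k) \<le> 16 * rtail 0 * t"
  proof -
    have "(\<Sum>k\<le>card E. real k * p k) * M = (\<Sum>f\<in>S. W (\<lambda>T. T \<inter> R = Q \<and> f \<in> T))"
      using W_mean[OF finS cardS, of "\<lambda>T. T \<inter> R = Q"] M by (simp add: p_def sum_distrib_right)
    also have "\<dots> \<le> (\<Sum>f\<in>S. 16 * rtail 0 * c f * M)"
      unfolding M_def by (rule sum_mono, rule edge_probability_le[OF Q]) (auto simp: S_def R_def)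
    also have "\<dots> = 16 * rtail 0 * (\<Sum>f\<in>S. c f) * M" by (simp add: sum_distrib_left sum_distrib_right mult_ac)
    also have "\<dots> \<le> 16 * rtail 0 * t * M" using cS r0 M by (intro mult_right_mono mult_left_mono) auto
    finally show ?thesis using M by simp
  qed
  have "1 / (2 * (\<Sum>k<Suc (nat \<lceil>2 * (16 * rtail 0 * t)\<rceil>). mass_bound (t / c e) \<eta> k))\<^sup>2 \<le>
      (\<Sum>k\<le>card E. (y k)\<^sup>2 / p k) - (W (\<lambda>T. T \<inter> R = Q \<and> e \<in> T) / M)\<^sup>2"
  proof (rule variance_lower_bound[OF _ _ sum_p zero step sum_y q\<eta> \<eta> _ mean])
    show "0 \<le> y k" "y k \<le> p k" for k
      unfolding y_def p_def using M by (auto intro!: divide_nonneg_pos divide_right_mono W_nonneg W_mono)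
    show "0 \<le> t / c e" using tpos ce by simp
    show "2 * (16 * rtail 0 * t) \<le> real (Suc (nat \<lceil>2 * (16 * rtail 0 * t)\<rceil>))"
      by (simp add: le_nat_iff) linarith
  qed simp
  then have "gain (c e) b \<le> (\<Sum>k\<le>card E. (y k)\<^sup>2 / p k) - (W (\<lambda>T. T \<inter> R = Q \<and> e \<in> T) / M)\<^sup>2"
    by (simp only: gain_def t_def \<eta>_def)
  then have "gain (c e) b * M \<le> ((\<Sum>k\<le>card E. (y k)\<^sup>2 / p k) - (W (\<lambda>T. T \<inter> R = Q \<and> e \<in> T) / M)\<^sup>2) * M"
    using M by (intro mult_right_mono) auto
  also have "\<dots> = (\<Sum>k\<le>card E. (y k)\<^sup>2 / p k * M) - energy e R Q"
    using M by (simp add: energy_def M_def[symmetric] left_diff_distrib sum_distrib_right power2_eq_square)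
  also have "(\<Sum>k\<le>card E. (y k)\<^sup>2 / p k * M) =
      (\<Sum>k\<le>card E. (W (\<lambda>T. T \<inter> R = Q \<and> e \<in> T \<and> card (T \<inter> S) = k))\<^sup>2 / W (\<lambda>T. T \<inter> R = Q \<and> card (T \<inter> S) = k))"
    using M by (intro sum.cong) (auto simp: y_def p_def power2_eq_square)
  finally have "energy e R Q + gain (c e) (c e / \<epsilon>) * W (\<lambda>T. T \<inter> R = Q) \<le>
      (\<Sum>k\<le>card E. (W (\<lambda>T. T \<inter> R = Q \<and> e \<in> T \<and> card (T \<inter> S) = k))\<^sup>2 / W (\<lambda>T. T \<inter> R = Q \<and> card (T \<inter> S) = k))"
    unfolding M_def b_def by linarith
  moreover have "S \<subseteq> touch (nbrs K)"
    using S_touch cluster_nbrs(1)[OF Q xn] by (auto simp: touch_def)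
  ultimately show ?thesis using that[of S] Ssub by blast
qed

text \<open>\<open>K'\<close> contains the neighbours of \<open>K\<close> so that the edges counted
  in \<open>degree_gain\<close>, which touch \<open>nbrs K\<close>, are all revealed at the next
  stage.\<close>

lemma stage_gain:
  assumes K': "nbrs K \<subseteq> K'" "K \<subseteq> K'" and \<epsilon>: "0 < \<epsilon>" and R': "R' = touch K' \<inter> E - {e}"
  shows "(\<Sum>Q\<in>Pow R. energy e R Q) + gain (c e) (c e / \<epsilon>) * (\<Sum>Q | good \<epsilon> Q. W (\<lambda>T. T \<inter> R = Q)) \<le>
    (\<Sum>Q\<in>Pow R'. energy e R' Q)"
proof -
  have RR: "R \<subseteq> R'" using K' by (auto simp: R_def R' touch_def)
  have finR': "finite R'" using finite_E by (simp add: R')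
  have one: "energy e R Q + (if good \<epsilon> Q then gain (c e) (c e / \<epsilon>) * W (\<lambda>T. T \<inter> R = Q) else 0)
      \<le> (\<Sum>Q' | Q' \<subseteq> R' \<and> Q' \<inter> R = Q. energy e R' Q')" for Q
  proof (cases "good \<epsilon> Q")
    case True
    obtain S where S: "S \<subseteq> E - {e}" "S \<subseteq> touch (nbrs K)"
      "energy e R Q + gain (c e) (c e / \<epsilon>) * W (\<lambda>T. T \<inter> R = Q) \<le>
      (\<Sum>k\<le>card E. (W (\<lambda>T. T \<inter> R = Q \<and> e \<in> T \<and> card (T \<inter> S) = k))\<^sup>2 / W (\<lambda>T. T \<inter> R = Q \<and> card (T \<inter> S) = k))"
      using degree_gain[OF True \<epsilon>] by blast
    have "S \<subseteq> R'" using S(1,2) K' by (auto simp: R' touch_def)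
    moreover have "card S \<le> card E" using S(1) finite_E by (intro card_mono) auto
    ultimately show ?thesis using energy_refine[OF finR' RR, of S "card E" Q e] S(3) True by simp
  next
    case False
    then show ?thesis using energy_refine_simple[OF finR' RR] by simp
  qed
  have "(\<Sum>Q\<in>Pow R. energy e R Q) + gain (c e) (c e / \<epsilon>) * (\<Sum>Q | good \<epsilon> Q. W (\<lambda>T. T \<inter> R = Q)) =
      (\<Sum>Q\<in>Pow R. energy e R Q + (if good \<epsilon> Q then gain (c e) (c e / \<epsilon>) * W (\<lambda>T. T \<inter> R = Q) else 0))"
  proof -
    have "{Q\<in>Pow R. good \<epsilon> Q} = {Q. good \<epsilon> Q}" by (auto simp: good_def)
    then show ?thesis using sum.inter_filter[of "Pow R" "\<lambda>Q. gain (c e) (c e / \<epsilon>) * W (\<lambda>T. T \<inter> R = Q)" "good \<epsilon>"] finite_R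
      by (simp add: sum.distrib sum_distrib_left)
  qed
  also have "\<dots> \<le> (\<Sum>Q\<in>Pow R. \<Sum>Q' | Q' \<in> Pow R' \<and> Q' \<inter> R = Q. energy e R' Q')"
    by (rule sum_mono) (use one in simp)
  also have "\<dots> = (\<Sum>Q'\<in>Pow R'. energy e R' Q')"
    by (rule sum.group) (use finR' finite_R in auto)
  finally show ?thesis .
qed

lemma two_sided_cluster:
  assumes T: "T \<in> ST" "T \<inter> R = Q" and f: "far e K T x" and x: "x \<in> V0"
  shows "cluster Q x \<noteq> {}"
proof -
  have TQ: "T \<inter> touch K - {e} = Q" using T ST_sub by (auto simp: R_def)
  obtain v where v: "v \<notin> K" "ends_conn G Q x v" using f unfolding far_def TQ by blast
  have "(x \<in> V0) = (v \<in> V0)"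
  proof (rule econn_const[OF v(2)])
    fix f assume "f \<in> Q"
    then have "f \<in> touch K" using T(2) by (auto simp: R_def)
    then show "(tail G f \<in> V0) = (head G f \<in> V0)" using touch_V0 by blast
  qed
  moreover have "conn Q (col x) (col v)"
    by (rule econn_image[OF v(2)]) (metis econn_edge tail_wired head_wired)
  ultimately have "v \<in> cluster Q x" using v(1) x by (simp add: cluster_def)
  then show ?thesis by blast
qed

text \<open>A two-sided tree has both clusters nonempty (\<open>two_sided_cluster\<close>). So if
  its pattern \<open>Q\<close> is not good, \<open>e\<close> has conditional probability below
  \<open>\<epsilon>\<close> there; all such patterns together contribute at most
  \<open>\<epsilon>\<close>.\<close>

lemma two_sided_le:
  assumes \<epsilon>: "0 < \<epsilon>"
  shows "W (two_sided e K) \<le> \<epsilon> * W (\<lambda>T. True) + (\<Sum>Q | good \<epsilon> Q. W (\<lambda>T. T \<inter> R = Q))"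
proof -
  have ends: "tail G e \<in> V0" "head G e \<in> V0" using touch_V0[OF eK] by auto
  have one: "W (\<lambda>T. two_sided e K T \<and> T \<inter> R = Q) \<le> \<epsilon> * W (\<lambda>T. True \<and> T \<inter> R = Q) +
      (if good \<epsilon> Q then W (\<lambda>T. T \<inter> R = Q) else 0)" if Q: "Q \<subseteq> R" for Q
  proof -
    have m: "0 \<le> W (\<lambda>T. T \<inter> R = Q)" by (rule W_nonneg)
    have le: "W (\<lambda>T. two_sided e K T \<and> T \<inter> R = Q) \<le> W (\<lambda>T. T \<inter> R = Q \<and> e \<in> T)"
      by (rule W_mono) (auto simp: two_sided_def)
    have le': "W (\<lambda>T. two_sided e K T \<and> T \<inter> R = Q) \<le> W (\<lambda>T. T \<inter> R = Q)"
      by (rule W_mono) auto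
    show ?thesis
    proof (cases "good \<epsilon> Q")
      case True
      then show ?thesis using le' m \<epsilon> by (simp add: add_increasing)
    next
      case False
      have "W (\<lambda>T. two_sided e K T \<and> T \<inter> R = Q) \<le> \<epsilon> * W (\<lambda>T. T \<inter> R = Q)"
      proof (cases "cluster Q (tail G e) \<noteq> {} \<and> cluster Q (head G e) \<noteq> {}")
        case True
        then consider "W (\<lambda>T. T \<inter> R = Q) = 0" | "W (\<lambda>T. T \<inter> R = Q \<and> e \<in> T) < \<epsilon> * W (\<lambda>T. T \<inter> R = Q)"
          using False Q m by (force simp: good_def)
        then show ?thesis using le le' by cases auto
      next
        case False
        have "W (\<lambda>T. two_sided e K T \<and> T \<inter> R = Q) = W (\<lambda>T. False)"
          by (rule W_cong) (use False two_sided_cluster ends in \<open>auto simp: two_sided_def\<close>)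
        also have "\<dots> = 0" by (simp add: W_def)
        finally show ?thesis using m \<epsilon> by simp
      qed
      then show ?thesis using False by simp
    qed
  qed
  have "W (two_sided e K) = (\<Sum>Q\<in>Pow R. W (\<lambda>T. two_sided e K T \<and> T \<inter> R = Q))"
    by (rule W_partition) (use finite_R in auto)
  also have "\<dots> \<le> (\<Sum>Q\<in>Pow R. \<epsilon> * W (\<lambda>T. True \<and> T \<inter> R = Q) + (if good \<epsilon> Q then W (\<lambda>T. T \<inter> R = Q) else 0))"
    by (rule sum_mono) (use one in auto)
  also have "\<dots> = \<epsilon> * W (\<lambda>T. True) + (\<Sum>Q | good \<epsilon> Q. W (\<lambda>T. T \<inter> R = Q))"
  proof -
    have "{Q\<in>Pow R. good \<epsilon> Q} = {Q. good \<epsilon> Q}" by (auto simp: good_def)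
    then show ?thesis
      using sum.inter_filter[of "Pow R" "\<lambda>Q. W (\<lambda>T. T \<inter> R = Q)" "good \<epsilon>"] finite_R
        W_partition[of "Pow R" "\<lambda>T. True" "\<lambda>T. T \<inter> R"]
      by (simp add: sum.distrib sum_distrib_left)
  qed
  finally show ?thesis .
qed

end

section \<open>Summing the gains over nested cuts\<close>

context isoperimetric_net
begin

text \<open>If the component of \<open>x\<close> under the edges touching \<open>K\<close> stayed
  inside \<open>K\<close>, no further edge would meet it, so \<open>x\<close> could not get out of
  \<open>K'\<close> either.\<close>

lemma far_mono:
  assumes "K \<subseteq> K'" "x \<in> K" "far e K' T x"
  shows "far e K T x"
proof (rule ccontr)
  assume nf: "\<not> far e K T x"
  define Y where "Y = {v. ends_conn G (T \<inter> touch K - {e}) x v}"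
  have YK: "Y \<subseteq> K" using nf by (auto simp: far_def Y_def)
  obtain v where v: "v \<notin> K'" "ends_conn G (T \<inter> touch K' - {e}) x v" using assms(3) by (auto simp: far_def)
  have "(x \<in> Y) = (v \<in> Y)"
  proof (rule econn_const[OF v(2)])
    fix f assume f: "f \<in> T \<inter> touch K' - {e}"
    show "(tail G f \<in> Y) = (head G f \<in> Y)"
    proof (cases "f \<in> touch K")
      case True
      then have "f \<in> T \<inter> touch K - {e}" using f by auto
      then show ?thesis unfolding Y_def mem_Collect_eq by (intro econn_cong_right econn_edge)
    next
      case False
      then show ?thesis using YK f by (auto simp: touch_def)
    qed
  qed
  then show False using v(1) YK assms(1) by (auto simp: Y_def)
qed

abbreviation wired_W :: "'v set \<Rightarrow> ('e set \<Rightarrow> bool) \<Rightarrow> real" where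
  "wired_W V0 \<equiv> fin_net.W (tail (wired G V0)) (head (wired G V0)) (verts (wired G V0)) (arcs (wired G V0)) c"

text \<open>By \<open>far_mono\<close> the last event lies in the event of every earlier stage. So
  each of the \<open>N\<close> stages raises the total energy by at least the gain times
  \<open>w - \<epsilon> * Z\<close>, while the energy never exceeds \<open>Z\<close>.\<close>

lemma two_sided_bound:
  assumes K: "\<And>n. nearmin (K n)" "\<And>n. K n \<subseteq> K (Suc n)" "\<And>n. nbrs (K n) \<subseteq> K (Suc n)"
    and e: "tail G e \<in> K 0" "head G e \<in> K 0"
    and VV: "finite V0" "V0 \<subseteq> verts G" "\<And>f. f \<in> touch (K N) \<Longrightarrow> tail G f \<in> V0 \<and> head G f \<in> V0"
    and eE: "e \<in> arcs (wired G V0)" and \<epsilon>: "0 < \<epsilon>"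
  shows "real N * wired_W V0 (two_sided e (K N)) \<le>
    (real N * \<epsilon> + 1 / gain (c e) (c e / \<epsilon>)) * wired_W V0 (\<lambda>T. True)"
proof -
  interpret wired_net G c \<kappa> s0 \<sigma> V0 by unfold_locales (use VV in auto)
  have eG: "e \<in> arcs G" using eE by (simp add: E_iff)
  have Kmono: "K m \<subseteq> K n" if "m \<le> n" for m n using K(2) that by (rule lift_Suc_mono_le)
  have st: "cut_stage G c \<kappa> s0 \<sigma> V0 (K n) e" if n: "n \<le> N" for n
  proof unfold_locales
    show "nearmin (K n)" by (rule K(1))
    show "tail G f \<in> V0 \<and> head G f \<in> V0" if "f \<in> touch (K n)" for f
      using that VV(3) Kmono[OF n] by (auto simp: touch_def)
    show "e \<in> E" by (rule eE)
    show "e \<in> touch (K n)" using eG e Kmono[of 0 n] by (auto simp: touch_def)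
  qed
  define RR where "RR n = touch (K n) \<inter> E - {e}" for n
  define \<Psi> where "\<Psi> n = (\<Sum>Q\<in>Pow (RR n). energy e (RR n) Q)" for n
  define Z where "Z = W (\<lambda>T. True)"
  define w where "w = W (two_sided e (K N))"
  let ?g = "gain (c e) (c e / \<epsilon>)"
  have ce: "0 < c e" using eE c_pos by blast
  have g: "0 < ?g" using ce \<epsilon> by (intro gain_pos) auto
  have step: "\<Psi> n + ?g * (w - \<epsilon> * Z) \<le> \<Psi> (Suc n)" if n: "n < N" for n
  proof -
    interpret S: cut_stage G c \<kappa> s0 \<sigma> V0 "K n" e by (rule st) (use n in simp)
    have "w \<le> W (two_sided e (K n))"
      unfolding w_def two_sided_def
      using far_mono[OF Kmono[of n N]] e Kmono[of 0 n] n by (intro W_mono) auto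
    also have "\<dots> \<le> \<epsilon> * Z + (\<Sum>Q | S.good \<epsilon> Q. W (\<lambda>T. T \<inter> S.R = Q))"
      unfolding Z_def by (rule S.two_sided_le[OF \<epsilon>])
    finally have "?g * (w - \<epsilon> * Z) \<le> ?g * (\<Sum>Q | S.good \<epsilon> Q. W (\<lambda>T. T \<inter> S.R = Q))"
      using g by (intro mult_left_mono) auto
    moreover have "\<Psi> n + ?g * (\<Sum>Q | S.good \<epsilon> Q. W (\<lambda>T. T \<inter> S.R = Q)) \<le> \<Psi> (Suc n)"
      using S.stage_gain[OF K(3,2) \<epsilon> refl] by (simp add: \<Psi>_def RR_def S.R_def)
    ultimately show ?thesis by linarith
  qed
  have "real n * (?g * (w - \<epsilon> * Z)) \<le> \<Psi> n" if "n \<le> N" for n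
    using that
  proof (induction n)
    case 0
    show ?case unfolding \<Psi>_def energy_def by (auto intro!: sum_nonneg divide_nonneg_nonneg W_nonneg)
  next
    case (Suc n)
    then show ?case using step[of n] by (simp add: algebra_simps)
  qed
  from this[of N] have "real N * (?g * (w - \<epsilon> * Z)) \<le> \<Psi> N" by simp
  also have "\<dots> \<le> Z" unfolding \<Psi>_def Z_def by (rule total_energy_le) (use finite_E in \<open>simp add: RR_def\<close>)
  finally have "real N * (w - \<epsilon> * Z) \<le> Z / ?g" using g by (simp add: field_simps)
  then have "real N * w \<le> (real N * \<epsilon> + 1 / ?g) * Z" by (simp add: algebra_simps)
  then show ?thesis unfolding w_def Z_def by (simp add: W_def)
qed

end

subsection \<open>Uniform spanning trees and their weak limit\<close>

lemma econn_simple_path: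
  assumes "econn src tgt T x y"
  obtains vs es where "length vs = Suc (length es)" "distinct vs" "set es \<subseteq> T" "vs ! 0 = x" "vs ! length es = y"
    "\<And>i. i < length es \<Longrightarrow> src (es ! i) = vs ! i \<and> tgt (es ! i) = vs ! Suc i \<or> src (es ! i) = vs ! Suc i \<and> tgt (es ! i) = vs ! i"
proof -
  have "\<exists>vs es. length vs = Suc (length es) \<and> distinct vs \<and> set es \<subseteq> T \<and> vs ! 0 = x \<and> vs ! length es = y \<and>
    (\<forall>i < length es. src (es ! i) = vs ! i \<and> tgt (es ! i) = vs ! Suc i \<or> src (es ! i) = vs ! Suc i \<and> tgt (es ! i) = vs ! i)"
    using assms
  proof (induction rule: econn_induct)
    case refl
    show ?case by (rule exI[of _ "[x]"], rule exI[of _ "[]"]) simp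
  next
    case (step u v f)
    then obtain vs es where p: "length vs = Suc (length es)" "distinct vs" "set es \<subseteq> T" "vs ! 0 = x" "vs ! length es = u"
      "\<forall>i < length es. src (es ! i) = vs ! i \<and> tgt (es ! i) = vs ! Suc i \<or> src (es ! i) = vs ! Suc i \<and> tgt (es ! i) = vs ! i"
      by blast
    show ?case
    proof (cases "v \<in> set vs")
      case True
      then obtain k where k: "k < length vs" "vs ! k = v" by (auto simp: in_set_conv_nth)
      have "set (take k es) \<subseteq> T" using p(3) set_take_subset by fast
      then show ?thesis using p k
        by (intro exI[of _ "take (Suc k) vs"] exI[of _ "take k es"]) auto
    next
      case False
      then show ?thesis using p step.hyps(2,3)
        by (intro exI[of _ "vs @ [v]"] exI[of _ "es @ [f]"]) (auto simp: nth_append less_Suc_eq)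
    qed
  qed
  then show ?thesis using that by blast
qed

text \<open>One direction walks around the cycle avoiding its first edge, the other closes a simple
  path between the ends of \<open>f\<close> by \<open>f\<close>. A loop is a cycle of length one and
  matches reflexivity of \<open>ends_conn\<close>.\<close>

lemma has_cycle_iff:
  assumes T: "T \<subseteq> arcs H"
  shows "has_cycle (H\<lparr>arcs := T\<rparr>) \<longleftrightarrow> (\<exists>f\<in>T. ends_conn H (T - {f}) (tail H f) (head H f))"
proof
  assume "has_cycle (H\<lparr>arcs := T\<rparr>)"
  then obtain vs es where c: "es \<noteq> []" "length vs = length es" "distinct es"
    "\<And>i. i < length es \<Longrightarrow> joins (H\<lparr>arcs := T\<rparr>) (es ! i) (vs ! i) (vs ! (Suc i mod length es))"
    unfolding has_cycle_def by blast
  let ?f = "es ! 0" and ?n = "length es"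
  have f: "?f \<in> T" using c(4)[of 0] c(1) by (auto simp: joins_def)
  \<comment> \<open>\<open>1 mod ?n\<close> and not \<open>1\<close>: on a loop the cycle has length
    one and its only vertex has index 0.\<close>
  have "ends_conn H (T - {?f}) (vs ! (1 mod ?n)) (vs ! (Suc i mod ?n))" if "i < ?n" for i
    using that
  proof (induction i)
    case (Suc i)
    have ne: "es ! Suc i \<noteq> ?f" using nth_eq_iff_index_eq[OF c(3), of "Suc i" 0] Suc.prems c(1) by auto
    have j: "joins (H\<lparr>arcs := T\<rparr>) (es ! Suc i) (vs ! (Suc i mod ?n)) (vs ! (Suc (Suc i) mod ?n))"
      using c(4)[OF Suc.prems] Suc.prems by simp
    then have "es ! Suc i \<in> T - {?f}" using ne by (simp add: joins_def)
    then have "ends_conn H (T - {?f}) (tail H (es ! Suc i)) (head H (es ! Suc i))" by (rule econn_edge)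
    then have "ends_conn H (T - {?f}) (vs ! (Suc i mod ?n)) (vs ! (Suc (Suc i) mod ?n))"
      using j by (auto simp: joins_def dest: econn_sym)
    moreover have "ends_conn H (T - {?f}) (vs ! (1 mod ?n)) (vs ! (Suc i mod ?n))" using Suc by simp
    ultimately show ?case by (rule econn_trans[rotated])
  qed simp
  from this[of "?n - 1"] have "ends_conn H (T - {?f}) (vs ! (1 mod ?n)) (vs ! 0)" using c(1) by simp
  then have "ends_conn H (T - {?f}) (tail H ?f) (head H ?f)"
    using c(4)[of 0] c(1) by (auto simp: joins_def dest: econn_sym)
  then show "\<exists>f\<in>T. ends_conn H (T - {f}) (tail H f) (head H f)" using f by blast
next
  assume "\<exists>f\<in>T. ends_conn H (T - {f}) (tail H f) (head H f)"
  then obtain f where f: "f \<in> T" "ends_conn H (T - {f}) (tail H f) (head H f)" by blast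
  obtain vs es where p: "length vs = Suc (length es)" "distinct vs" "set es \<subseteq> T - {f}"
    "vs ! 0 = tail H f" "vs ! length es = head H f"
    "\<And>i. i < length es \<Longrightarrow> tail H (es ! i) = vs ! i \<and> head H (es ! i) = vs ! Suc i \<or>
       tail H (es ! i) = vs ! Suc i \<and> head H (es ! i) = vs ! i"
    using econn_simple_path[OF f(2)] by blast
  have "distinct es"
    unfolding distinct_conv_nth
  proof (intro allI impI)
    fix i j assume ij: "i < length es" "j < length es" "i \<noteq> j"
    have "es ! i \<noteq> es ! j" if "i < j" "j < length es" for i j
    proof
      assume eq: "es ! i = es ! j"
      have "vs ! i = vs ! j \<or> vs ! i = vs ! Suc j" using p(6)[of i] p(6)[of j] that eq by auto
      then show False using that p(1,2) by (auto simp: nth_eq_iff_index_eq)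
    qed
    then show "es ! i \<noteq> es ! j" using ij by (metis linorder_neqE_nat)
  qed
  moreover have "joins (H\<lparr>arcs := T\<rparr>) ((es @ [f]) ! i) (vs ! i) (vs ! (Suc i mod Suc (length es)))"
    if "i < Suc (length es)" for i
  proof (cases "i < length es")
    case True
    then have "es ! i \<in> T" using nth_mem[of i es] p(3) by blast
    then show ?thesis using p(6)[OF True] True by (auto simp: joins_def nth_append)
  next
    case False
    then have "i = length es" using that by simp
    then show ?thesis using f(1) p(4,5) by (auto simp: joins_def nth_append)
  qed
  moreover have "f \<notin> set es" using p(3) by blast
  ultimately have "es @ [f] \<noteq> [] \<and> length vs = length (es @ [f]) \<and> distinct vs \<and> distinct (es @ [f]) \<and>
      (\<forall>i<length (es @ [f]). joins (H\<lparr>arcs := T\<rparr>) ((es @ [f]) ! i) (vs ! i) (vs ! (Suc i mod length (es @ [f]))))"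
    using p(1,2) by simp
  then show "has_cycle (H\<lparr>arcs := T\<rparr>)" unfolding has_cycle_def by blast
qed

context wired_net
begin

lemma col_verts: "v \<in> verts G \<Longrightarrow> col v \<in> verts \<Gamma>" by (simp add: wired_def)

lemma col_None: obtains v where "v \<in> verts G" "col v = None"
proof -
  have "\<not> verts G \<subseteq> V0" using V0(1) inf_G finite_subset[of "verts G" V0] by auto
  then obtain v where "v \<in> verts G" "v \<notin> V0" by blast
  then show ?thesis using that[of v] by (simp add: collapse_def)
qed

lemma spanning_trees_eq: "spanning_trees \<Gamma> = ST"
proof -
  have ne: "verts \<Gamma> \<noteq> {}" using col_None col_verts by (metis empty_iff)
  have "Digraph_Component.connected (\<Gamma>\<lparr>arcs := T\<rparr>) \<longleftrightarrow> (\<forall>x\<in>verts \<Gamma>. \<forall>y\<in>verts \<Gamma>. conn T x y)" if "T \<subseteq> E" for T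
  proof -
    interpret H: wf_digraph "\<Gamma>\<lparr>arcs := T\<rparr>"
      by unfold_locales (use that in \<open>auto simp del: tail_wired head_wired intro: src_V tgt_V\<close>)
    show ?thesis unfolding H.connected_iff_econn using ne by simp
  qed
  then show ?thesis unfolding spanning_trees_def ST_def using has_cycle_iff[of _ \<Gamma>] by blast
qed

lemma conn_E: "x \<in> verts \<Gamma> \<Longrightarrow> y \<in> verts \<Gamma> \<Longrightarrow> conn E x y"
proof -
  assume "x \<in> verts \<Gamma>" "y \<in> verts \<Gamma>"
  then obtain u v where uv: "u \<in> verts G" "v \<in> verts G" "x = col u" "y = col v" by (auto simp: wired_def)
  show "conn E x y" unfolding uv(3,4)
  proof (rule econn_image[OF econn_G[OF uv(1,2)]])
    fix f assume f: "f \<in> arcs G"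
    show "conn E (col (tail G f)) (col (head G f))"
    proof (cases "f \<in> E")
      case True
      then show ?thesis using econn_edge[of f E "tail \<Gamma>" "head \<Gamma>"] by (simp only: tail_wired head_wired)
    next
      case False
      then have "col (tail G f) = col (head G f)" using f by (simp add: E_iff)
      then show ?thesis by (simp only: econn_refl)
    qed
  qed
qed

text \<open>A connected edge set of least cardinality has no edge that could be removed. This makes
  the normalising constant of \<open>ust\<close> positive.\<close>

lemma ST_nonempty: "ST \<noteq> {}"
proof -
  define \<C> where "\<C> = {T. T \<subseteq> E \<and> (\<forall>x\<in>verts \<Gamma>. \<forall>y\<in>verts \<Gamma>. conn T x y)}"
  have "E \<in> \<C>" using conn_E by (simp only: \<C>_def mem_Collect_eq) blast
  then obtain T where T: "T \<in> \<C>" and min: "\<And>T'. T' \<in> \<C> \<Longrightarrow> card T \<le> card T'"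
    using ex_has_least_nat[of "\<lambda>T. T \<in> \<C>" E card] by blast
  have fin: "finite T" using T finite_E finite_subset unfolding \<C>_def by blast
  have TE: "T \<subseteq> E" and Tc: "\<And>x y. x\<in>verts \<Gamma> \<Longrightarrow> y\<in>verts \<Gamma> \<Longrightarrow> conn T x y" using T unfolding \<C>_def by blast+
  have "\<not> conn (T - {f}) (tail \<Gamma> f) (head \<Gamma> f)" if f: "f \<in> T" for f
  proof
    assume cf: "conn (T - {f}) (tail \<Gamma> f) (head \<Gamma> f)"
    have "conn (T - {f}) x y" if "x\<in>verts \<Gamma>" "y\<in>verts \<Gamma>" for x y
    proof (rule econn_image[OF Tc[OF that], where h = "\<lambda>x. x"])
      fix k assume "k \<in> T"
      then show "conn (T - {f}) (tail \<Gamma> k) (head \<Gamma> k)" using cf by (cases "k = f") (auto simp del: tail_wired head_wired intro: econn_edge)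
    qed
    then have "T - {f} \<in> \<C>" using TE unfolding \<C>_def by blast
    then show False using min[of "T - {f}"] card_Diff1_less[OF fin f] by simp
  qed
  then have "T \<in> ST" using TE Tc unfolding ST_def by blast
  then show ?thesis by blast
qed

lemma W_True: "W (\<lambda>T. True) = sum wt ST" by (simp add: W_def)

lemma W_True_pos: "0 < W (\<lambda>T. True)"
  unfolding W_def by (rule sum_pos) (use ST_nonempty wt_pos in auto)

lemma ust_prob: "measure_pmf.prob (ust \<Gamma> c) {T. P T} = W P / W (\<lambda>T. True)"
proof -
  define w where "w T = (if T \<in> ST then wt T / W (\<lambda>T. True) else 0)" for T
  have w: "0 \<le> w T" for T using W_True_pos by (auto simp: w_def intro!: divide_nonneg_pos less_imp_le[OF wt_pos])
  have wt: "wt = prod c" by (simp add: fun_eq_iff wt_def)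
  have ust: "ust \<Gamma> c = embed_pmf w"
    unfolding ust_def spanning_trees_eq w_def W_True wt by simp
  have "(\<integral>\<^sup>+T. ennreal (w T) \<partial>count_space UNIV) = (\<Sum>T\<in>ST. ennreal (w T))"
    by (rule nn_integral_count_space'[of ST]) (auto simp: w_def)
  also have "\<dots> = ennreal (\<Sum>T\<in>ST. w T)" by (rule sum_ennreal) (rule w)
  also have "(\<Sum>T\<in>ST. w T) = 1"
  proof -
    have "(\<Sum>T\<in>ST. w T) = (\<Sum>T\<in>ST. wt T / W (\<lambda>T. True))" by (rule sum.cong) (auto simp: w_def)
    also have "\<dots> = W (\<lambda>T. True) / W (\<lambda>T. True)" by (simp add: sum_divide_distrib[symmetric] W_True)
    finally have "(\<Sum>T\<in>ST. w T) = W (\<lambda>T. True) / W (\<lambda>T. True)" .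
    then show ?thesis using W_True_pos by simp
  qed
  finally have pmf: "pmf (ust \<Gamma> c) T = w T" for T unfolding ust by (intro pmf_embed_pmf) (use w in auto)
  have supp: "set_pmf (ust \<Gamma> c) \<subseteq> ST" by (auto simp: set_pmf_eq pmf w_def split: if_splits)
  have "measure_pmf.prob (ust \<Gamma> c) {T. P T} = measure_pmf.prob (ust \<Gamma> c) {T\<in>ST. P T}"
    by (rule measure_pmf.finite_measure_eq_AE) (use supp in \<open>auto simp: AE_measure_pmf_iff\<close>)
  also have "\<dots> = (\<Sum>T\<in>{T\<in>ST. P T}. w T)" by (subst measure_measure_pmf_finite) (auto simp: pmf)
  also have "\<dots> = W P / W (\<lambda>T. True)" by (simp add: w_def W_def sum_divide_distrib)
  finally show ?thesis .
qed

end

section \<open>Cylinder events under the weak limit\<close>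

definition cylinder :: "'e set \<Rightarrow> 'e set \<Rightarrow> ('e set \<Rightarrow> bool) \<Rightarrow> ('e \<Rightarrow> bool) set" where
  "cylinder A S P = {\<omega>\<in>space (config_space A). P {f\<in>S. \<omega> f}}"

lemma cylinder_alt:
  "cylinder A S P = (\<Union>D\<in>{D\<in>Pow S. P D}. {\<omega>\<in>space (config_space A). \<forall>f\<in>S. \<omega> f = (f \<in> D)})"
proof -
  have "{f\<in>S. \<omega> f} = D" if "D \<subseteq> S" "\<forall>f\<in>S. \<omega> f = (f \<in> D)" for D \<omega> using that by auto
  then have "P {f\<in>S. \<omega> f} \<longleftrightarrow> (\<exists>D\<subseteq>S. P D \<and> (\<forall>f\<in>S. \<omega> f = (f \<in> D)))" for \<omega>
    by (intro iffI exI[of _ "{f\<in>S. \<omega> f}"]) auto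
  then show ?thesis unfolding cylinder_def by auto
qed

lemma space_config: "space (config_space A) = topspace (config_topology A)"
  by (simp add: config_space_def config_topology_def space_PiM)

lemma cylinder_sets:
  assumes "finite S" "S \<subseteq> A"
  shows "cylinder A S P \<in> sets (config_space A)"
  unfolding cylinder_alt
proof (rule sets.finite_UN)
  show "finite {D \<in> Pow S. P D}" using assms by simp
  fix D
  have "(\<lambda>\<omega>. \<omega> f) \<in> measurable (config_space A) (count_space UNIV)" if "f \<in> A" for f
    unfolding config_space_def using that by simp
  then have "(\<lambda>\<omega>. \<omega> f) -` {f \<in> D} \<inter> space (config_space A) \<in> sets (config_space A)" if "f \<in> A" for f
    using that by (intro measurable_sets) auto
  then have "{\<omega>\<in>space (config_space A). \<omega> f = (f \<in> D)} \<in> sets (config_space A)" if "f \<in> A" for f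
    using that by (simp add: vimage_def Int_def conj_commute)
  then show "{\<omega> \<in> space (config_space A). \<forall>f\<in>S. \<omega> f = (f \<in> D)} \<in> sets (config_space A)"
    using assms by (intro sets.sets_Collect_finite_All) auto
qed

lemma cylinder_open:
  assumes "finite S" "S \<subseteq> A"
  shows "openin (config_topology A) (cylinder A S P)"
  unfolding cylinder_alt
proof (rule openin_Union, clarify)
  fix D
  have one: "openin (config_topology A) {\<omega> \<in> topspace (config_topology A). \<omega> f \<in> {f \<in> D}}" if "f \<in> A" for f
    by (rule openin_continuous_map_preimage[where Y = "discrete_topology UNIV"])
      (use that in \<open>auto simp: config_topology_def intro: continuous_map_product_projection\<close>)
  have "{\<omega> \<in> space (config_space A). \<forall>f\<in>S. \<omega> f = (f \<in> D)} =
      topspace (config_topology A) \<inter> (\<Inter>f\<in>S. {\<omega> \<in> topspace (config_topology A). \<omega> f \<in> {f \<in> D}})"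
    unfolding space_config by auto
  also have "openin (config_topology A) \<dots>"
  proof (cases "S = {}")
    case False
    have "openin (config_topology A) (\<Inter>f\<in>S. {\<omega> \<in> topspace (config_topology A). \<omega> f \<in> {f \<in> D}})"
      using assms False one by (intro openin_INT2) auto
    then show ?thesis by (intro openin_Int) auto
  qed simp
  finally show "openin (config_topology A) {\<omega> \<in> space (config_space A). \<forall>f\<in>S. \<omega> f = (f \<in> D)}" .
qed

text \<open>A cylinder over finitely many edges is open and so is its complement; its indicator is
  therefore bounded and continuous, and weak convergence applies to it directly.\<close>

lemma cylinder_limit:
  assumes lim: "weak_limit (config_topology A) (\<lambda>n. config_law A (p n)) P" and sets_P: "sets P = sets (config_space A)"
    and S: "finite S" "S \<subseteq> A"
  shows "(\<lambda>n. measure_pmf.prob (p n) {T. Q (T \<inter> S)}) \<longlonglongrightarrow> measure P (cylinder A S Q)"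
proof -
  let ?C = "cylinder A S Q"
  have C: "?C \<in> sets (config_space A)" by (rule cylinder_sets[OF S])
  have sub: "?C \<subseteq> topspace (config_topology A)" unfolding space_config[symmetric] by (auto simp: cylinder_def)
  have compl: "topspace (config_topology A) - ?C = cylinder A S (\<lambda>D. \<not> Q D)"
    unfolding space_config[symmetric] by (auto simp: cylinder_def)
  have "continuous_map (config_topology A) euclideanreal (indicat_real ?C)"
    unfolding continuous_map_def
  proof (intro conjI allI impI)
    fix U :: "real set" assume "openin euclideanreal U"
    have "{x \<in> topspace (config_topology A). indicator ?C x \<in> U} =
        (if 1 \<in> U then ?C else {}) \<union> (if 0 \<in> U then topspace (config_topology A) - ?C else {})"
      using sub by (auto simp: indicator_def)
    moreover have "openin (config_topology A) ((if 1 \<in> U then ?C else {}) \<union> (if 0 \<in> U then topspace (config_topology A) - ?C else {}))"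
      unfolding compl by (intro openin_Un) (auto intro: cylinder_open[OF S])
    ultimately show "openin (config_topology A) {x \<in> topspace (config_topology A). indicator ?C x \<in> U}" by simp
  qed simp
  moreover have "bounded ((indicator ?C :: _ \<Rightarrow> real) ` topspace (config_topology A))"
    by (rule boundedI[of _ 1]) (auto simp: indicator_def)
  ultimately have "(\<lambda>n. \<integral>x. indicat_real ?C x \<partial>config_law A (p n)) \<longlonglongrightarrow> (\<integral>x. indicat_real ?C x \<partial>P)"
    by (intro lim[unfolded weak_limit_def, THEN spec, THEN mp] conjI)
  moreover have "(\<integral>x. indicat_real ?C x \<partial>P) = measure P ?C"
  proof -
    have "?C \<in> sets P" unfolding sets_P by (rule C)
    then have "?C \<inter> space P = ?C" using sets.sets_into_space by blast
    then show ?thesis by simp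
  qed
  moreover have "(\<integral>x. indicat_real ?C x \<partial>config_law A (p n)) = measure_pmf.prob (p n) {T. Q (T \<inter> S)}" for n
  proof -
    have meas: "(\<lambda>T. \<lambda>e\<in>A. e \<in> T) \<in> measurable (measure_pmf (p n)) (config_space A)"
      by (simp add: config_space_def space_PiM)
    have "(\<integral>x. indicat_real ?C x \<partial>config_law A (p n)) = measure (config_law A (p n)) ?C"
    proof -
      have "?C \<inter> space (config_law A (p n)) = ?C"
        using sets.sets_into_space[OF C] by (simp add: config_law_def Int_absorb2)
      then show ?thesis by simp
    qed
    also have "\<dots> = measure_pmf.prob (p n) ((\<lambda>T. \<lambda>e\<in>A. e \<in> T) -` ?C)"
      unfolding config_law_def by (subst measure_distr[OF meas C]) simp
    also have "(\<lambda>T. \<lambda>e\<in>A. e \<in> T) -` ?C = {T. Q (T \<inter> S)}"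
    proof -
      have "{f \<in> S. (\<lambda>e\<in>A. e \<in> T) f} = T \<inter> S" for T using S(2) by auto
      then show ?thesis by (auto simp: cylinder_def config_space_def space_PiM)
    qed
    finally show ?thesis .
  qed
  ultimately show ?thesis by simp
qed

subsection \<open>Ends of trees\<close>

lemma econn_finite:
  assumes "econn src tgt T x y"
  obtains S where "finite S" "S \<subseteq> T" "econn src tgt S x y"
proof -
  have "\<exists>S. finite S \<and> S \<subseteq> T \<and> econn src tgt S x y"
    using assms
  proof (induction rule: econn_induct)
    case refl
    show ?case by (rule exI[of _ "{}"]) simp
  next
    case (step u v f)
    then obtain S where S: "finite S" "S \<subseteq> T" "econn src tgt S x u" by blast
    have "econn src tgt (insert f S) x u" using S(3) by (rule econn_mono) blast
    moreover have "econn src tgt (insert f S) u v"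
      using econn_edge[of f "insert f S" src tgt] step.hyps(3) by (auto dest: econn_sym)
    ultimately have "econn src tgt (insert f S) x v" by (rule econn_trans)
    then show ?case using S step.hyps(2) by (intro exI[of _ "insert f S"]) simp
  qed
  then show ?thesis using that by blast
qed

text \<open>Koenig's lemma: extend a simple path, keeping infinitely many vertices reachable off the path.\<close>

lemma infinite_ray:
  fixes src tgt :: "'e \<Rightarrow> 'v"
  assumes lf: "\<And>v. finite {f\<in>A. src f = v \<or> tgt f = v}"
    and inf: "infinite {v. econn src tgt A r v}"
  obtains x where "inj x" "\<And>i. \<exists>f\<in>A. src f = x i \<and> tgt f = x (Suc i) \<or> src f = x (Suc i) \<and> tgt f = x i"
proof -
  define reach where "reach S v = {w. econn src tgt {f\<in>A. src f \<notin> S \<and> tgt f \<notin> S} v w}" for S v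
  define nb where "nb u v \<longleftrightarrow> (\<exists>f\<in>A. src f = u \<and> tgt f = v \<or> src f = v \<and> tgt f = u)" for u v
  have step: "\<exists>u. nb v u \<and> u \<notin> insert v S \<and> infinite (reach (insert v S) u)"
    if v: "v \<notin> S" "infinite (reach S v)" for S v
  proof (rule ccontr)
    assume no: "\<not> ?thesis"
    let ?N = "{u. nb v u \<and> u \<notin> insert v S}"
    have "?N \<subseteq> src ` {f\<in>A. src f = v \<or> tgt f = v} \<union> tgt ` {f\<in>A. src f = v \<or> tgt f = v}"
      by (auto simp: nb_def)
    then have finN: "finite ?N" by (rule finite_subset) (simp add: lf)
    have "w \<in> insert v (\<Union>u\<in>?N. reach (insert v S) u)" if "w \<in> reach S v" for w
      using that unfolding reach_def[of S v] mem_Collect_eq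
    proof (induction rule: econn_induct)
      case refl show ?case by simp
    next
      case (step a b f)
      have f: "f \<in> A" "src f \<notin> S" "tgt f \<notin> S" using step.hyps(2) by auto
      have bS: "b \<notin> S" using f step.hyps(3) by auto
      show ?case
      proof (cases "b = v")
        case False
        show ?thesis
        proof (cases "a = v")
          case True
          then have "b \<in> ?N" using f step.hyps(3) False bS by (auto simp: nb_def)
          moreover have "b \<in> reach (insert v S) b" by (simp add: reach_def)
          ultimately show ?thesis by blast
        next
          case av: False
          then obtain u where u: "u \<in> ?N" "a \<in> reach (insert v S) u" using step.IH by blast
          have "f \<in> {f\<in>A. src f \<notin> insert v S \<and> tgt f \<notin> insert v S}"
            using f step.hyps(3) av False by auto
          from econn_edge[OF this, of src tgt]
          have "econn src tgt {f\<in>A. src f \<notin> insert v S \<and> tgt f \<notin> insert v S} a b"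
            using step.hyps(3) by (auto dest: econn_sym)
          then have "b \<in> reach (insert v S) u" using u(2) unfolding reach_def mem_Collect_eq by (blast intro: econn_trans)
          then show ?thesis using u(1) by blast
        qed
      qed simp
    qed
    then have "reach S v \<subseteq> insert v (\<Union>u\<in>?N. reach (insert v S) u)" by blast
    moreover have "finite (insert v (\<Union>u\<in>?N. reach (insert v S) u))" using finN no by auto
    ultimately show False using v(2) finite_subset by blast
  qed
  \<comment> \<open>A state pairs the set of vertices already used with the current vertex.\<close>
  define ok where "ok p \<longleftrightarrow> snd p \<notin> fst p \<and> infinite (reach (fst p) (snd p))" for p :: "'v set \<times> 'v"
  have "\<exists>p. \<forall>n. ok (p n) \<and> (fst (p (Suc n)) = insert (snd (p n)) (fst (p n)) \<and> nb (snd (p n)) (snd (p (Suc n))))"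
  proof (rule dependent_nat_choice)
    show "\<exists>p. ok p" by (rule exI[of _ "({}, r)"]) (use inf in \<open>simp add: ok_def reach_def\<close>)
    fix p n assume "ok p"
    then obtain u where "nb (snd p) u" "u \<notin> insert (snd p) (fst p)" "infinite (reach (insert (snd p) (fst p)) u)"
      using step[of "snd p" "fst p"] by (auto simp: ok_def)
    then show "\<exists>q. ok q \<and> (fst q = insert (snd p) (fst p) \<and> nb (snd p) (snd q))"
      by (intro exI[of _ "(insert (snd p) (fst p), u)"]) (simp add: ok_def)
  qed
  then obtain p where p: "\<And>n. ok (p n)" "\<And>n. fst (p (Suc n)) = insert (snd (p n)) (fst (p n))"
    "\<And>n. nb (snd (p n)) (snd (p (Suc n)))" by blast
  have mem: "snd (p i) \<in> fst (p j)" if "i < j" for i j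
    using that by (induction j) (auto simp: p(2) less_Suc_eq)
  have "inj (\<lambda>n. snd (p n))"
  proof (rule injI)
    fix i j assume eq: "snd (p i) = snd (p j)"
    have "snd (p i) \<noteq> snd (p j)" if "i < j" for i j
      using mem[OF that] p(1)[of j] by (auto simp: ok_def)
    then show "i = j" using eq by (metis linorder_neqE_nat)
  qed
  moreover have "\<exists>f\<in>A. src f = snd (p i) \<and> tgt f = snd (p (Suc i)) \<or> src f = snd (p (Suc i)) \<and> tgt f = snd (p i)" for i
    using p(3)[of i] unfolding nb_def .
  ultimately show ?thesis by (rule that)
qed

definition path_edge :: "('e \<Rightarrow> 'v) \<Rightarrow> ('e \<Rightarrow> 'v) \<Rightarrow> 'e \<Rightarrow> 'v \<Rightarrow> 'v \<Rightarrow> bool" where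
  "path_edge src tgt f u v \<longleftrightarrow> src f = u \<and> tgt f = v \<or> src f = v \<and> tgt f = u"

text \<open>Cutting the edge \<open>x i - x (i+1)\<close> leaves a finite part containing \<open>y 0\<close>, once \<open>i\<close> is large;
  the ray \<open>y\<close> has to leave it through that edge.\<close>

lemma rays_equivalent:
  fixes src tgt :: "'e \<Rightarrow> 'v"
  assumes acyclic: "\<And>f. f \<in> A \<Longrightarrow> \<not> econn src tgt (A - {f}) (src f) (tgt f)"
    and sided: "\<And>f. f \<in> A \<Longrightarrow> finite {v. econn src tgt (A - {f}) (src f) v} \<or> finite {v. econn src tgt (A - {f}) (tgt f) v}"
    and x: "inj x" "\<And>i. \<exists>f\<in>A. path_edge src tgt f (x i) (x (Suc i))"
    and y: "inj y" "\<And>i. \<exists>f\<in>A. path_edge src tgt f (y i) (y (Suc i))"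
    and conn: "econn src tgt A (x 0) (y 0)"
  shows "finite (range x - range y)"
proof -
  obtain f where f: "\<And>i. f i \<in> A" "\<And>i. path_edge src tgt (f i) (x i) (x (Suc i))" using x(2) by metis
  have f_inj: "f i \<noteq> f j" if "i \<noteq> j" for i j
  proof
    assume "f i = f j"
    then have "x i = x j \<and> x (Suc i) = x (Suc j) \<or> x i = x (Suc j) \<and> x (Suc i) = x j"
      using f(2)[of i] f(2)[of j] by (auto simp: path_edge_def)
    then show False using x(1) that by (auto simp: inj_eq)
  qed
  define C where "C i = {v. econn src tgt (A - {f i}) (x i) v}" for i
  define D where "D i = {v. econn src tgt (A - {f i}) (x (Suc i)) v}" for i
  have stepD: "econn src tgt (A - {f i}) (x j) (x (Suc j))" if "j \<noteq> i" for i j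
  proof -
    have "f j \<in> A - {f i}" using f_inj[OF that] f(1) by auto
    from econn_edge[OF this, of src tgt] show ?thesis using f(2)[of j] by (auto simp: path_edge_def dest: econn_sym)
  qed
  have "x (Suc i + k) \<in> D i" for i k
  proof (induction k)
    case (Suc k)
    then show ?case using stepD[of "Suc i + k" i] econn_trans[of src tgt "A - {f i}"] by (simp add: D_def)
  qed (simp add: D_def)
  then have "(\<lambda>k. x (Suc i + k)) ` UNIV \<subseteq> D i" for i by blast
  moreover have "inj (\<lambda>k. x (Suc i + k))" for i
    by (rule injI) (drule injD[OF x(1)], simp)
  then have "infinite ((\<lambda>k. x (Suc i + k)) ` UNIV)" for i by (rule range_inj_infinite)
  ultimately have infD: "infinite (D i)" for i by (rule infinite_super)
  \<comment> \<open>The side of \<open>x (Suc i)\<close> contains the rest of the ray, so the finite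
    side granted by \<open>sided\<close> is that of \<open>x i\<close>.\<close>
  have finC: "finite (C i)" for i
    using sided[OF f(1)[of i]] infD[of i] f(2)[of i] by (auto simp: C_def D_def path_edge_def)
  have sepC: "x (Suc i) \<notin> C i" for i
    using acyclic[OF f(1)[of i]] f(2)[of i] by (auto simp: C_def path_edge_def dest: econn_sym)
  have x0C: "x 0 \<in> C i" for i
  proof -
    have "j \<le> i \<Longrightarrow> econn src tgt (A - {f i}) (x 0) (x j)" for j
    proof (induction j)
      case (Suc j)
      then have "econn src tgt (A - {f i}) (x 0) (x j)" "econn src tgt (A - {f i}) (x j) (x (Suc j))"
        by (auto intro: stepD)
      then show ?case by (rule econn_trans)
    qed simp
    from this[of i] show ?thesis by (auto simp: C_def intro: econn_sym)
  qed
  \<comment> \<open>A finite connection from \<open>x 0\<close> to \<open>y 0\<close>. It avoids all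
    but finitely many \<open>f i\<close>, and cutting an avoided one leaves \<open>y 0\<close> on
    the finite side.\<close>
  obtain S where S: "finite S" "S \<subseteq> A" "econn src tgt S (x 0) (y 0)" using econn_finite[OF conn] by blast
  have "finite {i. f i \<in> S}"
    by (rule finite_vimageI[OF S(1), of f, unfolded vimage_def]) (use f_inj in \<open>auto simp: inj_def\<close>)
  then have "finite (x ` {i. f i \<in> S})" by simp
  moreover have "range x - range y \<subseteq> x ` {i. f i \<in> S}"
  proof
    fix v assume v: "v \<in> range x - range y"
    then obtain i where i: "v = x i" by blast
    show "v \<in> x ` {i. f i \<in> S}"
    proof (cases "f i \<in> S")
      case False
      then have "econn src tgt (A - {f i}) (x 0) (y 0)" using S by (auto elim!: econn_mono)
      then have y0: "y 0 \<in> C i" using x0C[of i] by (auto simp: C_def intro: econn_trans)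
      have "\<not> range y \<subseteq> C i" using finite_subset[OF _ finC] range_inj_infinite[OF y(1)] by blast
      then obtain m where m: "y m \<notin> C i" by blast
      have "\<exists>j. y j \<in> C i \<and> y (Suc j) \<notin> C i"
      proof (rule ccontr)
        assume n: "\<nexists>j. y j \<in> C i \<and> y (Suc j) \<notin> C i"
        have "y k \<in> C i" for k by (induction k) (use y0 n in auto)
        then show False using m by blast
      qed
      then obtain j where j: "y j \<in> C i" "y (Suc j) \<notin> C i" by blast
      obtain k where k: "k \<in> A" "path_edge src tgt k (y j) (y (Suc j))" using y(2) by blast
      have "k = f i"
      proof (rule ccontr)
        assume "k \<noteq> f i"
        then have "econn src tgt (A - {f i}) (src k) (tgt k)" using k(1) by (intro econn_edge) auto
        then have "econn src tgt (A - {f i}) (y j) (y (Suc j))" using k(2) by (auto simp: path_edge_def dest: econn_sym)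
        then show False using j by (auto simp: C_def intro: econn_trans)
      qed
      then have "y j = x i \<or> y j = x (Suc i)" using k(2) f(2)[of i] by (auto simp: path_edge_def)
      then have "y j = x i" using j(1) sepC by auto
      then show ?thesis using v i by (metis DiffD2 rangeI)
    qed (use i in blast)
  qed
  ultimately show ?thesis using finite_subset by blast
qed

section \<open>Ends of a component of a fixed configuration\<close>

context infinite_net
begin

text \<open>By \<open>inf\<close> a component cannot be finite: an open edge would leave it, against
  maximality. So it contains a ray and has at least one end; \<open>rays_equivalent\<close> in both
  directions gives at most one.\<close>

lemma one_end:
  fixes \<omega> :: "'e \<Rightarrow> bool"
  defines "A \<equiv> {f\<in>arcs G. \<omega> f}"
  assumes acyclic: "\<And>f. f \<in> A \<Longrightarrow> \<not> ends_conn G (A - {f}) (tail G f) (head G f)"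
    and sided: "\<And>f. f \<in> A \<Longrightarrow> finite {v. ends_conn G (A - {f}) (tail G f) v} \<or>
      finite {v. ends_conn G (A - {f}) (head G f) v}"
    and inf: "\<And>K. finite K \<Longrightarrow> K \<noteq> {} \<Longrightarrow> K \<subseteq> verts G \<Longrightarrow> A \<inter> edge_boundary G K \<noteq> {}"
    and T: "T \<in> components_of_graph (open_subgraph G \<omega>)"
  shows "card (ends_of_tree T) = 1"
proof -
  let ?F = "open_subgraph G \<omega>"
  have F: "verts ?F = verts G" "arcs ?F = A" "tail ?F = tail G" "head ?F = head G"
    by (auto simp: open_subgraph_def A_def)
  have max: "pre_digraph.max_subgraph ?F Digraph_Component.connected T"
    using T by (simp add: components_of_graph_def)
  have sub: "subgraph T ?F" and con: "Digraph_Component.connected T"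
    and maximal: "\<And>H. subgraph T H \<Longrightarrow> subgraph H ?F \<Longrightarrow> Digraph_Component.connected H \<Longrightarrow> H = T"
    using max unfolding pre_digraph.max_subgraph_def by blast+
  interpret T: wf_digraph T using sub by (simp add: subgraph_def)
  interpret F: wf_digraph ?F using sub by (simp add: subgraph_def)
  have ends: "tail T = tail G" "head T = head G" and TA: "arcs T \<subseteq> A" and TV: "verts T \<subseteq> verts G"
    using sub F by (auto simp: subgraph_def compatible_def)
  have T_conn: "ends_conn G (arcs T) u v" if "u \<in> verts T" "v \<in> verts T" for u v
    using con that unfolding T.connected_iff_econn ends by blast
  have T_ne: "verts T \<noteq> {}" using con unfolding T.connected_iff_econn by blast
  \<comment> \<open>The component with \<open>f\<close> and its ends added is again connected and
    open, so by maximality it is the component itself.\<close>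
  have closed: "f \<in> arcs T" if f: "f \<in> A" and touch: "tail G f \<in> verts T \<or> head G f \<in> verts T" for f
  proof -
    let ?H = "\<lparr>verts = verts T \<union> {tail G f, head G f}, arcs = insert f (arcs T), tail = tail T, head = head T\<rparr>"
    have fG: "f \<in> arcs G" using f by (simp add: A_def)
    interpret H: wf_digraph ?H
      by unfold_locales (auto simp: ends[symmetric])
    have 1: "subgraph T ?H" using T.wf_digraph H.wf_digraph by (auto simp: subgraph_def compatible_def)
    have 2: "subgraph ?H ?F" using H.wf_digraph F.wf_digraph TA TV f fG
      by (auto simp: subgraph_def compatible_def F ends)
    obtain u where u: "u \<in> verts T" "u = tail G f \<or> u = head G f" using touch by blast
    have fe: "ends_conn G (insert f (arcs T)) (tail G f) (head G f)" by (rule econn_edge) simp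
    have *: "ends_conn G (insert f (arcs T)) u v" if "v \<in> verts ?H" for v
    proof (cases "v \<in> verts T")
      case True
      show ?thesis by (rule econn_mono[OF T_conn[OF u(1) True]]) blast
    next
      case False
      then have "v = tail G f \<or> v = head G f" using that by simp
      then show ?thesis using u(2) fe by (auto dest: econn_sym)
    qed
    have "ends_conn G (insert f (arcs T)) a b" if "a \<in> verts ?H" "b \<in> verts ?H" for a b
      by (rule econn_trans[OF econn_sym[OF *[OF that(1)]] *[OF that(2)]])
    then have "Digraph_Component.connected ?H" unfolding H.connected_iff_econn by (simp add: ends)
    then have "?H = T" using maximal 1 2 by blast
    then show "f \<in> arcs T" by (metis insertI1 pre_digraph.select_convs(2))
  qed
  have T_inf: "infinite (verts T)"
  proof
    assume "finite (verts T)"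
    then obtain f where f: "f \<in> A" "f \<in> edge_boundary G (verts T)" using inf[OF _ T_ne TV] by blast
    then have "f \<in> arcs T" using closed by (auto simp: edge_boundary_def)
    then have "tail G f \<in> verts T" "head G f \<in> verts T" using ends T.wellformed by metis+
    then show False using f(2) by (simp add: edge_boundary_def)
  qed
  have joins: "joins T f u v \<longleftrightarrow> f \<in> arcs T \<and> path_edge (tail G) (head G) f u v" for f u v
    by (simp add: joins_def path_edge_def ends)
  obtain r where r: "r \<in> verts T" using T_ne by blast
  have "finite {f\<in>arcs T. tail G f = v \<or> head G f = v}" for v
    by (rule finite_subset[OF _ finite_touch[of "{v}"]]) (use TA in \<open>auto simp: A_def touch_def\<close>)
  moreover have "infinite {v. ends_conn G (arcs T) r v}"
    using T_conn[OF r] T_inf finite_subset[of "verts T"] by blast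
  ultimately obtain x0 where "inj x0" "\<And>i. \<exists>f\<in>arcs T. tail G f = x0 i \<and> head G f = x0 (Suc i) \<or>
      tail G f = x0 (Suc i) \<and> head G f = x0 i"
    by (rule infinite_ray[of "arcs T" "tail G" "head G" r]) blast
  then have x0: "x0 \<in> rays T" unfolding rays_def mem_Collect_eq joins path_edge_def by blast
  have ray: "inj x" "\<And>i. \<exists>f\<in>A. path_edge (tail G) (head G) f (x i) (x (Suc i))" "x 0 \<in> verts T" if "x \<in> rays T" for x
  proof -
    show "inj x" using that by (simp add: rays_def)
    have e: "\<exists>f\<in>arcs T. path_edge (tail G) (head G) f (x i) (x (Suc i))" for i
      using that unfolding rays_def joins by blast
    then show "\<exists>f\<in>A. path_edge (tail G) (head G) f (x i) (x (Suc i))" for i using TA by blast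
    show "x 0 \<in> verts T" using e[of 0] T.tail_in_verts T.head_in_verts unfolding path_edge_def ends by metis
  qed
  have "finite (range x - range y)" if "x \<in> rays T" "y \<in> rays T" for x y
  proof (rule rays_equivalent[OF acyclic sided])
    show "inj x" "\<And>i. \<exists>f\<in>A. path_edge (tail G) (head G) f (x i) (x (Suc i))"
      "inj y" "\<And>i. \<exists>f\<in>A. path_edge (tail G) (head G) f (y i) (y (Suc i))"
      using ray that by blast+
    show "ends_conn G A (x 0) (y 0)" by (rule econn_mono[OF T_conn TA]) (use ray that in blast)+
  qed
  then have "{(x, y) \<in> rays T \<times> rays T. finite ((range x - range y) \<union> (range y - range x))} = rays T \<times> rays T"
    by auto
  then have "ends_of_tree T = {rays T}"
    unfolding ends_of_tree_def using x0 by (auto simp: quotient_def)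
  then show ?thesis by simp
qed

end

subsection \<open>One end\<close>

context infinite_net
begin

lemma connected_induced_iff:
  "Digraph_Component.connected (G \<restriction> K) \<longleftrightarrow>
     K \<noteq> {} \<and> (\<forall>a\<in>K. \<forall>b\<in>K. ends_conn G {f\<in>arcs G. tail G f \<in> K \<and> head G f \<in> K} a b)"
proof -
  interpret I: wf_digraph "G \<restriction> K" by (rule wellformed_induce_subgraph)
  show ?thesis unfolding I.connected_iff_econn by simp
qed

lemma connected_singleton: "v \<in> verts G \<Longrightarrow> Digraph_Component.connected (G \<restriction> {v})"
  unfolding connected_induced_iff by simp

text \<open>Provides connected sets of arbitrarily large volume, so that \<open>kappa\<close> is
  never an infimum over the empty set.\<close>

lemma connected_of_card:
  "\<exists>K. K \<subseteq> verts G \<and> finite K \<and> Digraph_Component.connected (G \<restriction> K) \<and> card K = Suc n"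
proof (induction n)
  case 0
  obtain v where "v \<in> verts G" using inf_G by (metis ex_in_conv finite.emptyI)
  then show ?case using connected_singleton by (intro exI[of _ "{v}"]) simp
next
  case (Suc n)
  then obtain K where K: "K \<subseteq> verts G" "finite K" "Digraph_Component.connected (G \<restriction> K)" "card K = Suc n" by blast
  then have "K \<noteq> {}" by auto
  then obtain f where "f \<in> edge_boundary G K" using boundary_nonempty K by blast
  then have f: "f \<in> arcs G" "(tail G f \<in> K) \<noteq> (head G f \<in> K)" by (simp_all add: edge_boundary_def)
  obtain u v where uv: "u \<in> K" "v \<notin> K" "v \<in> verts G"
    "tail G f = u \<and> head G f = v \<or> tail G f = v \<and> head G f = u"
  proof (cases "tail G f \<in> K")
    case True
    then show ?thesis using f that[of "tail G f" "head G f"] by simp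
  next
    case False
    then show ?thesis using f that[of "head G f" "tail G f"] by simp
  qed
  let ?E = "{f\<in>arcs G. tail G f \<in> insert v K \<and> head G f \<in> insert v K}"
  have "f \<in> ?E" using uv f(1) by auto
  from econn_edge[OF this, of "tail G" "head G"] have fe: "ends_conn G ?E u v" using uv(4) by (auto dest: econn_sym)
  have *: "ends_conn G ?E u a" if "a \<in> insert v K" for a
  proof (cases "a = v")
    case False
    then have "ends_conn G {f\<in>arcs G. tail G f \<in> K \<and> head G f \<in> K} u a"
      using that K(3) uv(1) unfolding connected_induced_iff by blast
    then show ?thesis by (rule econn_mono) blast
  qed (use fe in simp)
  have "ends_conn G ?E a b" if "a \<in> insert v K" "b \<in> insert v K" for a b
    by (rule econn_trans[OF econn_sym[OF *[OF that(1)]] *[OF that(2)]])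
  then have "Digraph_Component.connected (G \<restriction> insert v K)" unfolding connected_induced_iff by blast
  then show ?case using K uv by (intro exI[of _ "insert v K"]) simp
qed

text \<open>Single vertices have boundary, hence volume, at least \<open>s 0\<close>. So large
  connected sets have large volume, \<open>kappa\<close> is finite, and everything can be moved to
  the reals. Passing from steps with \<open>\<kappa> / 2\<close> to steps with
  \<open>\<kappa> / 8\<close> costs a factor 4 in the series.\<close>

lemma isoperimetric_net_exists:
  fixes s :: "nat \<Rightarrow> ennreal"
  assumes s0: "s 0 = (INF t\<in>{0<..<\<infinity>}. kappa G c t)"
    and s_Suc: "\<And>k. s (Suc k) = s k + kappa G c (s k) / 2"
    and s0_pos: "s 0 > 0"
    and fin_sum: "(\<Sum>k. 1 / kappa G c (s k)) < \<infinity>"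
  shows "\<exists>\<kappa> \<sigma>0 \<sigma>. isoperimetric_net G c \<kappa> \<sigma>0 \<sigma>"
proof -
  have kap_le: "kappa G c (ennreal t) \<le> ennreal (bd K)"
    if "K \<subseteq> verts G" "finite K" "Digraph_Component.connected (G \<restriction> K)" "t \<le> vol G c K" for K t
    unfolding kappa_def bd_def using that by (intro INF_lower) (auto intro: ennreal_leI)
  have s0_le: "s 0 \<le> kappa G c (ennreal t)" if "0 < t" for t :: real
    unfolding s0 using that by (intro INF_lower) (auto simp: ennreal_less_top)
  have vol_pos: "0 < vol G c K" if "K \<subseteq> verts G" "finite K" "K \<noteq> {}" for K
    using bd_pos[OF that] sum_boundary_le_vol[OF that(2)] by linarith
  have s0_bd: "s 0 \<le> ennreal (bd {v})" if v: "v \<in> verts G" for v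
  proof -
    have "s 0 \<le> kappa G c (ennreal (vol G c {v}))" using vol_pos[of "{v}"] v by (intro s0_le) auto
    also have "\<dots> \<le> ennreal (bd {v})" using connected_singleton[OF v] v by (intro kap_le) auto
    finally show ?thesis .
  qed
  obtain v0 where v0: "v0 \<in> verts G" using inf_G by (metis ex_in_conv finite.emptyI)
  define z where "z = enn2real (s 0)"
  have "s 0 < \<top>" using s0_bd[OF v0] by (rule le_less_trans) (simp add: ennreal_less_top)
  then have z: "s 0 = ennreal z" by (simp add: z_def)
  have z_pos: "0 < z" using s0_pos unfolding z by simp
  have z_vol: "z \<le> vol G c {v}" if "v \<in> verts G" for v
    using s0_bd[OF that] bd_nonneg[of "{v}"] sum_boundary_le_vol[of "{v}"] unfolding z by (simp add: ennreal_le_iff)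
  have card_vol: "z * real (card K) \<le> vol G c K" if "K \<subseteq> verts G" "finite K" for K
  proof -
    have "vol G c K = (\<Sum>v\<in>K. vol G c {v})" by (simp add: vol_def)
    also have "\<dots> \<ge> (\<Sum>v\<in>K. z)" by (rule sum_mono) (use z_vol that in blast)
    finally show ?thesis by (simp add: mult.commute)
  qed
  have kap_fin: "kappa G c (ennreal t) < \<top>" for t
  proof -
    obtain n :: nat where n: "t / z < real n" using reals_Archimedean2 by blast
    obtain K where K: "K \<subseteq> verts G" "finite K" "Digraph_Component.connected (G \<restriction> K)" "card K = Suc n"
      using connected_of_card by blast
    have "t \<le> z * real n" using n z_pos by (simp add: field_simps)
    also have "\<dots> \<le> z * real (card K)" using K(4) z_pos by (intro mult_left_mono) auto
    also have "\<dots> \<le> vol G c K" using card_vol K by blast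
    finally have "kappa G c (ennreal t) \<le> ennreal (bd K)" using kap_le K by blast
    then show ?thesis by (rule le_less_trans) (simp add: ennreal_less_top)
  qed
  define \<kappa> where "\<kappa> t = enn2real (kappa G c (ennreal t))" for t
  have \<kappa>: "kappa G c (ennreal t) = ennreal (\<kappa> t)" for t using kap_fin[of t] by (simp add: \<kappa>_def)
  have \<kappa>_nonneg: "0 \<le> \<kappa> t" for t by (simp add: \<kappa>_def)
  have \<kappa>_ge: "z \<le> \<kappa> t" if "0 < t" for t
    using s0_le[OF that] \<kappa>_nonneg[of t] unfolding z \<kappa> by (simp add: ennreal_le_iff)
  have \<kappa>_mono: "\<kappa> t \<le> \<kappa> u" if "t \<le> u" for t u
  proof -
    have "kappa G c (ennreal t) \<le> kappa G c (ennreal u)"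
      unfolding kappa_def by (rule INF_superset_mono) (use ennreal_leI[OF that] order_trans in auto)
    then show ?thesis unfolding \<kappa> using \<kappa>_nonneg by (simp add: ennreal_le_iff)
  qed
  define r where "r = rec_nat z (\<lambda>_ a. a + \<kappa> a / 2)"
  have r: "r 0 = z" "r (Suc k) = r k + \<kappa> (r k) / 2" for k by (simp_all add: r_def)
  have r_ge: "z \<le> r k" for k
    by (induction k) (use \<kappa>_nonneg in \<open>auto simp: r intro: order_trans add_increasing2\<close>)
  have r_pos: "0 < r k" for k using r_ge[of k] z_pos by linarith
  have s_r: "s k = ennreal (r k)" for k
  proof (induction k)
    case (Suc k)
    have "ennreal (\<kappa> (r k)) / 2 = ennreal (\<kappa> (r k) / 2)" using divide_ennreal[of "\<kappa> (r k)" 2] \<kappa>_nonneg by simp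
    then have "s (Suc k) = ennreal (r k) + ennreal (\<kappa> (r k) / 2)" by (simp add: s_Suc Suc \<kappa>)
    also have "\<dots> = ennreal (r (Suc k))"
      unfolding r(2) using r_pos[of k] \<kappa>_nonneg[of "r k"] by (subst ennreal_plus) auto
    finally show ?case .
  qed (simp add: z r)
  have \<kappa>r: "z \<le> \<kappa> (r k)" for k using \<kappa>_ge r_pos by blast
  have \<kappa>r_pos: "0 < \<kappa> (r k)" for k using \<kappa>r[of k] z_pos by linarith
  have "1 / kappa G c (s k) = ennreal (1 / \<kappa> (r k))" for k
    using \<kappa>r_pos[of k] divide_ennreal[of 1 "\<kappa> (r k)"] by (simp add: s_r \<kappa>)
  then have "(\<Sum>k. ennreal (1 / \<kappa> (r k))) \<noteq> \<top>" using fin_sum by (simp add: less_top)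
  then have sum_r: "summable (\<lambda>k. 1 / \<kappa> (r k))"
    by (rule summable_suminf_not_top[rotated]) (use \<kappa>_nonneg in simp)
  define \<sigma> where "\<sigma> = rec_nat z (\<lambda>_ a. a + \<kappa> a / 8)"
  have \<sigma>: "\<sigma> 0 = z" "\<sigma> (Suc k) = \<sigma> k + \<kappa> (\<sigma> k) / 8" for k by (simp_all add: \<sigma>_def)
  have \<sigma>_step: "\<sigma> k \<le> \<sigma> (Suc k)" for k using \<kappa>_nonneg by (simp add: \<sigma>)
  have \<sigma>_mono: "\<sigma> j \<le> \<sigma> k" if "j \<le> k" for j k using \<sigma>_step that by (rule lift_Suc_mono_le)
  \<comment> \<open>By monotonicity of \<open>\<kappa>\<close>, each of four consecutive steps of
    \<open>\<sigma>\<close> is at least a quarter of the corresponding step of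
    \<open>r\<close>.\<close>
  have \<sigma>_r: "r k \<le> \<sigma> (4 * k)" for k
  proof (induction k)
    case (Suc k)
    have inc: "\<kappa> (r k) / 8 \<le> \<sigma> (Suc j) - \<sigma> j" if "4 * k \<le> j" for j
      using \<kappa>_mono[OF order_trans[OF Suc \<sigma>_mono[OF that]]] by (simp add: \<sigma>(2))
    have "4 * Suc k = Suc (Suc (Suc (Suc (4 * k))))" by simp
    then show ?case
      using inc[of "4 * k"] inc[of "Suc (4 * k)"] inc[of "Suc (Suc (4 * k))"] inc[of "Suc (Suc (Suc (4 * k)))"] Suc
      by (simp add: r(2) del: mult_Suc_right)
  qed (simp add: r \<sigma>)
  have \<sigma>_bound: "1 / \<kappa> (\<sigma> j) \<le> 1 / \<kappa> (r (j div 4))" for j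
  proof -
    have "r (j div 4) \<le> \<sigma> j" using \<sigma>_r[of "j div 4"] \<sigma>_mono[of "4 * (j div 4)" j] by simp
    then have "\<kappa> (r (j div 4)) \<le> \<kappa> (\<sigma> j)" by (rule \<kappa>_mono)
    then show ?thesis using \<kappa>r_pos[of "j div 4"] by (intro divide_left_mono) auto
  qed
  have "summable (\<lambda>j. 1 / \<kappa> (\<sigma> j))"
  proof (rule summableI_nonneg_bounded)
    show "0 \<le> 1 / \<kappa> (\<sigma> j)" for j using \<kappa>_nonneg by simp
    fix n
    have "(\<Sum>j<n. 1 / \<kappa> (\<sigma> j)) \<le> (\<Sum>j<n * 4. 1 / \<kappa> (\<sigma> j))"
      using \<kappa>_nonneg by (intro sum_mono2) auto
    also have "\<dots> \<le> (\<Sum>j<n * 4. 1 / \<kappa> (r (j div 4)))" by (rule sum_mono) (rule \<sigma>_bound)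
    also have "\<dots> = (\<Sum>m<n. \<Sum>j=m*4..<m*4+4. 1 / \<kappa> (r (j div 4)))" by (rule sum.nat_group[symmetric])
    also have "\<dots> = (\<Sum>m<n. 4 * (1 / \<kappa> (r m)))"
    proof (rule sum.cong[OF refl])
      fix m
      have "j div 4 = m" if "j \<in> {m*4..<m*4+4}" for j :: nat using that by auto
      then have "(\<Sum>j=m*4..<m*4+4. 1 / \<kappa> (r (j div 4))) = (\<Sum>j=m*4..<m*4+4. 1 / \<kappa> (r m))"
        by (intro sum.cong) auto
      then show "(\<Sum>j=m*4..<m*4+4. 1 / \<kappa> (r (j div 4))) = 4 * (1 / \<kappa> (r m))" by simp
    qed
    also have "\<dots> = 4 * (\<Sum>m<n. 1 / \<kappa> (r m))" by (rule sum_distrib_left[symmetric])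
    also have "\<dots> \<le> 4 * (\<Sum>m. 1 / \<kappa> (r m))"
      by (intro mult_left_mono sum_le_suminf[OF sum_r]) (use \<kappa>_nonneg in auto)
    finally show "(\<Sum>j<n. 1 / \<kappa> (\<sigma> j)) \<le> 4 * (\<Sum>m. 1 / \<kappa> (r m))" .
  qed
  moreover have "\<kappa> (vol G c K) \<le> (\<Sum>e\<in>edge_boundary G K. c e)"
    if "K \<subseteq> verts G" "finite K" "Digraph_Component.connected (G \<restriction> K)" for K
    using kap_le[OF that order_refl] bd_nonneg[of K] unfolding \<kappa> by (simp add: ennreal_le_iff bd_def)
  ultimately have "isoperimetric_net G c \<kappa> z \<sigma>"
    by unfold_locales (use z_pos \<kappa>_ge \<kappa>_mono \<sigma> in auto)
  then show ?thesis by blast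
qed

end

context isoperimetric_net
begin

text \<open>If the component under the edges touching \<open>K\<close> stayed inside
  \<open>K\<close>, it would be closed under all edges of \<open>T - {e}\<close>, hence be the whole
  component and finite.\<close>

lemma far_infinite:
  assumes x: "x \<in> K" "finite K" and inf: "infinite {v. ends_conn G (T - {e}) x v}" and T: "T \<subseteq> arcs G"
  shows "far e K T x"
proof (rule ccontr)
  assume nf: "\<not> far e K T x"
  define Y where "Y = {v. ends_conn G (T \<inter> touch K - {e}) x v}"
  have YK: "Y \<subseteq> K" using nf by (auto simp: far_def Y_def)
  have "v \<in> Y" if v: "ends_conn G (T - {e}) x v" for v
  proof -
    have "(x \<in> Y) = (v \<in> Y)"
    proof (rule econn_const[OF v])
      fix f assume f: "f \<in> T - {e}"
      show "(tail G f \<in> Y) = (head G f \<in> Y)"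
      proof (cases "f \<in> touch K")
        case True
        then have "f \<in> T \<inter> touch K - {e}" using f by auto
        then show ?thesis unfolding Y_def mem_Collect_eq by (intro econn_cong_right econn_edge)
      next
        case False
        then show ?thesis using YK f T by (auto simp: touch_def)
      qed
    qed
    then show ?thesis by (simp add: Y_def)
  qed
  then have "{v. ends_conn G (T - {e}) x v} \<subseteq> K" using YK by blast
  then show False using inf x(2) finite_subset by blast
qed

lemma cut_sequence:
  assumes "finite K0" "K0 \<subseteq> verts G"
  obtains K where "\<And>n. nearmin (K n)" "\<And>n. K n \<subseteq> K (Suc n)" "\<And>n. nbrs (K n) \<subseteq> K (Suc n)" "K0 \<subseteq> K 0"
proof -
  have "\<exists>K. \<forall>n. (nearmin (K n) \<and> K0 \<subseteq> K n) \<and> (K n \<subseteq> K (Suc n) \<and> nbrs (K n) \<subseteq> K (Suc n))"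
  proof (rule dependent_nat_choice)
    show "\<exists>K. nearmin K \<and> K0 \<subseteq> K" using nearmin_exists[OF assms] by blast
    fix K and n :: nat assume K: "nearmin K \<and> K0 \<subseteq> K"
    have fin: "finite (K \<union> nbrs K)" "K \<union> nbrs K \<subseteq> verts G"
      using K finite_touch[of K] by (auto simp: nearmin_def nbrs_def touch_def)
    obtain K' where "K \<union> nbrs K \<subseteq> K'" "nearmin K'" by (rule nearmin_exists[OF fin])
    then show "\<exists>K'. (nearmin K' \<and> K0 \<subseteq> K') \<and> (K \<subseteq> K' \<and> nbrs K \<subseteq> K')" using K by blast
  qed
  then show ?thesis using that by blast
qed

end

section \<open>Almost sure properties of the limit law\<close>

locale wsf_net = isoperimetric_net +
  fixes H :: "nat \<Rightarrow> ('a, 'b) pre_digraph" and P :: "('b \<Rightarrow> bool) measure"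
  assumes exh: "exhaustion G H" and prob_P: "prob_space P" and sets_P: "sets P = sets (config_space (arcs G))"
    and lim_P: "weak_limit (config_topology (arcs G)) (\<lambda>n. config_law (arcs G) (ust (wired G (verts (H n))) c)) P"
begin

interpretation P: prob_space P by (rule prob_P)

abbreviation law :: "nat \<Rightarrow> 'b set pmf" where "law n \<equiv> ust (wired G (verts (H n))) c"

lemma finite_H: "finite (verts (H n))" "finite (arcs (H n))" "verts (H n) \<subseteq> verts G"
proof -
  have h: "subgraph (H n) G" "fin_digraph (H n)" using exh by (auto simp: exhaustion_def)
  then show "verts (H n) \<subseteq> verts G" by (simp add: subgraph_def)
  show "finite (verts (H n))" "finite (arcs (H n))"
    using h(2) by (auto simp: fin_digraph_def fin_digraph_axioms_def)
qed

lemma wired_H: "wired_net G c \<kappa> s0 \<sigma> (verts (H n))"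
  by unfold_locales (rule finite_H)+

lemma countable_arcs: "countable (arcs G)" and countable_verts: "countable (verts G)"
proof -
  have "(\<Union>n. arcs (H n)) = arcs G" "(\<Union>n. verts (H n)) = verts G" using exh by (auto simp: exhaustion_def)
  moreover have "countable (\<Union>n. arcs (H n))"
    by (rule countable_UN[OF countableI_type countable_finite[OF finite_H(2)]])
  moreover have "countable (\<Union>n. verts (H n))"
    by (rule countable_UN[OF countableI_type countable_finite[OF finite_H(1)]])
  ultimately show "countable (arcs G)" "countable (verts G)" by simp_all
qed

lemma eventually_verts:
  assumes "finite F" "F \<subseteq> verts G"
  shows "\<forall>\<^sub>F n in sequentially. F \<subseteq> verts (H n)"
proof -
  have step: "verts (H n) \<subseteq> verts (H (Suc n))" for n using exh by (auto simp: exhaustion_def subgraph_def)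
  have mono: "verts (H m) \<subseteq> verts (H n)" if "m \<le> n" for m n by (rule lift_Suc_mono_le[where f = "\<lambda>n. verts (H n)", OF step that])
  have "\<forall>\<^sub>F n in sequentially. v \<in> verts (H n)" if "v \<in> F" for v
  proof -
    have "v \<in> (\<Union>n. verts (H n))" using that assms(2) exh by (auto simp: exhaustion_def)
    then obtain m where "v \<in> verts (H m)" by blast
    then show ?thesis using mono by (intro eventually_sequentiallyI[of m]) blast
  qed
  then have "\<forall>\<^sub>F n in sequentially. \<forall>v\<in>F. v \<in> verts (H n)" by (simp add: eventually_ball_finite_distrib assms(1))
  then show ?thesis by (rule eventually_mono) blast
qed

lemma cylinder_le:
  assumes S: "finite S" "S \<subseteq> arcs G"
    and ev: "\<forall>\<^sub>F n in sequentially. measure_pmf.prob (law n) {T. Q (T \<inter> S)} \<le> a"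
  shows "measure P (cylinder (arcs G) S Q) \<le> a"
  by (rule tendsto_upperbound[OF cylinder_limit[where Q = Q, OF lim_P sets_P S] ev]) simp

lemma AE_not_cylinder:
  assumes S: "finite S" "S \<subseteq> arcs G"
    and ev: "\<forall>\<^sub>F n in sequentially. measure_pmf.prob (law n) {T. Q (T \<inter> S)} = 0"
  shows "AE \<omega> in P. \<not> Q {f\<in>S. \<omega> f}"
proof -
  have "measure P (cylinder (arcs G) S Q) \<le> 0" by (rule cylinder_le[OF S eventually_mono[OF ev]]) simp
  then have "measure P (cylinder (arcs G) S Q) = 0" using measure_nonneg[of P "cylinder (arcs G) S Q"] by linarith
  moreover have "cylinder (arcs G) S Q \<in> sets P" unfolding sets_P by (rule cylinder_sets[OF S])
  ultimately have "cylinder (arcs G) S Q \<in> null_sets P" by (simp add: null_sets_def P.emeasure_eq_measure)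
  then have "AE \<omega> in P. \<omega> \<notin> cylinder (arcs G) S Q" by (rule AE_not_in)
  then show ?thesis
  proof (rule AE_mp, intro AE_I2 impI)
    fix \<omega> assume "\<omega> \<in> space P" "\<omega> \<notin> cylinder (arcs G) S Q"
    then show "\<not> Q {f\<in>S. \<omega> f}" using sets_eq_imp_space_eq[OF sets_P] by (auto simp: cylinder_def)
  qed
qed

text \<open>A connection in \<open>G\<close> between the ends of \<open>f\<close> that avoids
  \<open>f\<close> remains one after collapsing, so no spanning tree of a wired graph contains all
  of \<open>S\<close>.\<close>

lemma AE_acyclic_finite:
  assumes S: "finite S" "S \<subseteq> arcs G" and f: "f \<in> S" "ends_conn G (S - {f}) (tail G f) (head G f)"
  shows "AE \<omega> in P. \<not> S \<subseteq> {f\<in>S. \<omega> f}"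
proof (rule AE_not_cylinder[OF S], rule always_eventually, rule allI)
  fix n
  interpret N: wired_net G c \<kappa> s0 \<sigma> "verts (H n)" by (rule wired_H)
  have "\<not> S \<subseteq> T" if T: "T \<in> N.ST" for T
  proof
    assume ST: "S \<subseteq> T"
    have "N.conn (T - {f}) (N.col (tail G f)) (N.col (head G f))"
    proof (rule econn_image[OF f(2)])
      fix k assume "k \<in> S - {f}"
      then have "k \<in> T - {f}" using ST by blast
      from econn_edge[OF this, of "tail N.\<Gamma>" "head N.\<Gamma>"]
      show "N.conn (T - {f}) (N.col (tail G k)) (N.col (head G k))" by (simp only: N.tail_wired N.head_wired)
    qed
    then have "N.conn (T - {f}) (tail N.\<Gamma> f) (head N.\<Gamma> f)" by (simp only: N.tail_wired N.head_wired)
    then show False using N.ST_sep[OF T] f(1) ST by blast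
  qed
  then have "N.W (\<lambda>T. S \<subseteq> T \<inter> S) = N.W (\<lambda>T. False)" by (intro N.W_cong) blast
  then show "measure_pmf.prob (law n) {T. S \<subseteq> T \<inter> S} = 0"
    unfolding N.ust_prob by (simp add: N.W_def)
qed

text \<open>Once \<open>K\<close> lies in \<open>verts (H n)\<close>, a spanning tree has to join
  \<open>K\<close> to the wired vertex and so uses a boundary edge.\<close>

lemma AE_boundary:
  assumes K: "finite K" "K \<noteq> {}" "K \<subseteq> verts G"
  shows "AE \<omega> in P. {f\<in>edge_boundary G K. \<omega> f} \<noteq> {}"
proof (rule AE_not_cylinder)
  show "finite (edge_boundary G K)" "edge_boundary G K \<subseteq> arcs G"
    using finite_boundary[OF K(1)] by (auto simp: edge_boundary_def)
  show "\<forall>\<^sub>F n in sequentially. measure_pmf.prob (law n) {T. T \<inter> edge_boundary G K = {}} = 0"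
    using eventually_verts[OF K(1,3)]
  proof eventually_elim
    case (elim n)
    interpret N: wired_net G c \<kappa> s0 \<sigma> "verts (H n)" by (rule wired_H)
    have "T \<inter> edge_boundary G K \<noteq> {}" if T: "T \<in> N.ST" for T
    proof
      assume no: "T \<inter> edge_boundary G K = {}"
      obtain u where u: "u \<in> K" using K by blast
      obtain v where v: "v \<in> verts G" "N.col v = None" by (rule N.col_None)
      have uG: "u \<in> verts G" using u K by blast
      have "(N.col u \<in> Some ` K) = (N.col v \<in> Some ` K)"
      proof (rule econn_const[OF N.ST_conn[OF T N.col_verts[OF uG] N.col_verts[OF v(1)]]])
        fix f assume f: "f \<in> T"
        then have "f \<in> arcs G" using N.ST_sub[OF T] by (auto simp: N.E_iff)
        then have "(tail G f \<in> K) = (head G f \<in> K)" using no f by (auto simp: edge_boundary_def)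
        moreover have "(N.col w \<in> Some ` K) = (w \<in> K)" for w using elim by (auto simp: collapse_def)
        ultimately show "(tail N.\<Gamma> f \<in> Some ` K) = (head N.\<Gamma> f \<in> Some ` K)"
          by (simp only: N.tail_wired N.head_wired)
      qed
      moreover have "N.col u = Some u" using u elim by (auto simp: collapse_def)
      ultimately show False using u v(2) by auto
    qed
    then have "N.W (\<lambda>T. T \<inter> edge_boundary G K = {}) = N.W (\<lambda>T. False)" by (intro N.W_cong) blast
    then show "measure_pmf.prob (law n) {T. T \<inter> edge_boundary G K = {}} = 0"
      unfolding N.ust_prob by (simp add: N.W_def)
  qed
qed

text \<open>For fixed \<open>N\<close> the two-sided event is a cylinder, so its bound passes to the
  limit law with the same constants. Letting \<open>N\<close> grow and then
  \<open>\<epsilon>\<close> tend to 0 makes the intersection \<open>D\<close> null, and by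
  \<open>far_infinite\<close> it contains the case of an open \<open>e\<close> with two infinite
  sides. Loops are left out because they are not edges of the wired graphs.\<close>

lemma AE_one_sided:
  assumes e: "e \<in> arcs G" "tail G e \<noteq> head G e"
  shows "AE \<omega> in P. \<omega> e \<longrightarrow> finite {v. ends_conn G ({f\<in>arcs G. \<omega> f} - {e}) (tail G e) v} \<or>
    finite {v. ends_conn G ({f\<in>arcs G. \<omega> f} - {e}) (head G e) v}"
proof -
  obtain K where K: "\<And>n. nearmin (K n)" "\<And>n. K n \<subseteq> K (Suc n)" "\<And>n. nbrs (K n) \<subseteq> K (Suc n)"
    "{tail G e, head G e} \<subseteq> K 0"
    using cut_sequence[of "{tail G e, head G e}"] e(1) by auto
  have finK: "finite (K n)" for n using K(1)[of n] by (simp add: nearmin_def)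
  have Kmono: "K 0 \<subseteq> K n" for n using K(2) by (rule lift_Suc_mono_le) simp
  have ends: "tail G e \<in> K n" "head G e \<in> K n" for n using K(4) Kmono[of n] by auto
  define S where "S N = insert e (touch (K N))" for N
  have S: "finite (S N)" "S N \<subseteq> arcs G" for N
    using finite_touch[OF finK] e(1) by (auto simp: S_def touch_def)
  have depends: "two_sided e (K N) (T \<inter> S N) = two_sided e (K N) T" for N T
  proof -
    have "T \<inter> S N \<inter> touch (K N) = T \<inter> touch (K N)" "e \<in> S N" by (auto simp: S_def)
    then show ?thesis unfolding two_sided_def far_def by simp
  qed
  define C where "C N = cylinder (arcs G) (S N) (two_sided e (K N))" for N
  have C_sets: "C N \<in> sets P" for N unfolding C_def sets_P by (rule cylinder_sets[OF S])
  have ce: "0 < c e" using e(1) conductance_pos by blast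
  have bound: "measure P (C N) \<le> \<epsilon> + 1 / (real N * gain (c e) (c e / \<epsilon>))" if \<epsilon>: "0 < \<epsilon>" and N: "0 < N" for \<epsilon> N
    unfolding C_def
  proof (rule cylinder_le[OF S])
    have "finite (K N \<union> nbrs (K N))" "K N \<union> nbrs (K N) \<subseteq> verts G"
      using finK[of N] finite_touch[of "K N"] K(1)[of N] by (auto simp: nearmin_def nbrs_def touch_def)
    then have "\<forall>\<^sub>F n in sequentially. K N \<union> nbrs (K N) \<subseteq> verts (H n)" by (rule eventually_verts)
    then show "\<forall>\<^sub>F n in sequentially. measure_pmf.prob (law n) {T. two_sided e (K N) (T \<inter> S N)}
        \<le> \<epsilon> + 1 / (real N * gain (c e) (c e / \<epsilon>))"
    proof eventually_elim
      case (elim n)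
      interpret W: wired_net G c \<kappa> s0 \<sigma> "verts (H n)" by (rule wired_H)
      have eE: "e \<in> W.E" using e ends[of N] elim by (auto simp: W.E_iff collapse_def)
      have "real N * W.W (two_sided e (K N)) \<le> (real N * \<epsilon> + 1 / gain (c e) (c e / \<epsilon>)) * W.W (\<lambda>T. True)"
        by (rule two_sided_bound[where K = K and N = N and ?V0.0 = "verts (H n)", OF K(1,2,3) _ _ finite_H(1,3) _ eE \<epsilon>])
          (use ends elim in \<open>auto simp: nbrs_def\<close>)
      moreover have "0 < W.W (\<lambda>T. True)" by (rule W.W_True_pos)
      moreover have "0 < gain (c e) (c e / \<epsilon>)" using ce \<epsilon> by (intro gain_pos) auto
      ultimately have "W.W (two_sided e (K N)) / W.W (\<lambda>T. True) \<le> \<epsilon> + 1 / (real N * gain (c e) (c e / \<epsilon>))"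
        using N by (simp add: field_simps)
      then show ?case unfolding depends W.ust_prob by simp
    qed
  qed
  define D where "D = (\<Inter>N. C (Suc N))"
  have D_sets: "D \<in> sets P" unfolding D_def using C_sets by blast
  have D_le: "measure P D \<le> \<epsilon>" if \<epsilon>: "0 < \<epsilon>" for \<epsilon>
  proof (rule tendsto_lowerbound)
    have g: "gain (c e) (c e / \<epsilon>) \<noteq> 0" using gain_pos[of "c e" "c e / \<epsilon>"] ce \<epsilon> by simp
    have "(\<lambda>N. \<epsilon> + 1 / (real (Suc N)) * (1 / gain (c e) (c e / \<epsilon>))) \<longlonglongrightarrow> \<epsilon> + 0 * (1 / gain (c e) (c e / \<epsilon>))"
      by (intro tendsto_intros LIMSEQ_Suc[OF lim_1_over_n])
    then show "(\<lambda>N. \<epsilon> + 1 / (real (Suc N) * gain (c e) (c e / \<epsilon>))) \<longlonglongrightarrow> \<epsilon>" by simp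
    have "measure P D \<le> \<epsilon> + 1 / (real (Suc N) * gain (c e) (c e / \<epsilon>))" for N
      using P.finite_measure_mono[of D "C (Suc N)"] C_sets bound[OF \<epsilon>, of "Suc N"] by (force simp: D_def)
    then show "\<forall>\<^sub>F N in sequentially. measure P D \<le> \<epsilon> + 1 / (real (Suc N) * gain (c e) (c e / \<epsilon>))" by simp
  qed simp
  have "measure P D \<le> 0" by (rule field_le_epsilon) (use D_le in simp)
  then have "measure P D = 0" using measure_nonneg[of P D] by linarith
  then have "D \<in> null_sets P" using D_sets by (simp add: null_sets_def P.emeasure_eq_measure)
  then have "AE \<omega> in P. \<omega> \<notin> D" by (rule AE_not_in)
  then show ?thesis
  proof (rule AE_mp, intro AE_I2 impI)
    fix \<omega> assume \<omega>: "\<omega> \<in> space P" "\<omega> \<notin> D" "\<omega> e"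
    show "finite {v. ends_conn G ({f\<in>arcs G. \<omega> f} - {e}) (tail G e) v} \<or>
      finite {v. ends_conn G ({f\<in>arcs G. \<omega> f} - {e}) (head G e) v}"
    proof (rule ccontr)
      assume inf: "\<not> ?thesis"
      have "\<omega> \<in> C N" for N
      proof -
        have "far e (K N) {f\<in>arcs G. \<omega> f} (tail G e)" "far e (K N) {f\<in>arcs G. \<omega> f} (head G e)"
          using far_infinite[OF ends(1) finK] far_infinite[OF ends(2) finK] inf by blast+
        then have "two_sided e (K N) {f\<in>arcs G. \<omega> f}" using e(1) \<omega>(3) by (simp add: two_sided_def)
        then have "two_sided e (K N) ({f\<in>arcs G. \<omega> f} \<inter> S N)" by (simp only: depends)
        also have "{f\<in>arcs G. \<omega> f} \<inter> S N = {f\<in>S N. \<omega> f}" using S(2) by blast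
        finally show ?thesis using \<omega>(1) sets_eq_imp_space_eq[OF sets_P] by (simp add: C_def cylinder_def)
      qed
      then show False using \<omega>(2) by (simp add: D_def)
    qed
  qed
qed

text \<open>A cycle uses finitely many edges, so acyclicity, like the boundary condition, is a
  countable family of almost sure statements and holds for all of them at once.\<close>

lemma AE_one_end:
  "AE \<omega> in P. \<forall>T\<in>components_of_graph (open_subgraph G \<omega>). card (ends_of_tree T) = 1"
proof -
  define \<S> where "\<S> = {S. S \<subseteq> arcs G \<and> finite S}"
  define \<K> where "\<K> = {K. K \<subseteq> verts G \<and> finite K}"
  have cS: "countable \<S>" and cK: "countable \<K>"
    unfolding \<S>_def \<K>_def
    using countable_Collect_finite_subset[OF countable_arcs] countable_Collect_finite_subset[OF countable_verts]
    by (simp_all add: conj_commute)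
  have "AE \<omega> in P. \<forall>S\<in>\<S>. (\<exists>f\<in>S. ends_conn G (S - {f}) (tail G f) (head G f)) \<longrightarrow> \<not> S \<subseteq> {f\<in>S. \<omega> f}"
  proof (rule AE_ball_countable'[OF _ cS])
    fix S assume S: "S \<in> \<S>"
    show "AE \<omega> in P. (\<exists>f\<in>S. ends_conn G (S - {f}) (tail G f) (head G f)) \<longrightarrow> \<not> S \<subseteq> {f\<in>S. \<omega> f}"
    proof (cases "\<exists>f\<in>S. ends_conn G (S - {f}) (tail G f) (head G f)")
      case True
      then obtain f where "f \<in> S" "ends_conn G (S - {f}) (tail G f) (head G f)" by blast
      from AE_acyclic_finite[OF _ _ this] S show ?thesis by (auto simp: \<S>_def)
    qed simp
  qed
  moreover have "AE \<omega> in P. \<forall>K\<in>\<K>. K \<noteq> {} \<longrightarrow> {f\<in>edge_boundary G K. \<omega> f} \<noteq> {}"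
  proof (rule AE_ball_countable'[OF _ cK])
    fix K assume K: "K \<in> \<K>"
    show "AE \<omega> in P. K \<noteq> {} \<longrightarrow> {f\<in>edge_boundary G K. \<omega> f} \<noteq> {}"
    proof (cases "K = {}")
      case False
      have "AE \<omega> in P. {f\<in>edge_boundary G K. \<omega> f} \<noteq> {}"
        by (rule AE_boundary) (use K False in \<open>auto simp: \<K>_def\<close>)
      then show ?thesis by (rule AE_mp) simp
    qed simp
  qed
  moreover have "AE \<omega> in P. \<forall>e\<in>arcs G. tail G e \<noteq> head G e \<longrightarrow> \<omega> e \<longrightarrow>
      finite {v. ends_conn G ({f\<in>arcs G. \<omega> f} - {e}) (tail G e) v} \<or>
      finite {v. ends_conn G ({f\<in>arcs G. \<omega> f} - {e}) (head G e) v}"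
  proof (rule AE_ball_countable'[OF _ countable_arcs])
    fix e assume e: "e \<in> arcs G"
    show "AE \<omega> in P. tail G e \<noteq> head G e \<longrightarrow> \<omega> e \<longrightarrow>
      finite {v. ends_conn G ({f\<in>arcs G. \<omega> f} - {e}) (tail G e) v} \<or>
      finite {v. ends_conn G ({f\<in>arcs G. \<omega> f} - {e}) (head G e) v}"
      using AE_one_sided[OF e] by (cases "tail G e = head G e") auto
  qed
  ultimately show ?thesis
  proof eventually_elim
    case (elim \<omega>)
    show ?case
    proof
      fix T assume T: "T \<in> components_of_graph (open_subgraph G \<omega>)"
      let ?A = "{f\<in>arcs G. \<omega> f}"
      have acyclic: "\<not> ends_conn G (?A - {f}) (tail G f) (head G f)" if f: "f \<in> ?A" for f
      proof
        assume "ends_conn G (?A - {f}) (tail G f) (head G f)"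
        then obtain S where S: "finite S" "S \<subseteq> ?A - {f}" "ends_conn G S (tail G f) (head G f)"
          by (rule econn_finite)
        have "insert f S \<in> \<S>" using S(1,2) f by (auto simp: \<S>_def)
        moreover have "insert f S - {f} = S" using S(2) by auto
        then have "\<exists>k\<in>insert f S. ends_conn G (insert f S - {k}) (tail G k) (head G k)" using S(3) by auto
        ultimately have "\<not> insert f S \<subseteq> {k\<in>insert f S. \<omega> k}" using elim(1) by blast
        then show False using S(2) f by blast
      qed
      show "card (ends_of_tree T) = 1"
      proof (rule one_end[OF _ _ _ T])
        show "\<not> ends_conn G (?A - {f}) (tail G f) (head G f)" if "f \<in> ?A" for f by (rule acyclic[OF that])
        show "finite {v. ends_conn G (?A - {f}) (tail G f) v} \<or> finite {v. ends_conn G (?A - {f}) (head G f) v}"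
          if f: "f \<in> ?A" for f
        proof -
          have "tail G f \<noteq> head G f" using acyclic[OF f] by auto
          then show ?thesis using elim(3) f by blast
        qed
        show "?A \<inter> edge_boundary G K \<noteq> {}" if "finite K" "K \<noteq> {}" "K \<subseteq> verts G" for K
        proof -
          have "{f\<in>edge_boundary G K. \<omega> f} \<noteq> {}" using elim(2) that by (simp add: \<K>_def)
          then show ?thesis by (auto simp: edge_boundary_def)
        qed
      qed
    qed
  qed
qed

end

theorem theorem7p1:
  fixes G :: "('v, 'e) pre_digraph" and c :: "'e \<Rightarrow> real"
    and s :: "nat \<Rightarrow> ennreal" and WSF :: "('e \<Rightarrow> bool) measure"
  assumes "network G c"
    and "infinite (verts G)"
    and "Digraph_Component.connected G"
    and "locally_finite G"
    and "s 0 = (INF t\<in>{0<..<\<infinity>}. kappa G c t)"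
    and "\<And>k. s (Suc k) = s k + kappa G c (s k) / 2"
    and "s 0 > 0"
    and "(\<Sum>k. 1 / kappa G c (s k)) < \<infinity>"
    and "is_wsf G c WSF"
  shows "AE \<omega> in WSF. \<forall>T\<in>components_of_graph (open_subgraph G \<omega>). card (ends_of_tree T) = 1"
proof -
  interpret network G c by (rule assms(1))
  interpret infinite_net G c by unfold_locales (rule assms)+
  obtain \<kappa> \<sigma>0 \<sigma> where I: "isoperimetric_net G c \<kappa> \<sigma>0 \<sigma>"
    using isoperimetric_net_exists[OF assms(5-8)] by blast
  have P: "prob_space WSF" "sets WSF = sets (config_space (arcs G))" using assms(9) by (simp_all add: is_wsf_def)
  obtain H where H: "exhaustion G H"
    "weak_limit (config_topology (arcs G)) (\<lambda>n. config_law (arcs G) (ust (wired G (verts (H n))) c)) WSF"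
    using assms(9) unfolding is_wsf_def by blast
  interpret wsf_net G c \<kappa> \<sigma>0 \<sigma> H WSF
    by (rule wsf_net.intro[OF I wsf_net_axioms.intro[OF H(1) P H(2)]])
  show ?thesis by (rule AE_one_end)
qed

end
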